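(* Let $\mathbb K$ be a commutative semiring with $0\ne1$ and let $S:\Delta^*\to K$ be a formal power series. The following are equivalent: (1) $S$ is an algebraic formal power series; (2) $S=\pi(R)$ for some regular nested word series $R:\mathrm{NW}(\Delta)\to K$; (3) there is a sentence $\varphi\in\mathrm{sRFO}(\mathbb K)$ over the signature of nested words such that $[\![\exists\nu.\varphi]\!]^{\mathrm{nest}}=S$.
   Context: Nested words: $\Delta$ finite alphabet. A nesting relation of width $n$ is a relation $\nu$ on $[n]$ with: $\nu(i,j)\Rightarrow i<j$; $\nu(i,j),\nu(i,j')\Rightarrow j=j'$ and $\nu(i,j),\nu(i',j)\Rightarrow i=i'$; $\nu(i,j),\nu(i',j'),i<i'\Rightarrow j<i'$ or $j'<j$; $\mathrm{Nest}_n$ is their set. A nested word is $(w,\nu)$, $w=a_1\cdots a_n\in\Delta^+$, $\nu\in\mathrm{Nest}_n$; $\mathrm{NW}(\Delta)$ is their set; it is the structure with domain $[n]$, $\mathrm{Lab}_a=\{i:a_i=a\}$, natural order $\le$, binary $\nu$. If $\nu(i,j)$, $i$ is a call and $j$ a return position; others internal. WNWA: $\mathcal A=(Q,\iota,\delta_{call},\delta_{int},\delta_{ret},\kappa)$, $Q$ finite, $\delta_{call},\delta_{int}:Q\times\Delta\times Q\to K$, $\delta_{ret}:Q\times Q\times\Delta\times Q\to K$, $\iota,\kappa:Q\to K$. A run on $(a_1\cdots a_n,\nu)$ is $(q_0,\dots,q_n)$; weight at $j$: $\delta_{call}(q_{j-1},a_j,q_j)$ for a call $j$, $\delta_{int}(q_{j-1},a_j,q_j)$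 for internal $j$, $\delta_{ret}(q_{j-1},q_{i-1},a_j,q_j)$ if $\nu(i,j)$; run weight is the product. $\|\mathcal A\|(nw)=\sum_{(q_0..q_n)}\iota(q_0)\mathrm{wt}\,\kappa(q_n)$; regular series are the $\|\mathcal A\|$. Projection: $\pi(S)(w)=\sum_{\nu:(w,\nu)\in\mathrm{NW}(\Delta)}S((w,\nu))$ for $w\in\Delta^*$. Weighted logic: classical MSO formulas from $x=y$, $\mathrm{Lab}_a(x)$, $x\le y$, $\nu(x,y)$, $x\in X$ by $\vee,\neg,\exists x,\exists X$ ($x<y:=\neg(y\le x)$, usual abbreviations). Weighted formulas: constants $k\in K$, atomic formulas and their negations, $\vee,\wedge,\exists x,\exists X,\forall x,\forall X$; semantics: $[\![k]\!]=k$, (negated) atomic formulas $1$ if true else $0$, $\vee\mapsto+$, $\wedge\mapsto\cdot$, $\exists$ sums and $\forall$ multiplies over positions/subsets. For classical $\varphi$: atomic $\varphi^+=\varphi,\varphi^-=\neg\varphi$; $(\neg\psi)^\pm=\psi^\mp$; $(\psi\vee\psi')^+=\psi^+\vee(\psi^-\wedge\psi'^+)$, $(\psi\vee\psi')^-=\psi^-\wedge\psi'^-$; $(\exists x.\psi(x))^+=\exists x.(\psi(x)^+\wedge\forall y.(y<x\wedge\psi(y))^-)$, $(\exists x.\psi)^-=\forall x.\psi^-$; $(\exists X.\psi(X))^+=\exists X.(\psi(X)^+\wedge\forall Y.(Y<X\wedge\psi(Y))^-)$, $(\exists X.\psi)^-=\forall X.\psi^-$, with $Y<X:=\exists y.(y\in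 X\wedge\neg y\in Y\wedge\forall z.(z<y\to(z\in X\leftrightarrow z\in Y)))$; these are syntactically unambiguous. $\mathrm{aUMSO}(\mathbb K)$: smallest set containing constants and syntactically unambiguous formulas closed under $\wedge,\vee$. $\mathrm{sRFO}(\mathbb K)$: weighted formulas with no second-order quantifiers in which every subformula $\forall x.\psi$ has $\psi\in\mathrm{aUMSO}(\mathbb K)$. For a sentence $\varphi$ and $w\in\Delta^+$ of length $n$: $[\![\exists\nu.\varphi]\!]^{\mathrm{nest}}(w)=\sum_{\nu\in\mathrm{Nest}_n}[\![\varphi]\!]((w,\nu))$, and value $0$ at $\varepsilon$. Algebraic series: formal power series are maps $\Delta^*\to K$ with pointwise sum/scalar product and Cauchy product $(S_1S_2)(w)=\sum_{w=w_1w_2}S_1(w_1)S_2(w_2)$; words identified with their characteristic series. For a finite variable set $\mathcal X$ disjoint from $\Delta$, a polynomial is a finitely supported map $(\Delta\cup\mathcal X)^*\to K$; an algebraic system is $(P_X)_{X\in\mathcal X}$; a solution is $(S_X)$ with $S_X=\sum(P_X,u_1X_1\cdots u_kX_ku_{k+1})u_1S_{X_1}\cdots u_kS_{X_k}u_{k+1}$ over the support of $P_X$. Proper: $P_X(Y)=P_X(\varepsilon)=0$; quasiregular: $S(\varepsilon)=0$. A proper system has exactly one quasiregular solution; algebraic series are its components for some proper system. *)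

theory Defs
  imports Main
begin

text \<open>Positions of a word of length n are 1..n. A nesting relation is a set of pairs.\<close>

definition Nest :: "nat \<Rightarrow> (nat \<times> nat) set set" where
  "Nest n = {\<nu>. \<nu> \<subseteq> {1..n} \<times> {1..n}
      \<and> (\<forall>i j. (i, j) \<in> \<nu> \<longrightarrow> i < j)
      \<and> (\<forall>i j j'. (i, j) \<in> \<nu> \<longrightarrow> (i, j') \<in> \<nu> \<longrightarrow> j = j')
      \<and> (\<forall>i i' j. (i, j) \<in> \<nu> \<longrightarrow> (i', j) \<in> \<nu> \<longrightarrow> i = i')
      \<and> (\<forall>i j i' j'. (i, j) \<in> \<nu> \<longrightarrow> (i', j') \<in> \<nu> \<longrightarrow> i < i' \<longrightarrow> j < i' \<or> j' < j)}"

type_synonym 'a nword = "'a list \<times> (nat \<times> nat) set"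

definition NW :: "'a nword set" where
  "NW = {(w, \<nu>). w \<noteq> [] \<and> \<nu> \<in> Nest (length w)}"

record ('a, 'k) wnwa =
  states :: "nat set"
  iota   :: "nat \<Rightarrow> 'k"
  dcall  :: "nat \<Rightarrow> 'a \<Rightarrow> nat \<Rightarrow> 'k"
  dint   :: "nat \<Rightarrow> 'a \<Rightarrow> nat \<Rightarrow> 'k"
  dret   :: "nat \<Rightarrow> nat \<Rightarrow> 'a \<Rightarrow> nat \<Rightarrow> 'k"
  kappa  :: "nat \<Rightarrow> 'k"

definition wnwa_ok :: "('a, 'k) wnwa \<Rightarrow> bool" where
  "wnwa_ok A \<longleftrightarrow> finite (states A)"

text \<open>Weight of the transition at position j (1 \<le> j \<le> n) of run r = [q_0, ..., q_n].\<close>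
definition pos_weight :: "('a, 'k) wnwa \<Rightarrow> 'a nword \<Rightarrow> nat list \<Rightarrow> nat \<Rightarrow> 'k" where
  "pos_weight A nw r j =
     (let w = fst nw; \<nu> = snd nw in
      if (\<exists>k. (j, k) \<in> \<nu>) then dcall A (r ! (j - 1)) (w ! (j - 1)) (r ! j)
      else if (\<exists>i. (i, j) \<in> \<nu>) then
        dret A (r ! (j - 1)) (r ! ((THE i. (i, j) \<in> \<nu>) - 1)) (w ! (j - 1)) (r ! j)
      else dint A (r ! (j - 1)) (w ! (j - 1)) (r ! j))"

definition runs :: "('a, 'k) wnwa \<Rightarrow> nat \<Rightarrow> nat list set" where
  "runs A n = {r. length r = Suc n \<and> set r \<subseteq> states A}"

definition behaviour :: "('a, 'k::comm_semiring_1) wnwa \<Rightarrow> 'a nword \<Rightarrow> 'k" where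
  "behaviour A nw =
     (\<Sum>r \<in> runs A (length (fst nw)).
        iota A (r ! 0) * (\<Prod>j \<in> {1..length (fst nw)}. pos_weight A nw r j)
        * kappa A (r ! length (fst nw)))"

definition regular_nw_series :: "('a nword \<Rightarrow> 'k::comm_semiring_1) \<Rightarrow> bool" where
  "regular_nw_series R \<longleftrightarrow> (\<exists>A. wnwa_ok A \<and> (\<forall>nw \<in> NW. R nw = behaviour A nw))"

definition proj :: "('a nword \<Rightarrow> 'k::comm_monoid_add) \<Rightarrow> 'a list \<Rightarrow> 'k" where
  "proj R w = (\<Sum>\<nu> \<in> {\<nu>. (w, \<nu>) \<in> NW}. R (w, \<nu>))"

definition cauchy :: "('a list \<Rightarrow> 'k::comm_semiring_1) \<Rightarrow> ('a list \<Rightarrow> 'k) \<Rightarrow> 'a list \<Rightarrow> 'k" where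
  "cauchy S1 S2 w = (\<Sum>i \<in> {0..length w}. S1 (take i w) * S2 (drop i w))"

definition char_series :: "'a list \<Rightarrow> 'a list \<Rightarrow> 'k::comm_semiring_1" where
  "char_series u w = (if w = u then 1 else 0)"

text \<open>Letters of polynomials: terminals Inl a, variables Inr X (X :: nat).\<close>
definition sym_series :: "(nat \<Rightarrow> 'a list \<Rightarrow> 'k::comm_semiring_1) \<Rightarrow> ('a + nat) \<Rightarrow> 'a list \<Rightarrow> 'k" where
  "sym_series Sol s = (case s of Inl a \<Rightarrow> char_series [a] | Inr X \<Rightarrow> Sol X)"

definition subst_word :: "(nat \<Rightarrow> 'a list \<Rightarrow> 'k::comm_semiring_1) \<Rightarrow> ('a + nat) list \<Rightarrow> 'a list \<Rightarrow> 'k" where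
  "subst_word Sol u = foldr (\<lambda>s acc. cauchy (sym_series Sol s) acc) u (char_series [])"

definition supp :: "(('a + nat) list \<Rightarrow> 'k::zero) \<Rightarrow> ('a + nat) list set" where
  "supp P = {u. P u \<noteq> 0}"

definition alg_system :: "nat set \<Rightarrow> (nat \<Rightarrow> ('a + nat) list \<Rightarrow> 'k::zero) \<Rightarrow> bool" where
  "alg_system V P \<longleftrightarrow> finite V \<and>
     (\<forall>X \<in> V. finite (supp (P X)) \<and> (\<forall>u \<in> supp (P X). \<forall>Y. Inr Y \<in> set u \<longrightarrow> Y \<in> V))"

definition proper_system :: "nat set \<Rightarrow> (nat \<Rightarrow> ('a + nat) list \<Rightarrow> 'k::zero) \<Rightarrow> bool" where
  "proper_system V P \<longleftrightarrow> alg_system V P \<and>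
     (\<forall>X \<in> V. P X [] = 0 \<and> (\<forall>Y \<in> V. P X [Inr Y] = 0))"

definition is_solution :: "nat set \<Rightarrow> (nat \<Rightarrow> ('a + nat) list \<Rightarrow> 'k::comm_semiring_1)
    \<Rightarrow> (nat \<Rightarrow> 'a list \<Rightarrow> 'k) \<Rightarrow> bool" where
  "is_solution V P Sol \<longleftrightarrow>
     (\<forall>X \<in> V. \<forall>w. Sol X w = (\<Sum>u \<in> supp (P X). P X u * subst_word Sol u w))"

definition quasiregular :: "('a list \<Rightarrow> 'k::zero) \<Rightarrow> bool" where
  "quasiregular S \<longleftrightarrow> S [] = 0"

definition algebraic :: "('a list \<Rightarrow> 'k::comm_semiring_1) \<Rightarrow> bool" where
  "algebraic S \<longleftrightarrow> (\<exists>(V :: nat set) P Sol X. proper_system V P \<and> is_solution V P Sol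
       \<and> (\<forall>Y \<in> V. quasiregular (Sol Y)) \<and> X \<in> V \<and> S = Sol X)"

text \<open>First-order variables and second-order variables are natural numbers
  (separate name spaces).\<close>
datatype 'a atom =
    ALab 'a nat
  | AEq nat nat
  | ALeq nat nat
  | ANu nat nat
  | AIn nat nat

datatype 'a mso =
    MAt "'a atom"
  | MNeg "'a mso"
  | MOr "'a mso" "'a mso"
  | MEx1 nat "'a mso"
  | MEx2 nat "'a mso"

datatype ('a, 'k) wf =
    WConst 'k
  | WAt "'a atom"
  | WNAt "'a atom"
  | WOr "('a, 'k) wf" "('a, 'k) wf"
  | WAnd "('a, 'k) wf" "('a, 'k) wf"
  | WEx1 nat "('a, 'k) wf"
  | WEx2 nat "('a, 'k) wf"
  | WAll1 nat "('a, 'k) wf"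
  | WAll2 nat "('a, 'k) wf"

definition mlt :: "nat \<Rightarrow> nat \<Rightarrow> 'a mso" where
  "mlt x y = MNeg (MAt (ALeq y x))"
definition mand :: "'a mso \<Rightarrow> 'a mso \<Rightarrow> 'a mso" where
  "mand a b = MNeg (MOr (MNeg a) (MNeg b))"
definition mimp :: "'a mso \<Rightarrow> 'a mso \<Rightarrow> 'a mso" where
  "mimp a b = MOr (MNeg a) b"
definition miff :: "'a mso \<Rightarrow> 'a mso \<Rightarrow> 'a mso" where
  "miff a b = mand (mimp a b) (mimp b a)"
definition mall :: "nat \<Rightarrow> 'a mso \<Rightarrow> 'a mso" where
  "mall x a = MNeg (MEx1 x (MNeg a))"

text \<open>Y < X (lexicographic order on sets), with bound first-order variables y = 0, z = 1.\<close>
definition solt :: "nat \<Rightarrow> nat \<Rightarrow> 'a mso" where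
  "solt Y X = MEx1 0 (mand (MAt (AIn 0 X)) (mand (MNeg (MAt (AIn 0 Y)))
      (mall 1 (mimp (mlt 1 0) (miff (MAt (AIn 1 X)) (MAt (AIn 1 Y)))))))"

fun atom_subst1 :: "nat \<Rightarrow> nat \<Rightarrow> 'a atom \<Rightarrow> 'a atom" where
  "atom_subst1 x y (ALab a z) = ALab a (if z = x then y else z)"
| "atom_subst1 x y (AEq z z') = AEq (if z = x then y else z) (if z' = x then y else z')"
| "atom_subst1 x y (ALeq z z') = ALeq (if z = x then y else z) (if z' = x then y else z')"
| "atom_subst1 x y (ANu z z') = ANu (if z = x then y else z) (if z' = x then y else z')"
| "atom_subst1 x y (AIn z Z) = AIn (if z = x then y else z) Z"

fun atom_subst2 :: "nat \<Rightarrow> nat \<Rightarrow> 'a atom \<Rightarrow> 'a atom" where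
  "atom_subst2 X Y (AIn z Z) = AIn z (if Z = X then Y else Z)"
| "atom_subst2 X Y a = a"

text \<open>Replace free occurrences (capture is impossible since the new name is chosen fresh).\<close>
fun subst1 :: "nat \<Rightarrow> nat \<Rightarrow> 'a mso \<Rightarrow> 'a mso" where
  "subst1 x y (MAt a) = MAt (atom_subst1 x y a)"
| "subst1 x y (MNeg p) = MNeg (subst1 x y p)"
| "subst1 x y (MOr p q) = MOr (subst1 x y p) (subst1 x y q)"
| "subst1 x y (MEx1 z p) = (if z = x then MEx1 z p else MEx1 z (subst1 x y p))"
| "subst1 x y (MEx2 Z p) = MEx2 Z (subst1 x y p)"

fun subst2 :: "nat \<Rightarrow> nat \<Rightarrow> 'a mso \<Rightarrow> 'a mso" where
  "subst2 X Y (MAt a) = MAt (atom_subst2 X Y a)"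
| "subst2 X Y (MNeg p) = MNeg (subst2 X Y p)"
| "subst2 X Y (MOr p q) = MOr (subst2 X Y p) (subst2 X Y q)"
| "subst2 X Y (MEx1 z p) = MEx1 z (subst2 X Y p)"
| "subst2 X Y (MEx2 Z p) = (if Z = X then MEx2 Z p else MEx2 Z (subst2 X Y p))"

fun atom_vars1 :: "'a atom \<Rightarrow> nat set" where
  "atom_vars1 (ALab a z) = {z}"
| "atom_vars1 (AEq z z') = {z, z'}"
| "atom_vars1 (ALeq z z') = {z, z'}"
| "atom_vars1 (ANu z z') = {z, z'}"
| "atom_vars1 (AIn z Z) = {z}"

fun atom_vars2 :: "'a atom \<Rightarrow> nat set" where
  "atom_vars2 (AIn z Z) = {Z}"
| "atom_vars2 a = {}"

fun vars1 :: "'a mso \<Rightarrow> nat set" where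
  "vars1 (MAt a) = atom_vars1 a"
| "vars1 (MNeg p) = vars1 p"
| "vars1 (MOr p q) = vars1 p \<union> vars1 q"
| "vars1 (MEx1 z p) = insert z (vars1 p)"
| "vars1 (MEx2 Z p) = vars1 p"

fun vars2 :: "'a mso \<Rightarrow> nat set" where
  "vars2 (MAt a) = atom_vars2 a"
| "vars2 (MNeg p) = vars2 p"
| "vars2 (MOr p q) = vars2 p \<union> vars2 q"
| "vars2 (MEx1 z p) = vars2 p"
| "vars2 (MEx2 Z p) = insert Z (vars2 p)"

lemma finite_atom_vars1 [simp]: "finite (atom_vars1 a)" by (cases a) auto
lemma finite_atom_vars2 [simp]: "finite (atom_vars2 a)" by (cases a) auto
lemma finite_vars1 [simp]: "finite (vars1 p)" by (induction p) auto
lemma finite_vars2 [simp]: "finite (vars2 p)" by (induction p) auto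

definition fresh1 :: "'a mso \<Rightarrow> nat" where
  "fresh1 p = Suc (Max (insert 0 (vars1 p)))"
definition fresh2 :: "'a mso \<Rightarrow> nat" where
  "fresh2 p = Suc (Max (insert 0 (vars2 p)))"

subsection \<open>The translations phi^+ (pm True) and phi^- (pm False)\<close>

fun fsz :: "'a mso \<Rightarrow> nat" where
  "fsz (MAt a) = 1"
| "fsz (MNeg p) = Suc (fsz p)"
| "fsz (MOr p q) = Suc (fsz p + fsz q)"
| "fsz (MEx1 z p) = fsz p + 10"
| "fsz (MEx2 Z p) = fsz p + 100"

lemma fsz_subst1 [simp]: "fsz (subst1 x y p) = fsz p" by (induction p) auto
lemma fsz_subst2 [simp]: "fsz (subst2 x y p) = fsz p" by (induction p) auto

function pm :: "bool \<Rightarrow> 'a mso \<Rightarrow> ('a, 'k) wf" where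
  "pm True (MAt a) = WAt a"
| "pm False (MAt a) = WNAt a"
| "pm b (MNeg p) = pm (\<not> b) p"
| "pm True (MOr p q) = WOr (pm True p) (WAnd (pm False p) (pm True q))"
| "pm False (MOr p q) = WAnd (pm False p) (pm False q)"
| "pm True (MEx1 x p) =
     WEx1 x (WAnd (pm True p)
       (WAll1 (fresh1 (MEx1 x p))
          (pm False (mand (mlt (fresh1 (MEx1 x p)) x) (subst1 x (fresh1 (MEx1 x p)) p)))))"
| "pm False (MEx1 x p) = WAll1 x (pm False p)"
| "pm True (MEx2 X p) =
     WEx2 X (WAnd (pm True p)
       (WAll2 (fresh2 (MEx2 X p))
          (pm False (mand (solt (fresh2 (MEx2 X p)) X) (subst2 X (fresh2 (MEx2 X p)) p)))))"
| "pm False (MEx2 X p) = WAll2 X (pm False p)"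
  by pat_completeness auto
termination
  by (relation "measure (\<lambda>(b, p). fsz p)")
     (auto simp: mand_def mlt_def solt_def mall_def mimp_def miff_def)

text \<open>Syntactically unambiguous formulas: phi^+ and phi^- for classical phi
  (note phi^- = (not phi)^+).\<close>
definition synt_unamb :: "('a, 'k) wf set" where
  "synt_unamb = {pm b p | b p. True}"

inductive_set aUMSO :: "('a, 'k) wf set" where
  const: "WConst k \<in> aUMSO"
| su: "p \<in> synt_unamb \<Longrightarrow> p \<in> aUMSO"
| conj: "p \<in> aUMSO \<Longrightarrow> q \<in> aUMSO \<Longrightarrow> WAnd p q \<in> aUMSO"
| disj: "p \<in> aUMSO \<Longrightarrow> q \<in> aUMSO \<Longrightarrow> WOr p q \<in> aUMSO"

fun subformulas :: "('a, 'k) wf \<Rightarrow> ('a, 'k) wf set" where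
  "subformulas (WConst k) = {WConst k}"
| "subformulas (WAt a) = {WAt a}"
| "subformulas (WNAt a) = {WNAt a}"
| "subformulas (WOr p q) = insert (WOr p q) (subformulas p \<union> subformulas q)"
| "subformulas (WAnd p q) = insert (WAnd p q) (subformulas p \<union> subformulas q)"
| "subformulas (WEx1 x p) = insert (WEx1 x p) (subformulas p)"
| "subformulas (WEx2 X p) = insert (WEx2 X p) (subformulas p)"
| "subformulas (WAll1 x p) = insert (WAll1 x p) (subformulas p)"
| "subformulas (WAll2 X p) = insert (WAll2 X p) (subformulas p)"

fun no_so_quant :: "('a, 'k) wf \<Rightarrow> bool" where
  "no_so_quant (WOr p q) = (no_so_quant p \<and> no_so_quant q)"
| "no_so_quant (WAnd p q) = (no_so_quant p \<and> no_so_quant q)"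
| "no_so_quant (WEx1 x p) = no_so_quant p"
| "no_so_quant (WAll1 x p) = no_so_quant p"
| "no_so_quant (WEx2 X p) = False"
| "no_so_quant (WAll2 X p) = False"
| "no_so_quant _ = True"

definition sRFO :: "('a, 'k) wf set" where
  "sRFO = {p. no_so_quant p \<and> (\<forall>x q. WAll1 x q \<in> subformulas p \<longrightarrow> q \<in> aUMSO)}"

fun wfree1 :: "('a, 'k) wf \<Rightarrow> nat set" where
  "wfree1 (WConst k) = {}"
| "wfree1 (WAt a) = atom_vars1 a"
| "wfree1 (WNAt a) = atom_vars1 a"
| "wfree1 (WOr p q) = wfree1 p \<union> wfree1 q"
| "wfree1 (WAnd p q) = wfree1 p \<union> wfree1 q"
| "wfree1 (WEx1 x p) = wfree1 p - {x}"
| "wfree1 (WEx2 X p) = wfree1 p"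
| "wfree1 (WAll1 x p) = wfree1 p - {x}"
| "wfree1 (WAll2 X p) = wfree1 p"

fun wfree2 :: "('a, 'k) wf \<Rightarrow> nat set" where
  "wfree2 (WConst k) = {}"
| "wfree2 (WAt a) = atom_vars2 a"
| "wfree2 (WNAt a) = atom_vars2 a"
| "wfree2 (WOr p q) = wfree2 p \<union> wfree2 q"
| "wfree2 (WAnd p q) = wfree2 p \<union> wfree2 q"
| "wfree2 (WEx1 x p) = wfree2 p"
| "wfree2 (WEx2 X p) = wfree2 p - {X}"
| "wfree2 (WAll1 x p) = wfree2 p"
| "wfree2 (WAll2 X p) = wfree2 p - {X}"

definition sentence :: "('a, 'k) wf \<Rightarrow> bool" where
  "sentence p \<longleftrightarrow> wfree1 p = {} \<and> wfree2 p = {}"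

fun atom_holds :: "'a nword \<Rightarrow> (nat \<Rightarrow> nat) \<Rightarrow> (nat \<Rightarrow> nat set) \<Rightarrow> 'a atom \<Rightarrow> bool" where
  "atom_holds nw s1 s2 (ALab a x) =
     (1 \<le> s1 x \<and> s1 x \<le> length (fst nw) \<and> fst nw ! (s1 x - 1) = a)"
| "atom_holds nw s1 s2 (AEq x y) = (s1 x = s1 y)"
| "atom_holds nw s1 s2 (ALeq x y) = (s1 x \<le> s1 y)"
| "atom_holds nw s1 s2 (ANu x y) = ((s1 x, s1 y) \<in> snd nw)"
| "atom_holds nw s1 s2 (AIn x X) = (s1 x \<in> s2 X)"

fun wsem :: "'a nword \<Rightarrow> (nat \<Rightarrow> nat) \<Rightarrow> (nat \<Rightarrow> nat set) \<Rightarrow> ('a, 'k::comm_semiring_1) wf \<Rightarrow> 'k" where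
  "wsem nw s1 s2 (WConst k) = k"
| "wsem nw s1 s2 (WAt a) = (if atom_holds nw s1 s2 a then 1 else 0)"
| "wsem nw s1 s2 (WNAt a) = (if atom_holds nw s1 s2 a then 0 else 1)"
| "wsem nw s1 s2 (WOr p q) = wsem nw s1 s2 p + wsem nw s1 s2 q"
| "wsem nw s1 s2 (WAnd p q) = wsem nw s1 s2 p * wsem nw s1 s2 q"
| "wsem nw s1 s2 (WEx1 x p) = (\<Sum>i \<in> {1..length (fst nw)}. wsem nw (s1(x := i)) s2 p)"
| "wsem nw s1 s2 (WAll1 x p) = (\<Prod>i \<in> {1..length (fst nw)}. wsem nw (s1(x := i)) s2 p)"
| "wsem nw s1 s2 (WEx2 X p) = (\<Sum>I \<in> Pow {1..length (fst nw)}. wsem nw s1 (s2(X := I)) p)"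
| "wsem nw s1 s2 (WAll2 X p) = (\<Prod>I \<in> Pow {1..length (fst nw)}. wsem nw s1 (s2(X := I)) p)"

text \<open>For a sentence the assignment is irrelevant; we use a fixed one.\<close>
definition sentence_sem :: "('a, 'k::comm_semiring_1) wf \<Rightarrow> 'a nword \<Rightarrow> 'k" where
  "sentence_sem p nw = wsem nw (\<lambda>_. 0) (\<lambda>_. {}) p"

definition nest_sem :: "('a, 'k::comm_semiring_1) wf \<Rightarrow> 'a list \<Rightarrow> 'k" where
  "nest_sem p w = (if w = [] then 0 else (\<Sum>\<nu> \<in> Nest (length w). sentence_sem p (w, \<nu>)))"

end

theory Submission
  imports Defs
begin

text \<open>A nested word is a tree built from the empty word by prefixing an internal letter or an arc,
  and \<open>\<pi>\<close> sums over all trees with a given yield. So each of the three conditions is compared with a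
  fourth one: \<open>S\<close> lies in a finite family of series each of which is a linear combination of
  \<open>1\<close>, \<open>a g\<close> and \<open>a g b h\<close> with \<open>g\<close>, \<open>h\<close> in the family.

  Such a family becomes a proper system by removing constant terms; conversely the left corners of a
  proper system give a weak Greibach form, whose right quotients by letters form such a family.
  The states of an automaton guess at a call what will follow the matching return.

  A sentence in \<open>sRFO\<close> has no set quantifiers, so finite tree homomorphisms evaluate its classical parts,
  and a product over positions is computed bottom-up by guessing the effect of the context.
  For the converse the formula has no sum over runs available, so the variables of a derivation
  must be coded into \<open>\<nu>\<close>. In a double Greibach form whose
  phrases start with many letters, each phrase is enclosed by an arc and announces its variable
  by the position of one dummy arc; then \<open>\<nu>\<close> determines the derivation and its weight is a product
  of first-order definable local weights.\<close>

section \<open>The semiring of formal power series\<close>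

text \<open>The coefficients offer neither subtraction nor infinite sums, so equations between
  series cannot be solved by inversion. Uniqueness always comes from one observation: each unknown
  stands next to a factor without constant term, so two solutions that agree on words shorter than
  \<open>n\<close> also agree on words of length \<open>n\<close>. Commutativity is used when the
  weights of the inside and of the rest of an arc are collected in an order different from that of
  the word. The choice of \<nu> is the only sum over derivations that a sentence can use, so \<nu>
  must carry everything. Room for the announcement is the difficulty: a phrase for variable
  \<open>i\<close> needs its opening letter, \<open>i\<close> further letters and two letters for
  the dummy arc. Terminal prefixes can be lengthened without introducing new variables, so a bound
  depending on the number of variables is enough. Words too short for the code are finitely many and
  are listed in the formula one by one. The empty word has no nested words above it: all three
  conditions force the value 0 there, whereas the sum over trees counts the empty tree. Hence proper
  parts appear at the interfaces.\<close>

lemma cauchy_Nil: "cauchy f g [] = f [] * g []"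
  by (simp add: cauchy_def)

text \<open>Product rule for the left quotient by a letter. Together with \<open>cauchy_Nil\<close>
  it is a recursion on the word, so algebraic laws can be proved by induction instead of rearranging
  sums over splittings.\<close>

lemma cauchy_Cons: "cauchy f g (a # w) = f [] * g (a # w) + cauchy (\<lambda>v. f (a # v)) g w"
proof -
  have "cauchy f g (a # w) = (\<Sum>i = 0..Suc (length w). f (take i (a # w)) * g (drop i (a # w)))"
    by (simp add: cauchy_def)
  also have "\<dots> = f [] * g (a # w) + (\<Sum>i = 0..length w. f (a # take i w) * g (drop i w))"
    by (subst sum.atLeast0_atMost_Suc_shift) simp
  finally show ?thesis by (simp add: cauchy_def)
qed

lemma cauchy_add_left: "cauchy (\<lambda>v. f v + g v) h w = cauchy f h w + cauchy g h w"
  by (simp add: cauchy_def distrib_right sum.distrib)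

lemma cauchy_add_right: "cauchy h (\<lambda>v. f v + g v) w = cauchy h f w + cauchy h g w"
  by (simp add: cauchy_def distrib_left sum.distrib)

lemma cauchy_scale_left: "cauchy (\<lambda>v. c * f v) h w = c * cauchy f h w"
  by (simp add: cauchy_def sum_distrib_left mult.assoc)

lemma cauchy_assoc: "cauchy (cauchy f g) h w = cauchy f (cauchy g h) w"
proof (induction w arbitrary: f)
  case Nil
  show ?case by (simp add: cauchy_Nil mult.assoc)
next
  case (Cons a w)
  have "cauchy (cauchy f g) h (a # w) =
      f [] * g [] * h (a # w) + (f [] * cauchy (\<lambda>v. g (a # v)) h w
        + cauchy (cauchy (\<lambda>v. f (a # v)) g) h w)"
    by (simp add: cauchy_Cons cauchy_Nil cauchy_add_left cauchy_scale_left)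
  also have "\<dots> = cauchy f (cauchy g h) (a # w)"
    by (simp add: cauchy_Cons Cons.IH distrib_left mult.assoc add.assoc)
  finally show ?case .
qed

lemma cauchy_zero_left: "cauchy (\<lambda>_. 0) f w = 0"
  by (simp add: cauchy_def)

lemma cauchy_const_left: "cauchy (\<lambda>w. if w = [] then k else 0) f w = k * f w"
  by (cases w) (simp_all add: cauchy_Nil cauchy_Cons cauchy_zero_left)

lemma cauchy_const_right: "cauchy f (\<lambda>w. if w = [] then k else 0) w = f w * k"
  by (induction w arbitrary: f) (simp_all add: cauchy_Nil cauchy_Cons)

text \<open>A separate type, so that \<open>*\<close> can denote the Cauchy product and the general
  theory of semirings, finite sums and list products applies.\<close>

typedef ('a, 'k) ser = "UNIV :: ('a list \<Rightarrow> 'k) set"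
  morphisms cf Ser by simp

lemma cf_Ser [simp]: "cf (Ser f) = f"
  by (simp add: Ser_inverse)

lemma ser_eqI: "(\<And>w. cf f w = cf g w) \<Longrightarrow> f = g"
  by (metis cf_inverse ext)

instantiation ser :: (type, comm_semiring_1) semiring_1
begin
definition zero_ser where "0 = Ser (\<lambda>_. 0)"
definition one_ser where "1 = Ser (char_series [])"
definition plus_ser where "f + g = Ser (\<lambda>w. cf f w + cf g w)"
definition times_ser where "f * g = Ser (cauchy (cf f) (cf g))"
instance
proof
  have one: "cf (1 :: ('a, 'b) ser) = (\<lambda>w. if w = [] then 1 else 0)"
    by (auto simp: one_ser_def char_series_def)
  fix a b c :: "('a, 'b) ser"
  show "a + b + c = a + (b + c)" "a + b = b + a"
    by (auto simp: plus_ser_def algebra_simps)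
  show "0 + a = a" by (auto simp: plus_ser_def zero_ser_def cf_inverse)
  show "a * b * c = a * (b * c)"
    by (simp add: times_ser_def cauchy_assoc[abs_def])
  show "1 * a = a" "a * 1 = a"
    by (auto intro!: ser_eqI simp: times_ser_def one cauchy_const_left cauchy_const_right)
  show "0 * a = 0" "a * 0 = 0"
    by (auto intro!: ser_eqI simp: times_ser_def zero_ser_def cauchy_def)
  show "(a + b) * c = a * c + b * c" "a * (b + c) = a * b + a * c"
    by (auto intro!: ser_eqI simp: times_ser_def plus_ser_def cauchy_add_left cauchy_add_right)
  show "(0 :: ('a, 'b) ser) \<noteq> 1"
    using one by (metis cf_Ser zero_neq_one zero_ser_def)
qed
end

text \<open>A scalar becomes a series concentrated on the empty word; scaling is then multiplication
  by a central element (\<open>sc_commute\<close>).\<close>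

definition sc :: "'k \<Rightarrow> ('a, 'k::comm_semiring_1) ser" where
  "sc k = Ser (\<lambda>w. if w = [] then k else 0)"

definition lt :: "'a \<Rightarrow> ('a, 'k::comm_semiring_1) ser" where
  "lt a = Ser (char_series [a])"

lemma cf_zero [simp]: "cf 0 w = 0"
  by (simp add: zero_ser_def)
lemma cf_one: "cf 1 w = (if w = [] then 1 else 0)"
  by (simp add: one_ser_def char_series_def)
lemma cf_add [simp]: "cf (f + g) w = cf f w + cf g w"
  by (simp add: plus_ser_def)
lemma cf_mult: "cf (f * g) = cauchy (cf f) (cf g)"
  by (simp add: times_ser_def)
lemma cf_mult_Nil [simp]: "cf (f * g) [] = cf f [] * cf g []"
  by (simp add: cf_mult cauchy_Nil)
lemma cf_sum [simp]: "cf (sum f A) w = (\<Sum>x\<in>A. cf (f x) w)"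
  by (induction A rule: infinite_finite_induct) auto
lemma cf_sc: "cf (sc k) w = (if w = [] then k else 0)"
  by (simp add: sc_def)
lemma cf_sc_mult [simp]: "cf (sc k * f) w = k * cf f w"
  by (simp add: cf_mult sc_def cauchy_const_left)
lemma cf_mult_sc [simp]: "cf (f * sc k) w = cf f w * k"
  by (simp add: cf_mult sc_def cauchy_const_right)
lemma cf_lt: "cf (lt a) w = (if w = [a] then 1 else 0)"
  by (simp add: lt_def char_series_def)
lemma cf_lt_Nil [simp]: "cf (lt a) [] = 0"
  by (simp add: cf_lt)
lemma cf_lt_mult_Cons [simp]: "cf (lt a * f) (b # w) = (if a = b then cf f w else 0)"
proof -
  have "cf (lt a * f) (b # w) = cauchy (\<lambda>v. if v = [] \<and> b = a then 1 else 0) (cf f) w"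
    by (simp add: cf_mult cauchy_Cons cf_lt conj_commute)
  also have "\<dots> = (if a = b then cf f w else 0)"
    by (cases "a = b") (auto simp: cauchy_const_left cauchy_zero_left)
  finally show ?thesis .
qed

lemma sc_commute: "f * sc k = sc k * f"
  by (rule ser_eqI) (simp add: mult.commute)
lemma sc_commute_left: "f * (sc k * g) = sc k * (f * g)"
  by (metis sc_commute mult.assoc)
lemma sc_mult: "sc (k * l) = sc k * sc l"
  by (rule ser_eqI) (simp add: cf_sc)
lemma sc_add: "sc (k + l) = sc k + sc l"
  by (rule ser_eqI) (simp add: cf_sc)
lemma sc_0 [simp]: "sc 0 = 0"
  by (rule ser_eqI) (simp add: cf_sc)
lemma sc_1 [simp]: "sc 1 = 1"
  by (rule ser_eqI) (simp add: cf_sc cf_one)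

subsection \<open>Agreement up to a length\<close>

text \<open>Agreement of series up to a given order. It replaces differences and metrics, which a
  semiring does not provide.\<close>

definition eqn :: "nat \<Rightarrow> ('a, 'k) ser \<Rightarrow> ('a, 'k) ser \<Rightarrow> bool" where
  "eqn n f g \<longleftrightarrow> (\<forall>w. length w < n \<longrightarrow> cf f w = cf g w)"

lemma eqn_0 [simp]: "eqn 0 f g" by (simp add: eqn_def)
lemma eqn_refl [simp]: "eqn n f f" by (simp add: eqn_def)
lemma eqn_trans: "eqn n f g \<Longrightarrow> eqn n g h \<Longrightarrow> eqn n f h" by (simp add: eqn_def)
lemma eqn_mono: "eqn n f g \<Longrightarrow> m \<le> n \<Longrightarrow> eqn m f g" by (simp add: eqn_def)

lemma eqn_all: "(\<And>n. eqn n f g) \<Longrightarrow> f = g"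
  by (rule ser_eqI) (auto simp: eqn_def)

text \<open>A contraction principle for a whole family at once: at \<open>n = 0\<close> agreement is
  vacuous, and each round gains one length.\<close>

lemma eqn_induct:
  assumes "\<And>n. (\<And>i. i \<in> I \<Longrightarrow> eqn n (f i) (g i)) \<Longrightarrow> (\<And>i. i \<in> I \<Longrightarrow> eqn (Suc n) (f i) (g i))"
    and "i \<in> I"
  shows "f i = g i"
proof (rule eqn_all)
  fix n show "eqn n (f i) (g i)" using assms(2)
    by (induction n arbitrary: i) (auto intro: assms(1))
qed

lemma eqn_add: "eqn n f f' \<Longrightarrow> eqn n g g' \<Longrightarrow> eqn n (f + g) (f' + g')"
  by (simp add: eqn_def)

lemma eqn_sum: "(\<And>x. x \<in> A \<Longrightarrow> eqn n (f x) (g x)) \<Longrightarrow> eqn n (sum f A) (sum g A)"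
  by (auto simp: eqn_def intro: sum.cong)

lemma eqn_mult: "eqn n f f' \<Longrightarrow> eqn n g g' \<Longrightarrow> eqn n (f * g) (f' * g')"
  by (auto simp: eqn_def cf_mult cauchy_def intro!: sum.cong)

text \<open>The splitting with an empty left part contributes nothing because \<open>x\<close> and
  \<open>y\<close> have no constant term, so \<open>f\<close> and \<open>g\<close> are evaluated on
  strictly shorter words only. This is where a length is gained.\<close>

lemma eqn_mult_left:
  assumes "eqn (Suc n) x y" "cf x [] = 0" "cf y [] = 0" "eqn n f g"
  shows "eqn (Suc n) (x * f) (y * g)"
  unfolding eqn_def cf_mult cauchy_def
proof (intro allI impI sum.cong refl)
  fix w :: "'a list" and i assume w: "length w < Suc n" and i: "i \<in> {0..length w}"
  show "cf x (take i w) * cf f (drop i w) = cf y (take i w) * cf g (drop i w)"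
    using assms w i by (cases "i = 0 \<or> w = []") (auto simp: eqn_def)
qed

lemma eqn_mult_right:
  assumes "eqn (Suc n) x y" "cf x [] = 0" "cf y [] = 0" "eqn n f g"
  shows "eqn (Suc n) (f * x) (g * y)"
  unfolding eqn_def cf_mult cauchy_def
proof (intro allI impI sum.cong refl)
  fix w :: "'a list" and i assume w: "length w < Suc n" and i: "i \<in> {0..length w}"
  show "cf f (take i w) * cf x (drop i w) = cf g (take i w) * cf y (drop i w)"
    using assms w i by (cases "i = length w") (auto simp: eqn_def)
qed

lemma eqn_lt: "eqn n f g \<Longrightarrow> eqn (Suc n) (lt a * f) (lt a * g)"
  by (rule eqn_mult_left) (auto simp: cf_lt)

subsection \<open>The star of a quasiregular matrix\<close>

text \<open>Arden's rule for matrices, by contraction: the entries of \<open>N\<close> have no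
  constant term, so the right-hand side gains one length.\<close>

lemma linear_unique_left:
  assumes N: "\<And>i j. i \<in> J \<Longrightarrow> j \<in> J \<Longrightarrow> cf (N i j) [] = 0"
    and x: "\<And>i. i \<in> J \<Longrightarrow> x i = c i + (\<Sum>k\<in>J. N i k * x k)"
    and y: "\<And>i. i \<in> J \<Longrightarrow> y i = c i + (\<Sum>k\<in>J. N i k * y k)"
    and "i \<in> J"
  shows "x i = y i"
  using \<open>i \<in> J\<close>
proof (rule eqn_induct[rotated])
  fix n i assume IH: "\<And>i. i \<in> J \<Longrightarrow> eqn n (x i) (y i)" and i: "i \<in> J"
  show "eqn (Suc n) (x i) (y i)"
    unfolding x[OF i] y[OF i]
    by (intro eqn_add eqn_sum eqn_refl eqn_mult_left IH N i)
qed

lemma linear_unique_right: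
  assumes N: "\<And>i j. i \<in> J \<Longrightarrow> j \<in> J \<Longrightarrow> cf (N i j) [] = 0"
    and x: "\<And>i. i \<in> J \<Longrightarrow> x i = c i + (\<Sum>k\<in>J. x k * N k i)"
    and y: "\<And>i. i \<in> J \<Longrightarrow> y i = c i + (\<Sum>k\<in>J. y k * N k i)"
    and "i \<in> J"
  shows "x i = y i"
  using \<open>i \<in> J\<close>
proof (rule eqn_induct[rotated])
  fix n i assume IH: "\<And>i. i \<in> J \<Longrightarrow> eqn n (x i) (y i)" and i: "i \<in> J"
  show "eqn (Suc n) (x i) (y i)"
    unfolding x[OF i] y[OF i]
    by (intro eqn_add eqn_sum eqn_refl eqn_mult_right IH N i)
qed

abbreviation idm :: "'i \<Rightarrow> 'i \<Rightarrow> ('a, 'k::comm_semiring_1) ser" where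
  "idm i j \<equiv> (if i = j then 1 else 0)"

lemma star_exists_left:
  fixes N :: "'i \<Rightarrow> 'i \<Rightarrow> ('a, 'k::comm_semiring_1) ser"
  assumes N: "\<And>i j. i \<in> J \<Longrightarrow> j \<in> J \<Longrightarrow> cf (N i j) [] = 0"
  obtains L where "\<And>i j. i \<in> J \<Longrightarrow> j \<in> J \<Longrightarrow> L i j = idm i j + (\<Sum>k\<in>J. N i k * L k j)"
proof -
  \<comment> \<open>\<open>P n\<close> is the partial sum of the first \<open>n\<close> powers of
    \<open>N\<close>, starting with the unit matrix.\<close>
  define P where "P n = rec_nat (\<lambda>_ _. 0) (\<lambda>_ M i j. idm i j + (\<Sum>k\<in>J. N i k * M k j)) n" for n :: nat
  have P0: "P 0 i j = 0" and PS: "P (Suc n) i j = idm i j + (\<Sum>k\<in>J. N i k * P n k j)" for n i j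
    by (simp_all add: P_def)
  have step: "eqn n (P n i j) (P (Suc n) i j)" if "i \<in> J" "j \<in> J" for n i j
    using that
  proof (induction n arbitrary: i)
    case (Suc n)
    have "eqn (Suc n) (idm i j + (\<Sum>k\<in>J. N i k * P n k j)) (idm i j + (\<Sum>k\<in>J. N i k * P (Suc n) k j))"
      by (intro eqn_add eqn_sum eqn_mult_left eqn_refl N Suc)
    then show ?case by (simp only: PS)
  qed simp
  have conv: "eqn n (P n i j) (P (n + d) i j)" if "i \<in> J" "j \<in> J" for n d i j
  proof (induction d)
    case (Suc d)
    have "eqn n (P (n + d) i j) (P (Suc (n + d)) i j)"
      by (rule eqn_mono[OF step[OF that]]) simp
    with Suc show ?case by (auto intro: eqn_trans)
  qed simp
  \<comment> \<open>Diagonal limit: the coefficient at \<open>w\<close> no longer changes from index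
    \<open>Suc (length w)\<close> on.\<close>
  define L where "L i j = Ser (\<lambda>w. cf (P (Suc (length w)) i j) w)" for i j
  have L: "eqn n (L i j) (P n i j)" if "i \<in> J" "j \<in> J" for n i j
  proof -
    have "cf (P (Suc (length w)) i j) w = cf (P n i j) w" if "length w < n" for w
      using conv[OF \<open>i \<in> J\<close> \<open>j \<in> J\<close>, of "Suc (length w)" "n - Suc (length w)"] that
      by (auto simp: eqn_def)
    then show ?thesis by (auto simp: eqn_def L_def)
  qed
  have "L i j = idm i j + (\<Sum>k\<in>J. N i k * L k j)" if ij: "i \<in> J" "j \<in> J" for i j
  proof (rule eqn_all)
    fix n
    have "eqn (Suc n) (idm i j + (\<Sum>k\<in>J. N i k * L k j)) (P (Suc n) i j)"
      unfolding PS by (intro eqn_add eqn_sum eqn_mult_left eqn_refl N ij L)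
    then show "eqn n (L i j) (idm i j + (\<Sum>k\<in>J. N i k * L k j))"
      using L[OF ij, of n] L[OF ij, of "Suc n"] by (auto simp: eqn_def)
  qed
  then show ?thesis by (rule that)
qed

lemma star_exists:
  fixes N :: "'i \<Rightarrow> 'i \<Rightarrow> ('a, 'k::comm_semiring_1) ser"
  assumes J: "finite J" and N: "\<And>i j. i \<in> J \<Longrightarrow> j \<in> J \<Longrightarrow> cf (N i j) [] = 0"
  obtains L where "\<And>i j. i \<in> J \<Longrightarrow> j \<in> J \<Longrightarrow> L i j = idm i j + (\<Sum>k\<in>J. N i k * L k j)"
    and "\<And>i j. i \<in> J \<Longrightarrow> j \<in> J \<Longrightarrow> L i j = idm i j + (\<Sum>k\<in>J. L i k * N k j)"
proof -
  obtain L where L: "\<And>i j. i \<in> J \<Longrightarrow> j \<in> J \<Longrightarrow> L i j = idm i j + (\<Sum>k\<in>J. N i k * L k j)"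
    by (rule star_exists_left[of J N, OF N]) auto
  \<comment> \<open>The mirrored equation comes from uniqueness: 1 + L N satisfies the same left
    equation as L.\<close>
  define L' where "L' i j = idm i j + (\<Sum>k\<in>J. L i k * N k j)" for i j
  have "L i j = L' i j" if ij: "i \<in> J" "j \<in> J" for i j
    using N L _ ij(1)
  proof (rule linear_unique_left[where x = "\<lambda>i. L i j" and y = "\<lambda>i. L' i j" and c = "\<lambda>i. idm i j"])
    fix i assume i: "i \<in> J"
    have "(\<Sum>k\<in>J. N i k * L' k j)
        = (\<Sum>k\<in>J. N i k * idm k j) + (\<Sum>k\<in>J. \<Sum>l\<in>J. N i k * L k l * N l j)"
      by (simp add: L'_def distrib_left sum.distrib sum_distrib_left mult.assoc cong: if_cong)
    also have "(\<Sum>k\<in>J. N i k * idm k j) = N i j"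
      using J ij by (simp add: if_distrib[of "\<lambda>x. _ * x"] cong: if_cong)
    also have "N i j + (\<Sum>k\<in>J. \<Sum>l\<in>J. N i k * L k l * N l j)
        = (\<Sum>l\<in>J. idm i l * N l j) + (\<Sum>l\<in>J. (\<Sum>k\<in>J. N i k * L k l) * N l j)"
      using J i by (subst sum.swap) (simp add: sum_distrib_right if_distrib[of "\<lambda>x. x * _"] cong: if_cong)
    also have "\<dots> = (\<Sum>l\<in>J. L i l * N l j)"
      unfolding sum.distrib[symmetric] distrib_right[symmetric] using i by (auto intro!: sum.cong simp: L[of i])
    finally show "L' i j = idm i j + (\<Sum>k\<in>J. N i k * L' k j)" by (simp add: L'_def)
  qed (use ij in auto)
  then show ?thesis by (intro that[of L] L) (simp_all add: L'_def)
qed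

subsection \<open>Finite linear combinations\<close>

text \<open>Linear combinations are given inductively, so that linear maps pass through them by
  induction, without coefficient functions.\<close>

inductive_set lspan :: "('a, 'k::comm_semiring_1) ser set \<Rightarrow> ('a, 'k) ser set" for B where
  zero: "0 \<in> lspan B"
| add: "b \<in> B \<Longrightarrow> f \<in> lspan B \<Longrightarrow> sc k * b + f \<in> lspan B"

lemma lspan_scaled: "b \<in> B \<Longrightarrow> sc k * b \<in> lspan B"
  using lspan.add[OF _ lspan.zero] by fastforce

lemma lspan_base: "b \<in> B \<Longrightarrow> b \<in> lspan B"
  using lspan_scaled[of b B 1] by simp

lemma lspan_plus: "f \<in> lspan B \<Longrightarrow> g \<in> lspan B \<Longrightarrow> f + g \<in> lspan B"
  by (induction f rule: lspan.induct) (auto simp: add.assoc intro: lspan.add)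

lemma lspan_sum: "(\<And>x. x \<in> A \<Longrightarrow> f x \<in> lspan B) \<Longrightarrow> sum f A \<in> lspan B"
  by (induction A rule: infinite_finite_induct) (auto intro: lspan.zero lspan_plus)

lemma lspan_sc: "f \<in> lspan B \<Longrightarrow> sc k * f \<in> lspan B"
  by (induction f rule: lspan.induct)
     (auto simp: distrib_left mult.assoc[symmetric] sc_mult[symmetric] intro: lspan.intros)

text \<open>The two equations on \<open>T\<close> say that it is linear. Multiplications, proper
  parts, right quotients and truncations are later instances.\<close>

lemma lspan_lin:
  assumes "f \<in> lspan B" and "\<And>b. b \<in> B \<Longrightarrow> T b \<in> lspan C"
    and "T 0 = 0" "\<And>k f g. T (sc k * f + g) = sc k * T f + T g"
  shows "T f \<in> lspan C"
  using assms(1) by (induction f rule: lspan.induct) (auto simp: assms(3,4) intro: lspan.zero lspan_plus lspan_sc assms(2))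

lemma lspan_trans: "f \<in> lspan B \<Longrightarrow> (\<And>b. b \<in> B \<Longrightarrow> b \<in> lspan C) \<Longrightarrow> f \<in> lspan C"
  by (rule lspan_lin[where T = "\<lambda>f. f" and B = B]) auto

lemma lspan_mono: "f \<in> lspan B \<Longrightarrow> B \<subseteq> C \<Longrightarrow> f \<in> lspan C"
  by (rule lspan_trans[of f B]) (auto intro: lspan_base)

lemma lspan_left: "f \<in> lspan B \<Longrightarrow> (\<And>b. b \<in> B \<Longrightarrow> x * b \<in> lspan C) \<Longrightarrow> x * f \<in> lspan C"
  by (rule lspan_lin[where T = "\<lambda>f. x * f"]) (auto simp: distrib_left sc_commute_left)

lemma lspan_right: "f \<in> lspan B \<Longrightarrow> (\<And>b. b \<in> B \<Longrightarrow> b * x \<in> lspan C) \<Longrightarrow> f * x \<in> lspan C"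
  by (rule lspan_lin[where T = "\<lambda>f. f * x"]) (auto simp: distrib_right mult.assoc)

lemma lspan_mult:
  assumes "f \<in> lspan B" "g \<in> lspan C" "\<And>b c. b \<in> B \<Longrightarrow> c \<in> C \<Longrightarrow> b * c \<in> lspan D"
  shows "f * g \<in> lspan D"
  using assms(1) by (rule lspan_right) (auto intro: lspan_left assms)

text \<open>Generators are indexed by \<open>T\<close> instead of being a mere set of series, so
  that different monomials with the same value stay apart.\<close>

lemma lspan_coeffs:
  assumes "f \<in> lspan (e ` T)"
  obtains X c where "finite X" "X \<subseteq> T" "f = (\<Sum>x\<in>X. sc (c x) * e x)"
proof -
  have "\<exists>X c. finite X \<and> X \<subseteq> T \<and> f = (\<Sum>x\<in>X. sc (c x) * e x)"
    using assms
  proof (induction f rule: lspan.induct)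
    case zero
    show ?case by (rule exI[of _ "{}"]) simp
  next
    case (add b f k)
    then obtain X c t where X: "finite X" "X \<subseteq> T" "f = (\<Sum>x\<in>X. sc (c x) * e x)"
      and t: "t \<in> T" "b = e t" by auto
    define d where "d = c(t := k + (if t \<in> X then c t else 0))"
    have "(\<Sum>x\<in>insert t X. sc (d x) * e x) = sc (d t) * e t + (\<Sum>x\<in>X - {t}. sc (d x) * e x)"
      using X(1) by (simp add: sum.insert_remove)
    also have "(\<Sum>x\<in>X - {t}. sc (d x) * e x) = (\<Sum>x\<in>X - {t}. sc (c x) * e x)"
      by (auto intro!: sum.cong simp: d_def)
    also have "sc (d t) * e t + \<dots> = sc k * b + f"
      using X(1,3) t by (auto simp: d_def sc_add distrib_right add.assoc sum.remove[of X t])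
    finally show ?case using X t by (intro exI[of _ "insert t X"] exI[of _ d]) auto
  qed
  then show ?thesis using that by blast
qed

section \<open>Nested words as trees\<close>

datatype 'a nt = Emp | Itl 'a "'a nt" | Arc 'a "'a nt" 'a "'a nt"

fun yield :: "'a nt \<Rightarrow> 'a list" where
  "yield Emp = []"
| "yield (Itl a t) = a # yield t"
| "yield (Arc a t b s) = a # yield t @ b # yield s"

abbreviation len :: "'a nt \<Rightarrow> nat" where
  "len t \<equiv> length (yield t)"

section \<open>The nesting relation of a tree\<close>

definition sh :: "nat \<Rightarrow> (nat \<times> nat) set \<Rightarrow> (nat \<times> nat) set" where
  "sh k \<nu> = (\<lambda>(i, j). (i + k, j + k)) ` \<nu>"

lemma mem_sh: "(i, j) \<in> sh k \<nu> \<longleftrightarrow> k \<le> i \<and> k \<le> j \<and> (i - k, j - k) \<in> \<nu>"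
  by (force simp: sh_def image_iff split: prod.splits)

fun nu :: "'a nt \<Rightarrow> (nat \<times> nat) set" where
  "nu Emp = {}"
| "nu (Itl a t) = sh 1 (nu t)"
| "nu (Arc a t b s) = insert (1, len t + 2) (sh 1 (nu t) \<union> sh (len t + 2) (nu s))"

lemma nu_bounds: "(i, j) \<in> nu t \<Longrightarrow> 1 \<le> i \<and> i < j \<and> j \<le> len t"
  by (induction t arbitrary: i j) (force simp: mem_sh)+

lemma nu_bounds':
  assumes "(i - k, j - k) \<in> nu t"
  shows "k < i \<and> i < j \<and> j \<le> k + len t"
  using nu_bounds[OF assms] by linarith

lemma nu_functional: "(i, j) \<in> nu t \<Longrightarrow> (i, j') \<in> nu t \<Longrightarrow> j = j'"
proof (induction t arbitrary: i j j')
  case (Itl a t)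
  then have "j - 1 = j' - 1" by (intro Itl.IH[of "i - 1"]) (auto simp: mem_sh)
  with Itl.prems show ?case by (auto simp: mem_sh)
next
  case (Arc a t b s)
  have "j - 1 = j' - 1" if "(i - 1, j - 1) \<in> nu t" "(i - 1, j' - 1) \<in> nu t" 
    using Arc.IH(1) that by blast
  moreover have "j - (len t + 2) = j' - (len t + 2)"
    if "(i - (len t + 2), j - (len t + 2)) \<in> nu s" "(i - (len t + 2), j' - (len t + 2)) \<in> nu s"
    using Arc.IH(2) that by blast
  ultimately show ?case using Arc.prems
    by (auto simp: mem_sh dest: nu_bounds')
qed simp

lemma nu_injective: "(i, j) \<in> nu t \<Longrightarrow> (i', j) \<in> nu t \<Longrightarrow> i = i'"
proof (induction t arbitrary: i i' j)
  case (Itl a t)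
  then have "i - 1 = i' - 1" by (intro Itl.IH[of _ "j - 1"]) (auto simp: mem_sh)
  with Itl.prems show ?case by (auto simp: mem_sh)
next
  case (Arc a t b s)
  have "i - 1 = i' - 1" if "(i - 1, j - 1) \<in> nu t" "(i' - 1, j - 1) \<in> nu t" 
    using Arc.IH(1) that by blast
  moreover have "i - (len t + 2) = i' - (len t + 2)"
    if "(i - (len t + 2), j - (len t + 2)) \<in> nu s" "(i' - (len t + 2), j - (len t + 2)) \<in> nu s"
    using Arc.IH(2) that by blast
  ultimately show ?case using Arc.prems
    by (auto simp: mem_sh dest: nu_bounds')
qed simp

lemma nu_nested: "(i, j) \<in> nu t \<Longrightarrow> (i', j') \<in> nu t \<Longrightarrow> i < i' \<Longrightarrow> j < i' \<or> j' < j"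
proof (induction t arbitrary: i j i' j')
  case (Itl a t)
  then show ?case by (fastforce simp: sh_def)
next
  case (Arc a t b s)
  let ?r = "len t + 2"
  have cases: "(i, j) = (1, ?r) \<or> (\<exists>i0 j0. (i, j) = (Suc i0, Suc j0) \<and> (i0, j0) \<in> nu t \<and> i0 < j0 \<and> j0 \<le> len t)
      \<or> (\<exists>i0 j0. (i, j) = (i0 + ?r, j0 + ?r) \<and> (i0, j0) \<in> nu s \<and> 1 \<le> i0 \<and> i0 < j0)"
    if "(i, j) \<in> nu (Arc a t b s)" for i j
    using that nu_bounds[of _ _ t] nu_bounds[of _ _ s] by (auto simp: sh_def)
  show ?case using cases[OF Arc.prems(1)] cases[OF Arc.prems(2)]
  proof (elim disjE exE conjE)
    fix i0 j0 i1 j1 assume "(i, j) = (Suc i0, Suc j0)" "(i', j') = (Suc i1, Suc j1)" "(i0, j0) \<in> nu t" "(i1, j1) \<in> nu t"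
    then show ?thesis using Arc.IH(1)[of i0 j0 i1 j1] Arc.prems(3) by simp
  next
    fix i0 j0 i1 j1 assume "(i, j) = (i0 + ?r, j0 + ?r)" "(i', j') = (i1 + ?r, j1 + ?r)" "(i0, j0) \<in> nu s" "(i1, j1) \<in> nu s"
    then show ?thesis using Arc.IH(2)[of i0 j0 i1 j1] Arc.prems(3) by simp
  qed (use Arc.prems(3) in simp_all)
qed simp

lemma nu_Nest: "nu t \<in> Nest (len t)"
proof -
  have "nu t \<subseteq> {1..len t} \<times> {1..len t}"
    using nu_bounds[of _ _ t] by fastforce
  then show ?thesis
    unfolding Nest_def using nu_functional[of _ _ t] nu_injective[of _ _ t] nu_nested[of _ _ t] nu_bounds[of _ _ t]
    by blast
qed

section \<open>Trees as descriptions of factors of a nested word\<close>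

lemma Nest_bounds: "\<nu> \<in> Nest n \<Longrightarrow> (i, j) \<in> \<nu> \<Longrightarrow> 1 \<le> i \<and> i < j \<and> j \<le> n"
  unfolding Nest_def by auto
lemma Nest_functional: "\<nu> \<in> Nest n \<Longrightarrow> (i, j) \<in> \<nu> \<Longrightarrow> (i, j') \<in> \<nu> \<Longrightarrow> j = j'"
  unfolding Nest_def by blast
lemma Nest_injective: "\<nu> \<in> Nest n \<Longrightarrow> (i, j) \<in> \<nu> \<Longrightarrow> (i', j) \<in> \<nu> \<Longrightarrow> i = i'"
  unfolding Nest_def by blast
lemma Nest_nested: "\<nu> \<in> Nest n \<Longrightarrow> (i, j) \<in> \<nu> \<Longrightarrow> (i', j') \<in> \<nu> \<Longrightarrow> i < i' \<Longrightarrow> j < i' \<or> j' < j"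
  unfolding Nest_def by blast
lemma Nest_call_not_return: "\<nu> \<in> Nest n \<Longrightarrow> (i, j) \<in> \<nu> \<Longrightarrow> (j, k) \<in> \<nu> \<Longrightarrow> False"
  using Nest_nested[of \<nu> n i j j k] Nest_bounds[of \<nu> n i j] Nest_bounds[of \<nu> n j k] by auto

text \<open>The tree \<open>t\<close> describes the factor of \<open>(w, \<nu>)\<close> at the positions \<open>k + 1, \<dots>, k + len t\<close>.\<close>

fun emb :: "'a list \<Rightarrow> (nat \<times> nat) set \<Rightarrow> nat \<Rightarrow> 'a nt \<Rightarrow> bool" where
  "emb w \<nu> k Emp = True"
| "emb w \<nu> k (Itl a t) =
     (k < length w \<and> w ! k = a \<and> Suc k \<notin> Field \<nu> \<and> emb w \<nu> (Suc k) t)"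
| "emb w \<nu> k (Arc a t b s) =
     (k + len t + 1 < length w \<and> w ! k = a \<and> w ! (k + len t + 1) = b
      \<and> (Suc k, k + len t + 2) \<in> \<nu> \<and> emb w \<nu> (Suc k) t \<and> emb w \<nu> (k + len t + 2) s)"

text \<open>Transfers a factor to another word and offset. \<open>emb\<close> uses arcs positively
  and internal positions negatively, so arcs have to be carried forward and endpoints of arcs have
  to be carried back.\<close>

lemma emb_shift:
  assumes "emb w \<nu> k t"
    and "\<And>i. i < len t \<Longrightarrow> k' + i < length w' \<and> w' ! (k' + i) = w ! (k + i)"
    and "\<And>i j. (k + i, k + j) \<in> \<nu> \<Longrightarrow> 1 \<le> i \<Longrightarrow> j \<le> len t \<Longrightarrow> (k' + i, k' + j) \<in> \<nu>'"
    and "\<And>i. 1 \<le> i \<Longrightarrow> i \<le> len t \<Longrightarrow> k' + i \<in> Field \<nu>' \<Longrightarrow> k + i \<in> Field \<nu>"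
  shows "emb w' \<nu>' k' t"
  using assms
proof (induction t arbitrary: k k')
  case (Itl a t)
  have "emb w' \<nu>' (Suc k') t"
  proof (rule Itl.IH[of "Suc k"])
    fix i assume "i < len t" then show "Suc k' + i < length w' \<and> w' ! (Suc k' + i) = w ! (Suc k + i)"
      using Itl.prems(2)[of "Suc i"] by simp
  next
    fix i j assume "(Suc k + i, Suc k + j) \<in> \<nu>" "1 \<le> i" "j \<le> len t"
    then show "(Suc k' + i, Suc k' + j) \<in> \<nu>'"
      using Itl.prems(3)[of "Suc i" "Suc j"] by simp
  next
    fix i assume "1 \<le> i" "i \<le> len t" "Suc k' + i \<in> Field \<nu>'"
    then show "Suc k + i \<in> Field \<nu>" using Itl.prems(4)[of "Suc i"] by simp
  qed (use Itl.prems in simp)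
  then show ?case using Itl.prems(1) Itl.prems(2)[of 0] Itl.prems(4)[of 1] by auto
next
  case (Arc a t b s)
  have "emb w' \<nu>' (Suc k') t"
  proof (rule Arc.IH(1)[of "Suc k"])
    fix i assume "i < len t" then show "Suc k' + i < length w' \<and> w' ! (Suc k' + i) = w ! (Suc k + i)"
      using Arc.prems(2)[of "Suc i"] by simp
  next
    fix i j assume "(Suc k + i, Suc k + j) \<in> \<nu>" "1 \<le> i" "j \<le> len t"
    then show "(Suc k' + i, Suc k' + j) \<in> \<nu>'"
      using Arc.prems(3)[of "Suc i" "Suc j"] by simp
  next
    fix i assume "1 \<le> i" "i \<le> len t" "Suc k' + i \<in> Field \<nu>'"
    then show "Suc k + i \<in> Field \<nu>" using Arc.prems(4)[of "Suc i"] by simp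
  qed (use Arc.prems in simp)
  moreover have "emb w' \<nu>' (k' + len t + 2) s"
  proof (rule Arc.IH(2)[of "k + len t + 2"])
    fix i assume "i < len s" 
    then show "k' + len t + 2 + i < length w' \<and> w' ! (k' + len t + 2 + i) = w ! (k + len t + 2 + i)"
      using Arc.prems(2)[of "len t + 2 + i"] by (simp add: algebra_simps)
  next
    fix i j assume "(k + len t + 2 + i, k + len t + 2 + j) \<in> \<nu>" "1 \<le> i" "j \<le> len s"
    then show "(k' + len t + 2 + i, k' + len t + 2 + j) \<in> \<nu>'"
      using Arc.prems(3)[of "len t + 2 + i" "len t + 2 + j"] by (simp add: algebra_simps)
  next
    fix i assume "1 \<le> i" "i \<le> len s" "k' + len t + 2 + i \<in> Field \<nu>'"
    then show "k + len t + 2 + i \<in> Field \<nu>" 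
      using Arc.prems(4)[of "len t + 2 + i"] by (simp add: algebra_simps)
  qed (use Arc.prems in simp)
  ultimately show ?case
    using Arc.prems(1) Arc.prems(2)[of 0] Arc.prems(2)[of "len t + 1"] Arc.prems(3)[of 1 "len t + 2"]
    by auto
qed simp

lemma Field_sh: "i \<in> Field (sh k \<nu>) \<longleftrightarrow> k \<le> i \<and> i - k \<in> Field \<nu>"
proof
  assume "k \<le> i \<and> i - k \<in> Field \<nu>"
  then obtain j where "(i - k, j) \<in> \<nu> \<or> (j, i - k) \<in> \<nu>" and k: "k \<le> i" by (auto simp: Field_def)
  then have "(i, j + k) \<in> sh k \<nu> \<or> (j + k, i) \<in> sh k \<nu>" by (auto simp: mem_sh)
  then show "i \<in> Field (sh k \<nu>)" by (auto intro: FieldI1 FieldI2)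
qed (auto simp: Field_def mem_sh)

lemma Field_nu: "i \<in> Field (nu t) \<Longrightarrow> 1 \<le> i \<and> i \<le> len t"
  using nu_bounds by (fastforce simp: Field_def)

lemma emb_self: "emb (yield t) (nu t) 0 t"
proof (induction t)
  case (Itl a t)
  have "emb (yield (Itl a t)) (nu (Itl a t)) (Suc 0) t"
    by (rule emb_shift[OF Itl]) (auto simp: mem_sh Field_sh)
  then show ?case using Field_nu[of 0 t] by (auto simp: Field_sh)
next
  case (Arc a t b s)
  have "emb (yield (Arc a t b s)) (nu (Arc a t b s)) (Suc 0) t"
    by (rule emb_shift[OF Arc(1)])
       (auto simp: mem_sh Field_sh nth_append nth_Cons' dest: Field_nu)
  moreover have "emb (yield (Arc a t b s)) (nu (Arc a t b s)) (len t + 2) s"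
    by (rule emb_shift[OF Arc(2)])
       (auto simp: mem_sh Field_sh nth_append dest: Field_nu)
  ultimately show ?case by (simp add: nth_append)
qed simp

text \<open>The first position decides the constructor, and functionality of \<nu> fixes the return.
  The lengths must be compared because \<open>Emp\<close> fits at every offset.\<close>

lemma emb_unique:
  assumes "\<nu> \<in> Nest n" "emb w \<nu> k t" "emb w \<nu> k s" "len t = len s"
  shows "t = s"
  using assms(2-)
proof (induction t arbitrary: k s)
  case Emp
  then show ?case by (cases s) auto
next
  case (Itl a t)
  then show ?case by (cases s) (auto intro: FieldI1)
next
  case (Arc a t b t')
  show ?case
  proof (cases s)
    case (Arc a1 s1 b1 s2)
    with Arc.prems have "len t = len s1"
      using Nest_functional[OF assms(1), of "Suc k" "k + len t + 2" "k + len s1 + 2"] by auto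
    then show ?thesis using Arc Arc.prems Arc.IH(1)[of "Suc k" s1] Arc.IH(2)[of "k + len t + 2" s2] by auto
  qed (use Arc.prems in \<open>auto intro: FieldI1\<close>)
qed

text \<open>The window from \<open>k + 1\<close> to \<open>m\<close> has to be closed under arcs. If
  its first position is a call, the nesting condition makes the inside of the arc and the part
  behind it closed windows again. Otherwise the position is internal, since a return there would
  have its call outside the window.\<close>

lemma emb_exists:
  assumes N: "\<nu> \<in> Nest (length w)" and "k \<le> m" "m \<le> length w"
    and "\<And>i j. (i, j) \<in> \<nu> \<Longrightarrow> (k < i \<and> i \<le> m) = (k < j \<and> j \<le> m)"
  shows "\<exists>t. emb w \<nu> k t \<and> len t = m - k"
  using assms(2-)
proof (induction "m - k" arbitrary: k m rule: less_induct)
  case less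
  note b = Nest_bounds[OF N] and f = Nest_functional[OF N] and nst = Nest_nested[OF N]
    and cr = Nest_call_not_return[OF N]
  show ?case
  proof (cases "k = m")
    case True
    then show ?thesis by (intro exI[of _ Emp]) simp
  next
    case False
    with less.prems have km: "k < m" by simp
    show ?thesis
    proof (cases "\<exists>j. (Suc k, j) \<in> \<nu>")
      case True
      then obtain j where j: "(Suc k, j) \<in> \<nu>" by blast
      with b[OF j] less.prems(3)[OF j] km have jm: "Suc k < j" "j \<le> m" by auto
      have "\<exists>t. emb w \<nu> (Suc k) t \<and> len t = (j - 1) - Suc k"
      proof (rule less.hyps)
        fix i' j' assume "(i', j') \<in> \<nu>"
        then show "(Suc k < i' \<and> i' \<le> j - 1) = (Suc k < j' \<and> j' \<le> j - 1)"
          using less.prems(3)[of i' j'] b[of i' j'] nst[OF j, of i' j'] f[OF j, of j'] jm 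
          by (cases "i' = Suc k") auto
      qed (use jm km less.prems in auto)
      then obtain t where t: "emb w \<nu> (Suc k) t" "len t = j - 1 - Suc k" by blast
      have "\<exists>t. emb w \<nu> j t \<and> len t = m - j"
      proof (rule less.hyps)
        fix i' j' assume ij: "(i', j') \<in> \<nu>"
        then show "(j < i' \<and> i' \<le> m) = (j < j' \<and> j' \<le> m)"
          using less.prems(3)[of i' j'] b[of i' j'] nst[OF j, of i' j'] f[OF j, of j'] jm cr[OF j, of j']
          by (cases "i' = Suc k"; cases "i' = j") auto
      qed (use jm km less.prems in auto)
      then obtain s where s: "emb w \<nu> j s" "len s = m - j" by blast
      have "k + len t + 2 = j" using t jm by simp
      moreover have "k + len t + 1 = j - 1" using t jm by simp
      ultimately show ?thesis using t s j jm less.prems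
        by (intro exI[of _ "Arc (w ! k) t (w ! (j - 1)) s"]) auto
    next
      case nocall: False
      have "Suc k \<notin> Field \<nu>"
      proof
        assume "Suc k \<in> Field \<nu>"
        with nocall obtain i where i: "(i, Suc k) \<in> \<nu>" by (auto simp: Field_def)
        with b[OF i] less.prems(3)[OF i] km show False by auto
      qed
      moreover have "\<exists>t. emb w \<nu> (Suc k) t \<and> len t = m - Suc k"
      proof (rule less.hyps)
        fix i' j' assume "(i', j') \<in> \<nu>"
        then show "(Suc k < i' \<and> i' \<le> m) = (Suc k < j' \<and> j' \<le> m)"
          using less.prems(3)[of i' j'] b[of i' j'] nocall
          by (cases "i' = Suc k") auto
      qed (use km less.prems in auto)
      then obtain t where "emb w \<nu> (Suc k) t" "len t = m - Suc k" by blast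
      ultimately show ?thesis using km less.prems
        by (intro exI[of _ "Itl (w ! k) t"]) auto
    qed
  qed
qed

text \<open>\<open>emb\<close> only demands the arcs that the tree shows; here \<nu> is seen to have
  no others starting in the factor. This makes \<open>nu\<close> surjective onto the nesting
  relations.\<close>

lemma emb_mem:
  assumes N: "\<nu> \<in> Nest n" and "emb w \<nu> k t" "k < i" "i \<le> k + len t"
  shows "(i, j) \<in> \<nu> \<longleftrightarrow> k < j \<and> (i - k, j - k) \<in> nu t"
  using assms(2-)
proof (induction t arbitrary: k)
  case (Itl a t)
  show ?case
  proof (cases "i = Suc k")
    case True
    then have "(i, j) \<notin> \<nu>" using Itl.prems by (auto intro: FieldI1)
    with True show ?thesis by (auto simp: mem_sh dest: nu_bounds)
  next
    case False
    with Itl.prems have "(i, j) \<in> \<nu> \<longleftrightarrow> Suc k < j \<and> (i - Suc k, j - Suc k) \<in> nu t"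
      by (intro Itl.IH) auto
    with False Itl.prems show ?thesis by (auto simp: mem_sh dest: nu_bounds)
  qed
next
  case (Arc a t b s)
  let ?r = "k + len t + 2"
  have arc: "(Suc k, ?r) \<in> \<nu>" using Arc.prems by simp
  consider "i = Suc k" | "Suc k < i" "i \<le> Suc k + len t" | "i = ?r" | "?r < i" using Arc.prems by fastforce
  then show ?case
  proof cases
    case 1
    then have "(i, j) \<in> \<nu> \<longleftrightarrow> j = ?r" using arc Nest_functional[OF N, of "Suc k"] by auto
    with 1 show ?thesis by (auto simp: mem_sh dest: nu_bounds)
  next
    case 2
    with Arc.prems have "(i, j) \<in> \<nu> \<longleftrightarrow> Suc k < j \<and> (i - Suc k, j - Suc k) \<in> nu t"
      by (intro Arc.IH(1)) auto
    with 2 show ?thesis by (auto simp: mem_sh dest: nu_bounds)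
  next
    case 3
    then have "(i, j) \<notin> \<nu>" using Nest_call_not_return[OF N arc, of j] by auto
    with 3 show ?thesis by (auto simp: mem_sh dest: nu_bounds)
  next
    case 4
    with Arc.prems have "(i, j) \<in> \<nu> \<longleftrightarrow> ?r < j \<and> (i - ?r, j - ?r) \<in> nu s"
      by (intro Arc.IH(2)) auto
    with 4 show ?thesis by (auto simp: mem_sh dest: nu_bounds)
  qed
qed simp

lemma emb_yield: "emb w \<nu> k t \<Longrightarrow> yield t = take (len t) (drop k w)"
proof (induction t arbitrary: k)
  case (Itl a t)
  then show ?case by (simp add: Cons_nth_drop_Suc[symmetric])
next
  case (Arc a t b s)
  have t: "yield t = take (len t) (drop (Suc k) w)" and s: "yield s = take (len s) (drop (k + len t + 2) w)"
    using Arc by auto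
  have "drop k w = a # drop (Suc k) w"
    using Arc.prems by (simp add: Cons_nth_drop_Suc[symmetric])
  also have "drop (Suc k) w = yield t @ drop (k + len t + 1) w"
    by (subst append_take_drop_id[of "len t", symmetric]) (simp only: t[symmetric] drop_drop, simp add: ac_simps)
  also have "drop (k + len t + 1) w = b # drop (k + len t + 2) w"
    using Arc.prems Cons_nth_drop_Suc[of "k + len t + 1" w] by simp
  finally have d: "drop k w = a # yield t @ b # drop (k + len t + 2) w" .
  have "take (len s) (drop (Suc (Suc (k + len t))) w) = yield s"
    using s[symmetric] by (simp only: add_2_eq_Suc')
  with d show ?case by simp
qed simp

text \<open>Sums over the nesting relations of a word become sums over its trees, which opens the
  way to structural recursion.\<close>

lemma bij_betw_nu: "bij_betw nu {t. yield t = w} (Nest (length w))"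
proof (rule bij_betwI')
  fix t s assume t: "t \<in> {t. yield t = w}" "s \<in> {t. yield t = w}"
  show "(nu t = nu s) = (t = s)"
  proof
    assume eq: "nu t = nu s"
    have "emb w (nu t) 0 t" "emb w (nu t) 0 s" using emb_self[of t] emb_self[of s] t eq by auto
    with nu_Nest[of t] show "t = s" using emb_unique t by fastforce
  qed simp
next
  fix t assume "t \<in> {t. yield t = w}" then show "nu t \<in> Nest (length w)" using nu_Nest by auto
next
  fix \<nu> assume N: "\<nu> \<in> Nest (length w)"
  obtain t where t: "emb w \<nu> 0 t" "len t = length w"
    using emb_exists[OF N, of 0 "length w"] Nest_bounds[OF N]
    by (metis diff_zero le0 le_refl less_le_trans nat_less_le not_less order.strict_trans1 zero_less_one)
  have "(i, j) \<in> \<nu> \<longleftrightarrow> (i, j) \<in> nu t" for i j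
    using emb_mem[OF N t(1), of i j] t(2) Nest_bounds[OF N, of i j] nu_bounds[of i j t] by auto
  then have "\<nu> = nu t" by auto
  moreover have "yield t = w" using emb_yield[OF t(1)] t(2) by simp
  ultimately show "\<exists>t\<in>{t. yield t = w}. \<nu> = nu t" by blast
qed

lemma finite_Nest: "finite (Nest n)"
  by (rule finite_subset[of _ "Pow ({1..n} \<times> {1..n})"]) (auto simp: Nest_def)

lemma finite_yield [simp]: "finite {t. yield t = w}"
  using bij_betw_nu finite_Nest bij_betw_finite by blast

section \<open>Linear representations of tree series\<close>

definition ysum :: "('a nt \<Rightarrow> 'k::comm_semiring_1) \<Rightarrow> ('a, 'k) ser" where
  "ysum f = Ser (\<lambda>w. \<Sum>t\<in>{t. yield t = w}. f t)"

lemma cf_ysum: "cf (ysum f) w = (\<Sum>t\<in>{t. yield t = w}. f t)"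
  by (simp add: ysum_def)

lemma cf_ysum_Nest: "cf (ysum (\<lambda>t. F (yield t) (nu t))) w = (\<Sum>\<nu>\<in>Nest (length w). F w \<nu>)"
  by (simp add: cf_ysum sum.reindex_bij_betw[OF bij_betw_nu, symmetric])

lemma yield_eq_Nil: "yield t = [] \<longleftrightarrow> t = Emp"
  by (cases t) auto

lemma cf_ysum_Nil [simp]: "cf (ysum f) [] = f Emp"
  by (simp add: cf_ysum yield_eq_Nil)

lemma yield_eq_Cons: "{t. yield t = a # v} = Itl a ` {t. yield t = v} \<union>
  (\<Union>i<length v. (\<lambda>(t, s). Arc a t (v ! i) s) ` ({t. yield t = take i v} \<times> {s. yield s = drop (Suc i) v}))"
  (is "?L = ?R")
proof
  show "?L \<subseteq> ?R"
  proof
    fix t assume "t \<in> ?L"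
    then show "t \<in> ?R"
    proof (cases t)
      case (Arc a' t1 b s)
      then have "a' = a" "v = yield t1 @ b # yield s" using \<open>t \<in> ?L\<close> by auto
      then show ?thesis using Arc
        by (intro UnI2 UN_I[of "len t1"] image_eqI[of _ _ "(t1, s)"]) (auto simp: nth_append)
    qed auto
  qed
  show "?R \<subseteq> ?L" by (auto simp: id_take_nth_drop[symmetric])
qed

lemma cf_ysum_Cons:
  "cf (ysum f) (a # v) = cf (ysum (\<lambda>t. f (Itl a t))) v +
     (\<Sum>i<length v. \<Sum>t\<in>{t. yield t = take i v}. \<Sum>s\<in>{s. yield s = drop (Suc i) v}. f (Arc a t (v ! i) s))"
proof -
  let ?T = "\<lambda>i. {t. yield t = take i v} \<times> {s. yield s = drop (Suc i) v}"
  let ?g = "\<lambda>i (t, s). Arc a t (v ! i) s"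
  have "cf (ysum f) (a # v) = sum f (Itl a ` {t. yield t = v}) + sum f (\<Union>i<length v. ?g i ` ?T i)"
    unfolding cf_ysum yield_eq_Cons by (intro sum.union_disjoint) auto
  also have "sum f (Itl a ` {t. yield t = v}) = cf (ysum (\<lambda>t. f (Itl a t))) v"
    by (subst sum.reindex) (auto simp: inj_on_def cf_ysum)
  also have "sum f (\<Union>i<length v. ?g i ` ?T i) = (\<Sum>i<length v. sum f (?g i ` ?T i))"
  proof (rule sum.UNION_disjoint)
    show "\<forall>i\<in>{..<length v}. \<forall>j\<in>{..<length v}. i \<noteq> j \<longrightarrow> ?g i ` ?T i \<inter> ?g j ` ?T j = {}"
    proof (intro ballI impI)
      fix i j assume "i \<in> {..<length v}" "j \<in> {..<length v}" "i \<noteq> j"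
      then have "take i v \<noteq> take j v" by (auto dest: arg_cong[of _ _ length])
      then show "?g i ` ?T i \<inter> ?g j ` ?T j = {}" by auto
    qed
  qed auto
  also have "\<dots> = (\<Sum>i<length v. \<Sum>t\<in>{t. yield t = take i v}. \<Sum>s\<in>{s. yield s = drop (Suc i) v}. f (Arc a t (v ! i) s))"
    by (rule sum.cong[OF refl], subst sum.reindex)
       (auto simp: inj_on_def sum.cartesian_product intro!: sum.cong)
  finally show ?thesis .
qed

lemma cf_mult_lt_mult:
  "cf (f * (lt b * g)) v = (\<Sum>i<length v. if v ! i = b then cf f (take i v) * cf g (drop (Suc i) v) else 0)"
proof -
  have "cf (f * (lt b * g)) v = (\<Sum>i\<le>length v. cf f (take i v) * cf (lt b * g) (drop i v))"
    by (simp add: cf_mult[of f] cauchy_def atMost_atLeast0)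
  also have "\<dots> = (\<Sum>i<length v. cf f (take i v) * cf (lt b * g) (drop i v))"
    by (simp add: lessThan_Suc_atMost[symmetric] cf_lt)
  also have "\<dots> = (\<Sum>i<length v. if v ! i = b then cf f (take i v) * cf g (drop (Suc i) v) else 0)"
    by (intro sum.cong) (auto simp: Cons_nth_drop_Suc[symmetric])
  finally show ?thesis .
qed

text \<open>The bridge between functions on trees and series: if the recursion of \<open>f\<close>
  is linear at \<open>Itl\<close> and bilinear at \<open>Arc\<close>, then concatenation of yields
  turns sums over pairs of subtrees into Cauchy products.\<close>

lemma ysum_bilinear:
  fixes f :: "'a::finite nt \<Rightarrow> 'k::comm_semiring_1"
  assumes Itl: "\<And>a t. f (Itl a t) = (\<Sum>h\<in>F. cI a h * \<mu> h t)"
    and Arc: "\<And>a b t s. f (Arc a t b s) = (\<Sum>h\<in>F. \<Sum>h'\<in>F. cC a b h h' * \<mu> h t * \<mu> h' s)"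
  shows "ysum f = sc (f Emp) + (\<Sum>a\<in>UNIV. \<Sum>h\<in>F. sc (cI a h) * (lt a * ysum (\<mu> h)))
    + (\<Sum>a\<in>UNIV. \<Sum>b\<in>UNIV. \<Sum>h\<in>F. \<Sum>h'\<in>F.
        sc (cC a b h h') * (lt a * (ysum (\<mu> h) * (lt b * ysum (\<mu> h')))))"
proof (rule ser_eqI)
  fix w
  show "cf (ysum f) w = cf (sc (f Emp) + (\<Sum>a\<in>UNIV. \<Sum>h\<in>F. sc (cI a h) * (lt a * ysum (\<mu> h)))
    + (\<Sum>a\<in>UNIV. \<Sum>b\<in>UNIV. \<Sum>h\<in>F. \<Sum>h'\<in>F.
        sc (cC a b h h') * (lt a * (ysum (\<mu> h) * (lt b * ysum (\<mu> h')))))) w"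
  proof (cases w)
    case Nil
    then show ?thesis by (simp add: cf_sc)
  next
    case (Cons a v)
    have 1: "(\<Sum>x\<in>UNIV. \<Sum>h\<in>F. cI x h * (if x = a then cf (ysum (\<mu> h)) v else 0))
        = cf (ysum (\<lambda>t. f (Itl a t))) v"
    proof -
      have "(\<Sum>x\<in>UNIV. \<Sum>h\<in>F. cI x h * (if x = a then cf (ysum (\<mu> h)) v else 0))
          = (\<Sum>x\<in>UNIV. if x = a then \<Sum>h\<in>F. cI x h * cf (ysum (\<mu> h)) v else 0)"
        by (rule sum.cong[OF refl]) auto
      also have "\<dots> = (\<Sum>h\<in>F. cI a h * cf (ysum (\<mu> h)) v)" by (subst sum.delta) simp_all
      also have "\<dots> = cf (ysum (\<lambda>t. f (Itl a t))) v"
        unfolding cf_ysum Itl sum_distrib_left by (rule sum.swap)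
      finally show ?thesis .
    qed
    have 2: "(\<Sum>x\<in>UNIV. \<Sum>b\<in>UNIV. \<Sum>h\<in>F. \<Sum>h'\<in>F.
        cC x b h h' * (if x = a then cf (ysum (\<mu> h) * (lt b * ysum (\<mu> h'))) v else 0)) =
      (\<Sum>i<length v. \<Sum>t\<in>{t. yield t = take i v}. \<Sum>s\<in>{s. yield s = drop (Suc i) v}. f (Arc a t (v ! i) s))"
      (is "?L = ?R")
    proof -
      let ?P = "\<lambda>b i h h'. cf (ysum (\<mu> h)) (take i v) * cf (ysum (\<mu> h')) (drop (Suc i) v)"
      have "?L = (\<Sum>x\<in>UNIV. if x = a then \<Sum>b\<in>UNIV. \<Sum>h\<in>F. \<Sum>h'\<in>F.
          cC x b h h' * cf (ysum (\<mu> h) * (lt b * ysum (\<mu> h'))) v else 0)"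
        by (rule sum.cong[OF refl]) auto
      also have "\<dots> = (\<Sum>b\<in>UNIV. \<Sum>h\<in>F. \<Sum>h'\<in>F. \<Sum>i<length v.
          if v ! i = b then cC a b h h' * ?P b i h h' else 0)"
        by (subst sum.delta) (simp_all add: cf_mult_lt_mult sum_distrib_left if_distrib[of "\<lambda>x. _ * x"] cong: if_cong)
      also have "\<dots> = (\<Sum>b\<in>UNIV. \<Sum>i<length v. \<Sum>h\<in>F. \<Sum>h'\<in>F.
          if v ! i = b then cC a b h h' * ?P b i h h' else 0)"
        by (subst (2) sum.swap, subst sum.swap[of _ "{..<length v}" F]) (rule refl)
      also have "\<dots> = (\<Sum>i<length v. \<Sum>b\<in>UNIV. 
          if v ! i = b then \<Sum>h\<in>F. \<Sum>h'\<in>F. cC a b h h' * ?P b i h h' else 0)"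
        by (subst sum.swap) (auto intro!: sum.cong)
      also have "\<dots> = (\<Sum>i<length v. \<Sum>h\<in>F. \<Sum>h'\<in>F. cC a (v ! i) h h' * ?P (v ! i) i h h')"
        by (subst sum.delta') simp_all
      also have "\<dots> = ?R"
      proof (rule sum.cong[OF refl])
        fix i
        let ?A = "{t. yield t = take i v}" and ?B = "{s. yield s = drop (Suc i) v}"
        have "(\<Sum>t\<in>?A. \<Sum>s\<in>?B. f (Arc a t (v ! i) s))
           = (\<Sum>t\<in>?A. \<Sum>h\<in>F. \<Sum>s\<in>?B. \<Sum>h'\<in>F. cC a (v ! i) h h' * \<mu> h t * \<mu> h' s)"
          unfolding Arc by (rule sum.cong[OF refl], rule sum.swap)
        also have "\<dots> = (\<Sum>h\<in>F. \<Sum>t\<in>?A. \<Sum>h'\<in>F. \<Sum>s\<in>?B. cC a (v ! i) h h' * \<mu> h t * \<mu> h' s)"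
          by (subst sum.swap) (intro sum.cong refl sum.swap)
        also have "\<dots> = (\<Sum>h\<in>F. \<Sum>h'\<in>F. \<Sum>t\<in>?A. \<Sum>s\<in>?B. cC a (v ! i) h h' * \<mu> h t * \<mu> h' s)"
          by (intro sum.cong refl sum.swap)
        also have "\<dots> = (\<Sum>h\<in>F. \<Sum>h'\<in>F. cC a (v ! i) h h' * ?P (v ! i) i h h')"
          unfolding cf_ysum sum_product by (simp add: sum_distrib_left mult.assoc)
        finally show "(\<Sum>h\<in>F. \<Sum>h'\<in>F. cC a (v ! i) h h' * ?P (v ! i) i h h') =
            (\<Sum>t\<in>?A. \<Sum>s\<in>?B. f (Arc a t (v ! i) s))" by simp
      qed
      finally show ?thesis .
    qed
    show ?thesis unfolding Cons cf_ysum_Cons 1[symmetric] 2[symmetric] by (simp add: cf_sc)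
  qed
qed

text \<open>A weighted bottom-up tree automaton. The members of \<open>F\<close> are its states,
  their values at \<open>Emp\<close> its arbitrary initial weights. Functions serve as their own
  state names, so no type of states has to be quantified.\<close>

definition representable :: "('b nt \<Rightarrow> 'k::comm_semiring_1) \<Rightarrow> bool" where
  "representable f \<longleftrightarrow> (\<exists>F cI cC. finite F \<and> f \<in> F
     \<and> (\<forall>g\<in>F. \<forall>a t. g (Itl a t) = (\<Sum>h\<in>F. cI g a h * h t))
     \<and> (\<forall>g\<in>F. \<forall>a t b s. g (Arc a t b s) = (\<Sum>h\<in>F. \<Sum>h'\<in>F. cC g a b h h' * h t * h' s)))"

lemma representableE:
  assumes "representable f"
  obtains F cI cC where "finite F" "f \<in> F"
    and "\<And>g a t. g \<in> F \<Longrightarrow> g (Itl a t) = (\<Sum>h\<in>F. cI g a h * h t)"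
    and "\<And>g a t b s. g \<in> F \<Longrightarrow> g (Arc a t b s) = (\<Sum>h\<in>F. \<Sum>h'\<in>F. cC g a b h h' * h t * h' s)"
proof -
  from assms obtain F cI cC where "finite F" "f \<in> F"
    and I: "\<forall>g\<in>F. \<forall>a t. g (Itl a t) = (\<Sum>h\<in>F. cI g a h * h t)"
    and C: "\<forall>g\<in>F. \<forall>a t b s. g (Arc a t b s) = (\<Sum>h\<in>F. \<Sum>h'\<in>F. cC g a b h h' * h t * h' s)"
    unfolding representable_def by (elim exE conjE) (rule that)
  then show ?thesis by (intro that[of F cI cC] I[rule_format] C[rule_format])
qed

text \<open>An indexed family may repeat a function, whereas \<open>representable\<close> speaks of
  a set of functions; coefficients over one fibre of \<mu> are therefore added.\<close>

lemma representableI: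
  fixes \<mu> :: "'j \<Rightarrow> 'b nt \<Rightarrow> 'k::comm_semiring_1"
  assumes J: "finite J" "j0 \<in> J"
    and I: "\<And>j a t. j \<in> J \<Longrightarrow> \<mu> j (Itl a t) = (\<Sum>i\<in>J. cI j a i * \<mu> i t)"
    and C: "\<And>j a t b s. j \<in> J \<Longrightarrow> \<mu> j (Arc a t b s) = (\<Sum>i\<in>J. \<Sum>k\<in>J. cC j a b i k * \<mu> i t * \<mu> k s)"
  shows "representable (\<mu> j0)"
proof -
  define r where "r g = (SOME j. j \<in> J \<and> \<mu> j = g)" for g
  have r: "r g \<in> J \<and> \<mu> (r g) = g" if "g \<in> \<mu> ` J" for g
    unfolding r_def by (rule someI_ex) (use that in auto)
  have gen: "(\<Sum>i\<in>J. H i (\<mu> i)) = (\<Sum>h\<in>\<mu> ` J. \<Sum>i\<in>{i\<in>J. \<mu> i = h}. H i h)"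
    for H :: "'j \<Rightarrow> ('b nt \<Rightarrow> 'k) \<Rightarrow> 'k"
    by (subst sum.image_gen[OF J(1), of _ \<mu>]) (auto intro!: sum.cong)
  have "g (Itl a t) = (\<Sum>h\<in>\<mu> ` J. (\<Sum>i\<in>{i\<in>J. \<mu> i = h}. cI (r g) a i) * h t)"
    if g: "g \<in> \<mu> ` J" for g a t
  proof -
    have "g (Itl a t) = (\<Sum>i\<in>J. cI (r g) a i * \<mu> i t)"
      using r[OF g] I[of "r g"] by simp
    also have "\<dots> = (\<Sum>h\<in>\<mu> ` J. \<Sum>i\<in>{i\<in>J. \<mu> i = h}. cI (r g) a i * h t)"
      by (rule gen)
    finally show ?thesis by (simp add: sum_distrib_right)
  qed
  moreover have "g (Arc a t b s) = (\<Sum>h\<in>\<mu> ` J. \<Sum>h'\<in>\<mu> ` J.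
      (\<Sum>i\<in>{i\<in>J. \<mu> i = h}. \<Sum>k\<in>{k\<in>J. \<mu> k = h'}. cC (r g) a b i k) * h t * h' s)"
    if g: "g \<in> \<mu> ` J" for g a t b s
  proof -
    have "g (Arc a t b s) = (\<Sum>i\<in>J. \<Sum>k\<in>J. cC (r g) a b i k * \<mu> i t * \<mu> k s)"
      using r[OF g] C[of "r g"] by simp
    also have "\<dots> = (\<Sum>h\<in>\<mu> ` J. \<Sum>i\<in>{i\<in>J. \<mu> i = h}. \<Sum>k\<in>J. cC (r g) a b i k * h t * \<mu> k s)"
      by (rule gen)
    also have "\<dots> = (\<Sum>h\<in>\<mu> ` J. \<Sum>i\<in>{i\<in>J. \<mu> i = h}. \<Sum>h'\<in>\<mu> ` J. \<Sum>k\<in>{k\<in>J. \<mu> k = h'}. cC (r g) a b i k * h t * h' s)"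
      by (subst gen) (rule refl)
    also have "\<dots> = (\<Sum>h\<in>\<mu> ` J. \<Sum>h'\<in>\<mu> ` J. \<Sum>i\<in>{i\<in>J. \<mu> i = h}. \<Sum>k\<in>{k\<in>J. \<mu> k = h'}. cC (r g) a b i k * h t * h' s)"
      by (intro sum.cong refl sum.swap)
    finally show ?thesis by (simp add: sum_distrib_right)
  qed
  ultimately show ?thesis unfolding representable_def
    by (intro exI[of _ "\<mu> ` J"] exI[of _ "\<lambda>g a h. \<Sum>i\<in>{i\<in>J. \<mu> i = h}. cI (r g) a i"]
        exI[of _ "\<lambda>g a b h h'. \<Sum>i\<in>{i\<in>J. \<mu> i = h}. \<Sum>k\<in>{k\<in>J. \<mu> k = h'}. cC (r g) a b i k"])
       (use J in auto)
qed

text \<open>The combination is adjoined as a state \<open>None\<close> to which every coefficient on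
  a right-hand side is 0.\<close>

lemma representable_lincomb:
  fixes \<mu> :: "'j \<Rightarrow> 'b nt \<Rightarrow> 'k::comm_semiring_1"
  assumes J: "finite J"
    and I: "\<And>j a t. j \<in> J \<Longrightarrow> \<mu> j (Itl a t) = (\<Sum>i\<in>J. cI j a i * \<mu> i t)"
    and C: "\<And>j a t b s. j \<in> J \<Longrightarrow> \<mu> j (Arc a t b s) = (\<Sum>i\<in>J. \<Sum>k\<in>J. cC j a b i k * \<mu> i t * \<mu> k s)"
  shows "representable (\<lambda>t. \<Sum>j\<in>J. l j * \<mu> j t)"
proof -
  define M where "M = case_option (\<lambda>t. \<Sum>j\<in>J. l j * \<mu> j t) \<mu>"
  define dI where "dI j a i = (case i of None \<Rightarrow> 0 | Some i \<Rightarrow>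
      (case j of None \<Rightarrow> \<Sum>j\<in>J. l j * cI j a i | Some j \<Rightarrow> cI j a i))" for j a i
  define dC where "dC j a b i k = (case i of None \<Rightarrow> 0 | Some i \<Rightarrow> (case k of None \<Rightarrow> 0 | Some k \<Rightarrow>
      (case j of None \<Rightarrow> \<Sum>j\<in>J. l j * cC j a b i k | Some j \<Rightarrow> cC j a b i k)))" for j a b i k
  let ?J = "insert None (Some ` J)"
  have S: "(\<Sum>i\<in>?J. F i) = F None + (\<Sum>i\<in>J. F (Some i))" for F :: "'j option \<Rightarrow> 'k"
    using J by (simp add: sum.reindex)
  have "representable (M None)"
  proof (rule representableI[of ?J None M dI dC])
    fix j a t assume "j \<in> ?J"
    then show "M j (Itl a t) = (\<Sum>i\<in>?J. dI j a i * M i t)"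
      unfolding S by (auto simp: M_def dI_def I sum_distrib_left sum_distrib_right mult.assoc intro: sum.swap)
  next
    fix j a t b s assume j: "j \<in> ?J"
    show "M j (Arc a t b s) = (\<Sum>i\<in>?J. \<Sum>k\<in>?J. dC j a b i k * M i t * M k s)"
    proof (cases j)
      case None
      have "M j (Arc a t b s) = (\<Sum>j\<in>J. \<Sum>i\<in>J. \<Sum>k\<in>J. l j * (cC j a b i k * \<mu> i t * \<mu> k s))"
        by (simp add: None M_def C sum_distrib_left)
      also have "\<dots> = (\<Sum>i\<in>J. \<Sum>k\<in>J. \<Sum>j\<in>J. l j * (cC j a b i k * \<mu> i t * \<mu> k s))"
        by (subst sum.swap) (intro sum.cong refl sum.swap)
      finally show ?thesis unfolding S
        by (simp add: None M_def dC_def sum_distrib_right mult.assoc)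
    next
      case (Some j')
      with j show ?thesis unfolding S by (auto simp: M_def dC_def C)
    qed
  qed (use J in auto)
  then show ?thesis by (simp add: M_def)
qed

subsection \<open>Series of tree type\<close>

definition tgen :: "('a, 'k::comm_semiring_1) ser set \<Rightarrow> ('a, 'k) ser set" where
  "tgen U = insert 1 ({lt a * g |a g. g \<in> U} \<union> {lt a * (g * (lt b * h)) |a g b h. g \<in> U \<and> h \<in> U})"

definition tree_series :: "('a, 'k::comm_semiring_1) ser \<Rightarrow> bool" where
  "tree_series S \<longleftrightarrow> (\<exists>U. finite U \<and> S \<in> U \<and> U \<subseteq> lspan (tgen U))"

lemma tgen_1: "1 \<in> lspan (tgen U)"
  and tgen_sc: "sc k \<in> lspan (tgen U)"
  and tgen_I: "g \<in> U \<Longrightarrow> lt a * g \<in> lspan (tgen U)"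
  and tgen_C: "g \<in> U \<Longrightarrow> h \<in> U \<Longrightarrow> lt a * (g * (lt b * h)) \<in> lspan (tgen U)"
  using lspan_scaled[of 1 "tgen U" k] by (auto simp: tgen_def intro!: lspan_base)

lemma tgen_mono: "U \<subseteq> V \<Longrightarrow> tgen U \<subseteq> tgen V"
  unfolding tgen_def by blast

lemma tree_series_ysum:
  fixes f :: "'a::finite nt \<Rightarrow> 'k::comm_semiring_1"
  assumes "representable f"
  shows "tree_series (ysum f)"
proof -
  obtain F cI cC where F: "finite F" "f \<in> F"
    and I: "\<And>g a t. g \<in> F \<Longrightarrow> g (Itl a t) = (\<Sum>h\<in>F. cI g a h * h t)"
    and C: "\<And>g a t b s. g \<in> F \<Longrightarrow> g (Arc a t b s) = (\<Sum>h\<in>F. \<Sum>h'\<in>F. cC g a b h h' * h t * h' s)"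
    using assms by (rule representableE) (rule that; assumption)
  have "ysum g \<in> lspan (tgen (ysum ` F))" if "g \<in> F" for g
  proof (subst ysum_bilinear[where f = g and F = F and \<mu> = "\<lambda>h. h"])
    show "g (Itl a t) = (\<Sum>h\<in>F. cI g a h * h t)" for a t by (rule I[OF that])
    show "g (Arc a t b s) = (\<Sum>h\<in>F. \<Sum>h'\<in>F. cC g a b h h' * h t * h' s)" for a b t s by (rule C[OF that])
  qed (intro lspan_plus lspan_sum lspan_sc tgen_sc tgen_I tgen_C imageI; assumption)
  then show ?thesis unfolding tree_series_def using F by (intro exI[of _ "ysum ` F"]) auto
qed

definition tcomb where
  "tcomb U c cI cC = sc c + (\<Sum>a\<in>UNIV. \<Sum>h\<in>U. sc (cI a h) * (lt a * h))
    + (\<Sum>a\<in>UNIV. \<Sum>b\<in>UNIV. \<Sum>h\<in>U. \<Sum>h'\<in>U. sc (cC a b h h') * (lt a * (h * (lt b * h'))))"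

lemma tgen_coeffs:
  fixes U :: "('a::finite, 'k::comm_semiring_1) ser set"
  assumes U: "finite U" and f: "f \<in> lspan (tgen U)"
  shows "\<exists>c cI cC. f = tcomb U c cI cC"
proof -
  define e :: "unit + ('a \<times> ('a, 'k) ser) + ('a \<times> 'a \<times> ('a, 'k) ser \<times> ('a, 'k) ser) \<Rightarrow> ('a, 'k) ser"
    where "e = case_sum (\<lambda>_. 1) (case_sum (\<lambda>(a, h). lt a * h) (\<lambda>(a, b, h, h'). lt a * (h * (lt b * h'))))"
  define T :: "(unit + ('a \<times> ('a, 'k) ser) + ('a \<times> 'a \<times> ('a, 'k) ser \<times> ('a, 'k) ser)) set"
    where "T = UNIV <+> ((UNIV \<times> U) <+> (UNIV \<times> UNIV \<times> U \<times> U))"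
  have "tgen U \<subseteq> e ` T"
    unfolding tgen_def T_def e_def by (force simp: image_iff Bex_def split: sum.splits)
  with f have "f \<in> lspan (e ` T)" by (rule lspan_mono)
  then obtain X c where X: "finite X" "X \<subseteq> T" "f = (\<Sum>x\<in>X. sc (c x) * e x)"
    by (rule lspan_coeffs)
  \<comment> \<open>Coefficients are padded with 0: the span names only some of the generators,
    while \<open>tcomb\<close> ranges over all of them.\<close>
  define d where "d x = (if x \<in> X then c x else 0)" for x
  have "finite T" unfolding T_def using U by (intro finite_Plus finite_cartesian_product) auto
  then have "f = (\<Sum>x\<in>T. sc (d x) * e x)"
    unfolding X(3) using X by (intro sum.mono_neutral_cong_left) (auto simp: d_def)
  also have "\<dots> = sc (d (Inl ())) + ((\<Sum>(a, h)\<in>UNIV \<times> U. sc (d (Inr (Inl (a, h)))) * (lt a * h))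
    + (\<Sum>(a, b, h, h')\<in>UNIV \<times> UNIV \<times> U \<times> U. sc (d (Inr (Inr (a, b, h, h')))) * (lt a * (h * (lt b * h')))))"
  proof -
    have fin: "finite ((UNIV :: 'a set) \<times> U)" "finite ((UNIV :: 'a set) \<times> (UNIV :: 'a set) \<times> U \<times> U)"
      using U by (simp_all add: finite_cartesian_product)
    show ?thesis unfolding T_def
      by (subst sum.Plus[OF finite finite_Plus[OF fin]], subst sum.Plus[OF fin])
         (auto simp: e_def UNIV_unit intro!: arg_cong2[of _ _ _ _ plus] sum.cong)
  qed
  finally show ?thesis
    by (intro exI[of _ "d (Inl ())"] exI[of _ "\<lambda>a h. d (Inr (Inl (a, h)))"]
        exI[of _ "\<lambda>a b h h'. d (Inr (Inr (a, b, h, h')))"])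
       (simp add: tcomb_def sum.cartesian_product add.assoc)
qed

primrec trep :: "'j set \<Rightarrow> ('j \<Rightarrow> 'k::comm_semiring_1) \<Rightarrow> ('j \<Rightarrow> 'a \<Rightarrow> 'j \<Rightarrow> 'k)
    \<Rightarrow> ('j \<Rightarrow> 'a \<Rightarrow> 'a \<Rightarrow> 'j \<Rightarrow> 'j \<Rightarrow> 'k) \<Rightarrow> 'a nt \<Rightarrow> 'j \<Rightarrow> 'k" where
  "trep J c cI cC Emp = c"
| "trep J c cI cC (Itl a t) = (\<lambda>j. \<Sum>i\<in>J. cI j a i * trep J c cI cC t i)"
| "trep J c cI cC (Arc a t b s) =
     (\<lambda>j. \<Sum>i\<in>J. \<Sum>k\<in>J. cC j a b i k * trep J c cI cC t i * trep J c cI cC s k)"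

text \<open>The coefficients of the family define functions on trees by recursion
  (\<open>trep\<close>). Their yield sums satisfy the equations of the series in \<open>U\<close>,
  and the solution is unique because every nonconstant term starts with a letter.\<close>

lemma tree_series_imp_representable:
  fixes S :: "('a::finite, 'k::comm_semiring_1) ser"
  assumes "tree_series S"
  obtains f where "representable f" "S = ysum f"
proof -
  obtain U where U: "finite U" "S \<in> U" "U \<subseteq> lspan (tgen U)" using assms unfolding tree_series_def by blast
  have "\<forall>g\<in>U. \<exists>c cI cC. g = tcomb U c cI cC"
    using tgen_coeffs[OF U(1)] U(3) by blast
  then obtain c cI cC where eq: "\<And>g. g \<in> U \<Longrightarrow> g = tcomb U (c g) (cI g) (cC g)"
    by metis
  define \<mu> where "\<mu> g t = trep U c cI cC t g" for g t
  have "representable (\<mu> S)" using U(1,2) by (rule representableI[where cI = cI and cC = cC]) (simp_all add: \<mu>_def)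
  moreover have "S = ysum (\<mu> S)" using U(2)
  proof (rule eqn_induct[rotated])
    fix n g assume IH: "\<And>g. g \<in> U \<Longrightarrow> eqn n g (ysum (\<mu> g))" and g: "g \<in> U"
    note eq' = eq[OF g, unfolded tcomb_def]
    have ysum: "ysum (\<mu> g) = sc (c g) + (\<Sum>a\<in>UNIV. \<Sum>h\<in>U. sc (cI g a h) * (lt a * ysum (\<mu> h)))
      + (\<Sum>a\<in>UNIV. \<Sum>b\<in>UNIV. \<Sum>h\<in>U. \<Sum>h'\<in>U. sc (cC g a b h h') * (lt a * (ysum (\<mu> h) * (lt b * ysum (\<mu> h')))))"
      by (subst ysum_bilinear[where F = U and \<mu> = \<mu> and cI = "cI g" and cC = "cC g"]) (simp_all add: \<mu>_def)
    show "eqn (Suc n) g (ysum (\<mu> g))"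
      unfolding ysum by (subst (1) eq')
        (intro eqn_add eqn_sum eqn_mult[of "Suc n"] eqn_refl eqn_lt eqn_mult[of n] IH; assumption)
  qed
  ultimately show ?thesis by (rule that)
qed

section \<open>Algebraic series\<close>

text \<open>The type of variables is left open: series can be their own variables, with the identity
  as valuation, so that unknowns need no names.\<close>

definition ev :: "('v \<Rightarrow> ('a, 'k::comm_semiring_1) ser) \<Rightarrow> ('a + 'v) list \<Rightarrow> ('a, 'k) ser" where
  "ev \<sigma> u = prod_list (map (case_sum lt \<sigma>) u)"

lemma ev_simps [simp]:
  "ev \<sigma> [] = 1" "ev \<sigma> (Inl a # u) = lt a * ev \<sigma> u" "ev \<sigma> (Inr x # u) = \<sigma> x * ev \<sigma> u"
  "ev \<sigma> (u @ v) = ev \<sigma> u * ev \<sigma> v"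
  by (simp_all add: ev_def)

lemma subst_word_ev: "subst_word (\<lambda>x. cf (\<sigma> x)) u = cf (ev \<sigma> u)"
proof (induction u)
  case Nil
  show ?case by (simp add: subst_word_def one_ser_def)
next
  case (Cons s u)
  then show ?case
    by (cases s) (simp_all add: subst_word_def sym_series_def cf_mult lt_def)
qed

lemma ev_quasiregular:
  assumes "u \<noteq> []" and "\<And>x. Inr x \<in> set u \<Longrightarrow> cf (\<sigma> x) [] = 0"
  shows "cf (ev \<sigma> u) [] = 0"
proof (cases u)
  case (Cons s v)
  then show ?thesis using assms by (cases s) simp_all
qed (use assms in simp)

definition pmon :: "('a, 'k::comm_semiring_1) ser set \<Rightarrow> ('a + ('a, 'k) ser) list set" where
  "pmon U = {u. u \<noteq> [] \<and> (\<forall>g. u \<noteq> [Inr g]) \<and> set u \<subseteq> range Inl \<union> Inr ` U}"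

text \<open>The series in \<open>U\<close> are their own unknowns; \<open>e\<close> numbers them
  because systems are indexed by naturals. \<open>pmon\<close> makes the system proper, and
  \<open>qr\<close> makes the solution quasiregular.\<close>

lemma algebraicI:
  fixes U :: "('a, 'k::comm_semiring_1) ser set"
  assumes U: "finite U" "S \<in> U" and qr: "\<And>g. g \<in> U \<Longrightarrow> cf g [] = 0"
    and sp: "\<And>g. g \<in> U \<Longrightarrow> g \<in> lspan (ev (\<lambda>x. x) ` pmon U)"
  shows "algebraic (cf S)"
proof -
  have "\<forall>g\<in>U. \<exists>X c. finite X \<and> X \<subseteq> pmon U \<and> g = (\<Sum>x\<in>X. sc (c x) * ev (\<lambda>x. x) x)"
  proof
    fix g assume "g \<in> U"
    obtain X c where "finite X" "X \<subseteq> pmon U" "g = (\<Sum>x\<in>X. sc (c x) * ev (\<lambda>x. x) x)"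
      using sp[OF \<open>g \<in> U\<close>] by (rule lspan_coeffs)
    then show "\<exists>X c. finite X \<and> X \<subseteq> pmon U \<and> g = (\<Sum>x\<in>X. sc (c x) * ev (\<lambda>x. x) x)" 
      by (intro exI conjI)
  qed
  from bchoice[OF this] obtain M where M': "\<forall>g\<in>U. \<exists>c. finite (M g) \<and> M g \<subseteq> pmon U
      \<and> g = (\<Sum>x\<in>M g. sc (c x) * ev (\<lambda>x. x) x)" by blast
  from bchoice[OF M'] obtain c where c: "\<forall>g\<in>U. finite (M g) \<and> M g \<subseteq> pmon U
      \<and> g = (\<Sum>x\<in>M g. sc (c g x) * ev (\<lambda>x. x) x)" by blast
  have M: "finite (M g)" "M g \<subseteq> pmon U"
    and eq: "g = (\<Sum>x\<in>M g. sc (c g x) * ev (\<lambda>x. x) x)" if "g \<in> U" for g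
    using c that by blast+
  obtain e :: "('a, 'k) ser \<Rightarrow> nat" where e: "inj_on e U"
    using finite_imp_inj_to_nat_seg[OF U(1)] by blast
  define d where "d = inv_into U e"
  have d: "d (e g) = g" if "g \<in> U" for g using that e by (simp add: d_def)
  define en where "en = map (map_sum (id :: 'a \<Rightarrow> 'a) e)"
  define de where "de = map (map_sum (id :: 'a \<Rightarrow> 'a) d)"
  have de: "de (en u) = u" if "u \<in> pmon U" for u
  proof -
    have "map_sum id d (map_sum id e s) = s" if "s \<in> set u" for s
      using that \<open>u \<in> pmon U\<close> d by (cases s) (auto simp: pmon_def)
    then show ?thesis unfolding de_def en_def map_map by (intro map_idI) simp
  qed
  have ev: "ev d (en u) = ev (\<lambda>x. x) u" if "u \<in> pmon U" for u
  proof -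
    have "case_sum lt d (map_sum id e s) = case_sum lt (\<lambda>x. x) s" if "s \<in> set u" for s
      using that \<open>u \<in> pmon U\<close> d by (cases s) (auto simp: pmon_def)
    then show ?thesis unfolding ev_def en_def map_map by (auto intro!: arg_cong[of _ _ prod_list])
  qed
  define P where "P n u = (if u \<in> en ` M (d n) then c (d n) (de u) else 0)" for n u
  have sup: "supp (P (e g)) \<subseteq> en ` M g" if "g \<in> U" for g
    using that by (auto simp: supp_def P_def d split: if_splits)
  have "proper_system (e ` U) P"
    unfolding proper_system_def alg_system_def
  proof (intro conjI ballI allI impI)
    fix n assume "n \<in> e ` U"
    then obtain g where g: "n = e g" "g \<in> U" by blast
    show "finite (supp (P n))" using sup[OF g(2)] M(1)[OF g(2)] g(1) by (auto intro: finite_subset)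
    show "P n [] = 0" using M(2)[OF g(2)] g by (auto simp: P_def d en_def pmon_def)
    fix m assume "m \<in> e ` U"
    show "P n [Inr m] = 0"
    proof (rule ccontr)
      assume "P n [Inr m] \<noteq> 0"
      then obtain u where u: "u \<in> M g" "en u = [Inr m]" using g by (force simp: P_def d split: if_splits)
      with M(2)[OF g(2)] have "u \<in> pmon U" by blast
      moreover from u(2) obtain s where "u = [s]" "map_sum id e s = Inr m" by (auto simp: en_def)
      ultimately show False by (cases s) (auto simp: pmon_def)
    qed
  next
    fix n u m assume "n \<in> e ` U" "u \<in> supp (P n)" "Inr m \<in> set u"
    then obtain g v where g: "g \<in> U" "v \<in> M g" "u = en v" using sup by blast
    with M(2) have "v \<in> pmon U" by blast
    with \<open>Inr m \<in> set u\<close> g(3) obtain s where "s \<in> set v" "map_sum id e s = Inr m"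
      by (auto simp: en_def)
    with \<open>v \<in> pmon U\<close> show "m \<in> e ` U" by (cases s) (auto simp: pmon_def)
  qed (use U in simp)
  moreover have "is_solution (e ` U) P (\<lambda>n. cf (d n))"
    unfolding is_solution_def
  proof (intro ballI allI)
    fix n w assume "n \<in> e ` U"
    then obtain g where g: "n = e g" "g \<in> U" by blast
    have inj: "inj_on en (M g)" by (rule inj_on_inverseI[where g = de]) (use de M(2)[OF g(2)] in blast)
    have "(\<Sum>u\<in>supp (P n). P n u * subst_word (\<lambda>n. cf (d n)) u w)
        = (\<Sum>u\<in>en ` M g. P n u * cf (ev d u) w)"
      unfolding subst_word_ev using sup[OF g(2)] M(1)[OF g(2)] g(1)
      by (intro sum.mono_neutral_left) (auto simp: supp_def)
    also have "\<dots> = (\<Sum>u\<in>M g. c g u * cf (ev (\<lambda>x. x) u) w)"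
      unfolding sum.reindex[OF inj] using M(2)[OF g(2)] g
      by (intro sum.cong) (auto simp: P_def d de ev subset_iff)
    also have "\<dots> = cf (\<Sum>u\<in>M g. sc (c g u) * ev (\<lambda>x. x) u) w" by simp
    also have "(\<Sum>u\<in>M g. sc (c g u) * ev (\<lambda>x. x) u) = g" by (rule eq[OF g(2), symmetric])
    also have "g = d n" using d g by simp
    finally show "cf (d n) w = (\<Sum>u\<in>supp (P n). P n u * subst_word (\<lambda>n. cf (d n)) u w)" by simp
  qed
  ultimately show ?thesis unfolding algebraic_def quasiregular_def
    by (intro exI[of _ "e ` U"] exI[of _ P] exI[of _ "\<lambda>n. cf (d n)"] exI[of _ "e S"])
       (use U qr d in auto)
qed

section \<open>Removal of constant terms\<close>

definition proper_part :: "('a, 'k::comm_semiring_1) ser \<Rightarrow> ('a, 'k) ser" where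
  "proper_part f = Ser (\<lambda>w. if w = [] then 0 else cf f w)"

lemma cf_proper_part: "cf (proper_part f) w = (if w = [] then 0 else cf f w)"
  by (simp add: proper_part_def)

lemma split_proper_part: "f = sc (cf f []) + proper_part f"
  by (rule ser_eqI) (simp add: cf_proper_part cf_sc)

lemma proper_part_id: "cf f [] = 0 \<Longrightarrow> proper_part f = f"
  by (rule ser_eqI) (simp add: cf_proper_part)

text \<open>Each series is split into constant and proper part. Multiplying out a g b h leaves
  monomials that start with a letter and mention proper parts only, hence a proper system for the
  proper parts.\<close>

lemma tree_series_imp_algebraic:
  assumes "tree_series S" "cf S [] = 0"
  shows "algebraic (cf S)"
proof -
  obtain U where U: "finite U" "S \<in> U" "U \<subseteq> lspan (tgen U)" using assms unfolding tree_series_def by blast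
  let ?L = "lspan (ev (\<lambda>x. x) ` pmon (proper_part ` U))"
  have L: "ev (\<lambda>x. x) u \<in> ?L" if "u \<in> pmon (proper_part ` U)" for u
    using that by (intro lspan_base imageI)
  \<comment> \<open>The six monomial shapes that remain when the constants of \<open>a g\<close> and
    \<open>a g b h\<close> are multiplied out.\<close>
  have m1: "lt a \<in> ?L" for a
    using L[of "[Inl a]"] by (simp add: pmon_def)
  have m2: "lt a * lt b \<in> ?L" for a b
    using L[of "[Inl a, Inl b]"] by (simp add: pmon_def)
  have m3: "lt a * proper_part g \<in> ?L" if "g \<in> U" for a g
    using L[of "[Inl a, Inr (proper_part g)]"] that by (simp add: pmon_def)
  have m4: "lt a * (proper_part g * lt b) \<in> ?L" if "g \<in> U" for a b g
    using L[of "[Inl a, Inr (proper_part g), Inl b]"] that by (simp add: pmon_def)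
  have m5: "lt a * (lt b * proper_part h) \<in> ?L" if "h \<in> U" for a b h
    using L[of "[Inl a, Inl b, Inr (proper_part h)]"] that by (simp add: pmon_def)
  have m6: "lt a * (proper_part g * (lt b * proper_part h)) \<in> ?L" if "g \<in> U" "h \<in> U" for a b g h
    using L[of "[Inl a, Inr (proper_part g), Inl b, Inr (proper_part h)]"] that by (simp add: pmon_def)
  have "proper_part g \<in> ?L" if "g \<in> U" for g
  proof (rule lspan_lin[where T = proper_part and B = "tgen U"])
    show "g \<in> lspan (tgen U)" using that U by blast
    fix b assume "b \<in> tgen U"
    then consider "b = 1" | a g where "g \<in> U" "b = lt a * g"
      | a g c h where "g \<in> U" "h \<in> U" "b = lt a * (g * (lt c * h))" unfolding tgen_def by blast
    then show "proper_part b \<in> ?L"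
    proof cases
      case 1
      have "proper_part (1 :: ('a, 'b) ser) = 0" by (rule ser_eqI) (simp add: cf_proper_part cf_one)
      with 1 show ?thesis by (simp add: lspan.zero)
    next
      case 2
      have "proper_part b = lt a * (sc (cf g []) + proper_part g)" 
        unfolding split_proper_part[symmetric] 2(2) by (rule proper_part_id) simp
      also have "\<dots> = sc (cf g []) * lt a + lt a * proper_part g" by (simp add: distrib_left sc_commute)
      finally show ?thesis using 2 by (auto intro!: lspan_plus lspan_sc m1 m3)
    next
      case 3
      have "proper_part b = lt a * ((sc (cf g []) + proper_part g) * (lt c * (sc (cf h []) + proper_part h)))" 
        unfolding split_proper_part[symmetric] 3(3) by (rule proper_part_id) simp
      also have "\<dots> = sc (cf g [] * cf h []) * (lt a * lt c) + sc (cf g []) * (lt a * (lt c * proper_part h))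
          + (sc (cf h []) * (lt a * (proper_part g * lt c)) + lt a * (proper_part g * (lt c * proper_part h)))"
        by (simp add: distrib_left distrib_right mult.assoc add_ac sc_mult sc_commute[of "lt _"] sc_commute[of "proper_part _"]
            sc_commute_left[of "lt _"] sc_commute_left[of "proper_part _"])
      finally show ?thesis using 3 by (auto intro!: lspan_plus lspan_sc m2 m4 m5 m6)
    qed
  qed (auto intro!: ser_eqI simp: cf_proper_part)
  then have "algebraic (cf (proper_part S))"
    by (intro algebraicI[of "proper_part ` U"]) (use U in \<open>auto simp: cf_proper_part\<close>)
  then show ?thesis using proper_part_id[OF assms(2)] by simp
qed

subsection \<open>From weak Greibach form to tree form\<close>

definition rquot :: "'a \<Rightarrow> ('a, 'k::comm_semiring_1) ser \<Rightarrow> ('a, 'k) ser" where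
  "rquot b f = Ser (\<lambda>w. cf f (w @ [b]))"

lemma cf_rquot: "cf (rquot b f) w = cf f (w @ [b])"
  by (simp add: rquot_def)

lemma rquot_lin: "rquot b 0 = 0" "rquot b (sc k * f + g) = sc k * rquot b f + rquot b g"
  by (auto intro!: ser_eqI simp: cf_rquot)

lemma rquot_one: "rquot b 1 = 0"
  by (auto intro!: ser_eqI simp: cf_rquot cf_one)

lemma rquot_lt: "rquot b (lt a) = (if a = b then 1 else 0)"
  by (auto intro!: ser_eqI simp: cf_rquot cf_lt cf_one)

text \<open>Mirror image of \<open>cauchy_Cons\<close>: in the second summand the last letter is
  taken from \<open>f\<close>, and \<open>g\<close> contributes its constant.\<close>

lemma rquot_mult: "rquot b (f * g) = f * rquot b g + rquot b f * sc (cf g [])"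
proof (rule ser_eqI)
  fix w
  have "(\<Sum>i = 0..length w. cf f (take i (w @ [b])) * cf g (drop i (w @ [b])))
      = (\<Sum>i = 0..length w. cf f (take i w) * cf g (drop i w @ [b]))"
    by (intro sum.cong) auto
  then show "cf (rquot b (f * g)) w = cf (f * rquot b g + rquot b f * sc (cf g [])) w"
    by (simp add: cf_rquot cf_mult[of f] cauchy_def)
qed

lemma split_rquot:
  fixes f :: "('a::finite, 'k::comm_semiring_1) ser"
  shows "f = sc (cf f []) + (\<Sum>b\<in>UNIV. rquot b f * lt b)"
proof (rule ser_eqI)
  fix w show "cf f w = cf (sc (cf f []) + (\<Sum>b\<in>UNIV. rquot b f * lt b)) w"
  proof (cases w rule: rev_cases)
    case Nil
    then show ?thesis by (simp add: cf_sc cf_lt)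
  next
    case (snoc v c)
    have "cf (rquot b f * lt b) w = (if b = c then cf f w else 0)" for b
    proof -
      have "cf (rquot b f * lt b) w = cf (rquot c (rquot b f * lt b)) v" by (simp add: snoc cf_rquot[of c])
      also have "\<dots> = (if b = c then cf f w else 0)"
        by (simp add: rquot_mult rquot_lt cf_lt cf_rquot snoc)
      finally show ?thesis .
    qed
    then show ?thesis by (simp add: cf_sc snoc)
  qed
qed

definition wgen :: "('a, 'k::comm_semiring_1) ser set \<Rightarrow> ('a, 'k) ser set" where
  "wgen F = insert 1 ({lt a * g |a g. g \<in> F} \<union> {lt a * (g * h) |a g h. g \<in> F \<and> h \<in> F})"

lemma wgen_mono: "F \<subseteq> G \<Longrightarrow> wgen F \<subseteq> wgen G"
  unfolding wgen_def by blast

text \<open>In a g h no letter between \<open>g\<close> and \<open>h\<close> can serve as a return.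
  Splitting \<open>g\<close> into its constant and its quotients followed by letters exposes one:
  the last letter of \<open>g\<close>. A further quotient on \<open>h\<close> then leaves only
  quotients of \<open>F\<close>, so these form a tree family.\<close>

lemma weak_greibach_tree_series:
  fixes F :: "('a::finite, 'k::comm_semiring_1) ser set"
  assumes F: "finite F" "S \<in> F" "F \<subseteq> lspan (wgen F)"
  shows "tree_series S"
proof -
  define U where "U = (\<lambda>(b, g). rquot b g) ` (UNIV \<times> F)"
  have U: "rquot b g \<in> U" if "g \<in> F" for b g using that by (auto simp: U_def)
  have rquot: "rquot b g \<in> lspan (tgen U)" if "g \<in> F" for b g
  proof (rule lspan_lin[where T = "rquot b" and B = "wgen F"])
    show "g \<in> lspan (wgen F)" using that F by blast
    fix x assume "x \<in> wgen F"
    then consider "x = 1" | a g where "g \<in> F" "x = lt a * g"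
      | a g h where "g \<in> F" "h \<in> F" "x = lt a * (g * h)" unfolding wgen_def by blast
    then show "rquot b x \<in> lspan (tgen U)"
    proof cases
      case 1 then show ?thesis by (simp add: rquot_one lspan.zero)
    next
      case 2
      have "rquot b x = lt a * rquot b g + sc (if a = b then cf g [] else 0)"
        by (simp add: 2 rquot_mult rquot_lt)
      then show ?thesis using 2 by (auto intro!: lspan_plus tgen_I tgen_sc U)
    next
      case 3
      have "lt a * (g * rquot b h) = lt a * ((sc (cf g []) + (\<Sum>c\<in>UNIV. rquot c g * lt c)) * rquot b h)"
        by (simp only: split_rquot[symmetric])
      also have "\<dots> = sc (cf g []) * (lt a * rquot b h) + (\<Sum>c\<in>UNIV. lt a * (rquot c g * (lt c * rquot b h)))"
        by (simp add: distrib_left distrib_right sum_distrib_left sum_distrib_right mult.assoc sc_commute_left)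
      finally have "lt a * (g * rquot b h) \<in> lspan (tgen U)"
        using tgen_C[OF U[OF 3(1)] U[OF 3(2)]] tgen_I[OF U[OF 3(2)]]
        by (simp add: lspan_plus lspan_sum lspan_sc)
      moreover have "rquot b x = lt a * (g * rquot b h) + sc (cf h []) * (lt a * rquot b g)
          + sc (if a = b then cf g [] * cf h [] else 0)"
        by (simp add: 3 rquot_mult rquot_lt distrib_left sc_commute sc_commute_left)
      ultimately show ?thesis using 3 by (auto intro!: lspan_plus lspan_sc tgen_I tgen_sc U)
    qed
  qed (rule rquot_lin)+
  \<comment> \<open>\<open>S\<close> is recovered from its quotients by appending letters, so the
    products \<open>u * lt b\<close> are adjoined; 1 is what follows a lone letter.\<close>
  define W where "W = U \<union> (\<lambda>(u, b). u * lt b) ` (U \<times> UNIV) \<union> {1, S}"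
  have UW: "lspan (tgen U) \<subseteq> lspan (tgen W)"
    using lspan_mono tgen_mono[of U W] unfolding W_def by blast
  have W: "u * lt b \<in> W" if "u \<in> U" for u b using that by (auto simp: W_def)
  have r: "u * lt b \<in> lspan (tgen W)" if "u \<in> lspan (tgen U)" for u b
    using that
  proof (rule lspan_right)
    fix x assume "x \<in> tgen U"
    then consider "x = 1" | a g where "g \<in> U" "x = lt a * g"
      | a g c h where "g \<in> U" "h \<in> U" "x = lt a * (g * (lt c * h))" unfolding tgen_def by blast
    then show "x * lt b \<in> lspan (tgen W)"
    proof cases
      case 1
      have "1 \<in> W" by (simp add: W_def)
      from tgen_I[OF this, of b] 1 show ?thesis by simp
    next
      case 2
      then show ?thesis using tgen_I[OF W[OF 2(1)]] by (simp add: mult.assoc)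
    next
      case 3
      have "g \<in> W" using 3 by (simp add: W_def)
      then show ?thesis using 3 tgen_C[OF _ W[OF 3(2)]] by (simp add: mult.assoc)
    qed
  qed
  have "S = sc (cf S []) + (\<Sum>b\<in>UNIV. rquot b S * lt b)" by (rule split_rquot)
  also have "\<dots> \<in> lspan (tgen W)"
    by (intro lspan_plus lspan_sum tgen_sc r rquot F)
  finally have "S \<in> lspan (tgen W)" .
  then have "W \<subseteq> lspan (tgen W)"
    using UW rquot r by (auto simp: W_def U_def tgen_1)
  moreover have "finite W" unfolding W_def U_def using F(1) by auto
  ultimately show ?thesis unfolding tree_series_def by (intro exI[of _ W]) (simp add: W_def)
qed

subsection \<open>Left corners\<close>

lemma algebraicE:
  fixes S :: "'a list \<Rightarrow> 'k::comm_semiring_1"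
  assumes "algebraic S"
  obtains V P X and \<sigma> :: "nat \<Rightarrow> ('a, 'k) ser"
  where "finite V" "X \<in> V" "S = cf (\<sigma> X)"
    and "\<And>Y. Y \<in> V \<Longrightarrow> finite (supp (P Y))"
    and "\<And>Y u Z. Y \<in> V \<Longrightarrow> u \<in> supp (P Y) \<Longrightarrow> Inr Z \<in> set u \<Longrightarrow> Z \<in> V"
    and "\<And>Y u. Y \<in> V \<Longrightarrow> u \<in> supp (P Y) \<Longrightarrow> u \<noteq> [] \<and> (\<forall>Z. u \<noteq> [Inr Z])"
    and "\<And>Y. Y \<in> V \<Longrightarrow> cf (\<sigma> Y) [] = 0"
    and "\<And>Y. Y \<in> V \<Longrightarrow> \<sigma> Y = (\<Sum>u\<in>supp (P Y). sc (P Y u) * ev \<sigma> u)"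
proof -
  from assms obtain V P Sol X where p: "proper_system V P" and s: "is_solution V P Sol"
    and q: "\<forall>Y\<in>V. quasiregular (Sol Y)" and X: "X \<in> V" "S = Sol X"
    unfolding algebraic_def by blast
  define \<sigma> where "\<sigma> Y = Ser (Sol Y)" for Y
  have Sol: "Sol = (\<lambda>Y. cf (\<sigma> Y))" by (simp add: \<sigma>_def)
  have 1: "finite V" and 2: "finite (supp (P Y))" if "Y \<in> V" for Y
    using p that by (auto simp: proper_system_def alg_system_def)
  have 3: "Z \<in> V" if "Y \<in> V" "u \<in> supp (P Y)" "Inr Z \<in> set u" for Y u Z
    using p that unfolding proper_system_def alg_system_def by blast
  have 4: "cf (\<sigma> Y) [] = 0" if "Y \<in> V" for Y
    using q that by (simp add: \<sigma>_def quasiregular_def)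
  have "\<sigma> Y = (\<Sum>u\<in>supp (P Y). sc (P Y u) * ev \<sigma> u)" if "Y \<in> V" for Y
    using s that unfolding is_solution_def by (intro ser_eqI) (simp add: Sol subst_word_ev)
  moreover have "u \<noteq> [] \<and> (\<forall>Z. u \<noteq> [Inr Z])" if "Y \<in> V" "u \<in> supp (P Y)" for Y u
  proof -
    \<comment> \<open>Properness speaks of variables in \<open>V\<close> only;
      \<open>alg_system\<close> puts the variable of a supported monomial there.\<close>
    have "Z \<in> V" if "u = [Inr Z]" for Z
      using p that \<open>Y \<in> V\<close> \<open>u \<in> supp (P Y)\<close> unfolding proper_system_def alg_system_def by force
    then show ?thesis using p that unfolding proper_system_def supp_def by auto
  qed
  moreover have "S = cf (\<sigma> X)" by (simp add: X \<sigma>_def)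
  ultimately show ?thesis using 1[OF X(1)] X(1) 2 3 4 by (intro that[of V X \<sigma> P]) blast+
qed

text \<open>With \<open>A\<close> the terms of the system that start with a letter and \<open>N Y Z\<close> what follows a leading \<open>Y\<close>
  in the equation of \<open>Z\<close>, the solution is the row vector with \<open>\<sigma> = A + \<sigma> N\<close>, hence \<open>\<sigma> = A N\<^sup>*\<close>.\<close>

lemma algebraic_imp_tree_series:
  fixes S :: "'a::finite list \<Rightarrow> 'k::comm_semiring_1"
  assumes "algebraic S"
  shows "tree_series (Ser S)"
proof -
  obtain V P X and \<sigma> :: "nat \<Rightarrow> ('a, 'k) ser"
  where V: "finite V" "X \<in> V" "S = cf (\<sigma> X)"
    and fin: "\<And>Y. Y \<in> V \<Longrightarrow> finite (supp (P Y))"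
    and vars: "\<And>Y u Z. Y \<in> V \<Longrightarrow> u \<in> supp (P Y) \<Longrightarrow> Inr Z \<in> set u \<Longrightarrow> Z \<in> V"
    and proper: "\<And>Y u. Y \<in> V \<Longrightarrow> u \<in> supp (P Y) \<Longrightarrow> u \<noteq> [] \<and> (\<forall>Z. u \<noteq> [Inr Z])"
    and qr: "\<And>Y. Y \<in> V \<Longrightarrow> cf (\<sigma> Y) [] = 0"
    and eq: "\<And>Y. Y \<in> V \<Longrightarrow> \<sigma> Y = (\<Sum>u\<in>supp (P Y). sc (P Y u) * ev \<sigma> u)"
    using assms by (rule algebraicE) (rule that; assumption)
  define A where "A Z = (\<Sum>u\<in>supp (P Z). case u of Inl a # v \<Rightarrow> sc (P Z u) * (lt a * ev \<sigma> v) | _ \<Rightarrow> 0)" for Z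
  define N where "N Y Z = (\<Sum>u\<in>supp (P Z). case u of Inr Y' # v \<Rightarrow>
      (if Y' = Y then sc (P Z u) * ev \<sigma> v else 0) | _ \<Rightarrow> 0)" for Y Z
  have decomp: "\<sigma> Z = A Z + (\<Sum>Y\<in>V. \<sigma> Y * N Y Z)" if Z: "Z \<in> V" for Z
  proof -
    have "(\<Sum>Y\<in>V. \<sigma> Y * N Y Z) = (\<Sum>u\<in>supp (P Z). \<Sum>Y\<in>V. case u of Inr Y' # v \<Rightarrow>
        (if Y' = Y then sc (P Z u) * ev \<sigma> u else 0) | _ \<Rightarrow> 0)"
      unfolding N_def sum_distrib_left
      by (subst sum.swap) (intro sum.cong refl, auto simp: sc_commute_left split: list.splits sum.splits)
    also have "\<dots> = (\<Sum>u\<in>supp (P Z). case u of Inr Y' # v \<Rightarrow> sc (P Z u) * ev \<sigma> u | _ \<Rightarrow> 0)"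
      using V(1) vars[OF Z] by (intro sum.cong refl) (auto split: list.splits sum.splits)
    finally show ?thesis unfolding A_def
      by (subst eq[OF Z], simp add: sum.distrib[symmetric], intro sum.cong refl)
         (use proper[OF Z] in \<open>auto split: list.splits sum.splits\<close>)
  qed
  have N: "cf (N Y Z) [] = 0" if "Y \<in> V" "Z \<in> V" for Y Z
  proof -
    have "cf (case u of Inr Y' # v \<Rightarrow> (if Y' = Y then sc (P Z u) * ev \<sigma> v else 0) | _ \<Rightarrow> 0) [] = 0"
      if u: "u \<in> supp (P Z)" for u
    proof (cases "\<exists>v. u = Inr Y # v")
      case True
      then obtain v where v: "u = Inr Y # v" by blast
      have "cf (ev \<sigma> v) [] = 0"
        using v u proper[OF \<open>Z \<in> V\<close> u] vars[OF \<open>Z \<in> V\<close> u] by (intro ev_quasiregular qr) auto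
      then show ?thesis using v by simp
    qed (auto split: list.splits sum.splits)
    then show ?thesis unfolding N_def cf_sum by (intro sum.neutral) blast
  qed
  obtain L where L1: "\<And>i j. i \<in> V \<Longrightarrow> j \<in> V \<Longrightarrow> L i j = idm i j + (\<Sum>k\<in>V. N i k * L k j)"
    and L2: "\<And>i j. i \<in> V \<Longrightarrow> j \<in> V \<Longrightarrow> L i j = idm i j + (\<Sum>k\<in>V. L i k * N k j)"
    by (rule star_exists[of V N, OF V(1) N]) (assumption | rule that)+
  have \<sigma>L: "\<sigma> Z = (\<Sum>W\<in>V. A W * L W Z)" if Z: "Z \<in> V" for Z
    using N decomp _ Z
  proof (rule linear_unique_right[where y = "\<lambda>Z. \<Sum>W\<in>V. A W * L W Z"])
    fix Z assume Z: "Z \<in> V"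
    have "(\<Sum>W\<in>V. A W * L W Z) = (\<Sum>W\<in>V. A W * (idm W Z + (\<Sum>k\<in>V. L W k * N k Z)))"
      by (intro sum.cong refl) (subst L2, use Z in auto)
    also have "\<dots> = A Z + (\<Sum>W\<in>V. \<Sum>k\<in>V. A W * L W k * N k Z)"
      using V(1) Z by (simp add: distrib_left sum.distrib sum_distrib_left mult.assoc
          if_distrib[of "\<lambda>x. _ * x"] cong: if_cong)
    also have "(\<Sum>W\<in>V. \<Sum>k\<in>V. A W * L W k * N k Z) = (\<Sum>k\<in>V. (\<Sum>W\<in>V. A W * L W k) * N k Z)"
      by (subst sum.swap) (simp add: sum_distrib_right)
    finally show "(\<Sum>W\<in>V. A W * L W Z) = A Z + (\<Sum>k\<in>V. (\<Sum>W\<in>V. A W * L W k) * N k Z)" .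
  qed
  \<comment> \<open>Suffixes of right-hand sides: what remains of a rule after part of it has been
    read.\<close>
  define Sf where "Sf = insert [] (\<Union>Z\<in>V. \<Union>u\<in>supp (P Z). (\<lambda>n. drop n u) ` {..length u})"
  have Sf1: "v \<in> Sf" if "s # v \<in> Sf" for s v
  proof -
    from that obtain Z u n where "Z \<in> V" "u \<in> supp (P Z)" "n \<le> length u" "s # v = drop n u"
      by (auto simp: Sf_def)
    moreover from this have "v = drop (Suc n) u" "n < length u"
      by (metis drop_Suc list.sel(3) tl_drop, metis drop_all le_neq_implies_less list.distinct(1) order_refl)
    ultimately show ?thesis unfolding Sf_def
      by (intro insertI2 UN_I[of Z] UN_I[of u] image_eqI[of _ _ "Suc n"]) auto
  qed
  have Sf0: "u \<in> Sf" if "Z \<in> V" "u \<in> supp (P Z)" for Z u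
    using that unfolding Sf_def by (intro insertI2 UN_I[of Z] UN_I[of u] image_eqI[of _ _ 0]) auto
  have Sfv: "Z \<in> V" if "u \<in> Sf" "Inr Z \<in> set u" for Z u
    using that vars by (auto simp: Sf_def dest: in_set_dropD)
  \<comment> \<open>The rest of a rule, followed by the chains of left corners leading from
    \<open>Z\<close> up to \<open>Y\<close>. Both kinds of data are finite.\<close>
  define F where "F = (\<lambda>(u, Z, Y). ev \<sigma> u * L Z Y) ` (Sf \<times> V \<times> V)"
  have F: "ev \<sigma> u * L Z Y \<in> F" if "u \<in> Sf" "Z \<in> V" "Y \<in> V" for u Z Y
    using that unfolding F_def by (intro image_eqI[of _ _ "(u, Z, Y)"]) auto
  have head: "\<sigma> Z \<in> lspan {lt a * g |a g. g \<in> F}" if Z: "Z \<in> V" for Z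
  proof -
    have "A W * L W Z \<in> lspan {lt a * g |a g. g \<in> F}" if W: "W \<in> V" for W
      unfolding A_def sum_distrib_right
    proof (rule lspan_sum)
      fix u assume u: "u \<in> supp (P W)"
      show "(case u of Inl a # v \<Rightarrow> sc (P W u) * (lt a * ev \<sigma> v) | _ \<Rightarrow> 0) * L W Z
          \<in> lspan {lt a * g |a g. g \<in> F}"
      proof (cases "\<exists>a v. u = Inl a # v")
        case True
        then obtain a v where v: "u = Inl a # v" by blast
        have "ev \<sigma> v * L W Z \<in> F" using F Sf1 Sf0[OF W u] v W Z by blast
        then show ?thesis unfolding v by (auto simp: mult.assoc intro!: lspan_scaled)
      qed (auto intro: lspan.zero split: list.splits sum.splits)
    qed
    then show ?thesis unfolding \<sigma>L[OF Z] by (rule lspan_sum)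
  qed
  \<comment> \<open>A leading variable is replaced by its expansion from \<open>head\<close>, which
    yields a leading letter and two factors in \<open>F\<close>.\<close>
  have nonempty: "ev \<sigma> u * L Z Y \<in> lspan (wgen F)" if u: "u \<in> Sf" "u \<noteq> []" and ZY: "Z \<in> V" "Y \<in> V" for u Z Y
  proof (cases u)
    case (Cons s v)
    have g: "ev \<sigma> v * L Z Y \<in> F" using F Sf1 u Cons ZY by blast
    show ?thesis
    proof (cases s)
      case (Inl b)
      then show ?thesis using g unfolding Cons by (auto simp: mult.assoc wgen_def intro!: lspan_base)
    next
      case (Inr W)
      then have "W \<in> V" using Sfv u Cons by auto
      then have "\<sigma> W * (ev \<sigma> v * L Z Y) \<in> lspan (wgen F)"
        by (rule lspan_right[OF head]) (use g in \<open>auto simp: mult.assoc wgen_def intro!: lspan_base\<close>)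
      then show ?thesis using Inr Cons by (simp add: mult.assoc)
    qed
  qed (use u in simp)
  \<comment> \<open>The star is unfolded once. By properness the rest of a rule inside an entry of
    \<open>N\<close> is nonempty, so the previous case applies.\<close>
  have empty: "L Z Y \<in> lspan (wgen F)" if ZY: "Z \<in> V" "Y \<in> V" for Z Y
  proof -
    have "N Z k * L k Y \<in> lspan (wgen F)" if k: "k \<in> V" for k
      unfolding N_def sum_distrib_right
    proof (rule lspan_sum)
      fix u assume u: "u \<in> supp (P k)"
      show "(case u of Inr Y' # v \<Rightarrow> (if Y' = Z then sc (P k u) * ev \<sigma> v else 0) | _ \<Rightarrow> 0) * L k Y
          \<in> lspan (wgen F)"
      proof (cases "\<exists>v. u = Inr Z # v")
        case True
        then obtain v where v: "u = Inr Z # v" by blast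
        have "ev \<sigma> v * L k Y \<in> lspan (wgen F)"
          using proper[OF k u] v by (intro nonempty Sf1[of "Inr Z" v] k ZY) (use Sf0[OF k u] in auto)
        then show ?thesis unfolding v by (auto simp: mult.assoc intro!: lspan_sc)
      qed (auto intro: lspan.zero split: list.splits sum.splits)
    qed
    then show ?thesis unfolding L1[OF ZY]
      by (intro lspan_plus lspan_sum) (auto simp: wgen_def intro: lspan_base lspan.zero)
  qed
  let ?F = "insert (\<sigma> X) F"
  have mono: "lspan (wgen F) \<subseteq> lspan (wgen ?F)"
    by (rule subsetI, erule lspan_mono) (intro wgen_mono subset_insertI)
  have "F \<subseteq> lspan (wgen F)"
  proof
    fix g assume "g \<in> F"
    then obtain u Z Y where "u \<in> Sf" "Z \<in> V" "Y \<in> V" "g = ev \<sigma> u * L Z Y" unfolding F_def by auto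
    then show "g \<in> lspan (wgen F)" using nonempty empty by (cases "u = []") auto
  qed
  moreover have "\<sigma> X \<in> lspan (wgen F)"
    using head[OF V(2)] by (rule lspan_mono) (auto simp: wgen_def)
  ultimately have "?F \<subseteq> lspan (wgen ?F)" using mono by blast
  moreover have "finite ?F"
    unfolding F_def Sf_def using V(1) fin by (intro finite.insertI finite_imageI finite_cartesian_product finite_UN_I) auto
  ultimately have "tree_series (\<sigma> X)" by (intro weak_greibach_tree_series[of ?F]) auto
  then show ?thesis by (simp add: V(3) cf_inverse)
qed

lemma algebraic_iff_tree_series:
  fixes S :: "'a::finite list \<Rightarrow> 'k::comm_semiring_1"
  shows "algebraic S \<longleftrightarrow> tree_series (Ser S) \<and> S [] = 0"
proof
  assume "algebraic S"
  then show "tree_series (Ser S) \<and> S [] = 0"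
    using algebraic_imp_tree_series[of S] by (auto simp: algebraic_def quasiregular_def)
next
  assume "tree_series (Ser S) \<and> S [] = 0"
  then show "algebraic S" using tree_series_imp_algebraic[of "Ser S"] by simp
qed

section \<open>Weighted nested word automata\<close>

context comm_monoid_set
begin

lemma split_Itl: "F g {k<..k + Suc m} = g (Suc k) \<^bold>* F g {Suc k<..Suc k + m}"
proof -
  have "{k<..k + Suc m} = insert (Suc k) {Suc k<..Suc k + m}" by auto
  then show ?thesis by simp
qed

lemma split_Arc:
  "F g {k<..k + Suc (m + Suc n)} = 
     g (Suc k) \<^bold>* F g {Suc k<..Suc k + m} \<^bold>* (g (k + m + 2) \<^bold>* F g {k + m + 2<..k + m + 2 + n})"
proof -
  have "{Suc k<..Suc k + (m + Suc n)} = {Suc k<..Suc k + m} \<union> {Suc k + m<..Suc k + m + Suc n}" by auto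
  then have "F g {Suc k<..Suc k + (m + Suc n)} = F g {Suc k<..Suc k + m} \<^bold>* F g {Suc k + m<..Suc k + m + Suc n}"
    by (simp add: union_disjoint)
  then show ?thesis unfolding split_Itl[of g k] split_Itl[of g "Suc k + m" n] by (simp add: assoc)
qed

end

text \<open>Entry (p, q) collects the runs on the factor from \<open>p\<close> to \<open>q\<close>.
  At an arc, \<open>r\<close> is the state after the call, \<open>x\<close> and \<open>u\<close> are
  the states before and after the return, and the return also reads \<open>p\<close>, the state
  before the call.\<close>

fun run_matrix :: "('a, 'k::comm_semiring_1) wnwa \<Rightarrow> 'a nt \<Rightarrow> nat \<Rightarrow> nat \<Rightarrow> 'k" where
  "run_matrix A Emp p q = (if p = q then 1 else 0)"
| "run_matrix A (Itl a t) p q = (\<Sum>r\<in>states A. dint A p a r * run_matrix A t r q)"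
| "run_matrix A (Arc a t b s) p q = (\<Sum>r\<in>states A. \<Sum>x\<in>states A. \<Sum>u\<in>states A.
     dcall A p a r * run_matrix A t r x * (dret A x p b u * run_matrix A s u q))"

text \<open>The weight of the run \<open>R\<close> on the factor \<open>t\<close> at offset \<open>k\<close>.\<close>

fun run_weight :: "('a, 'k::comm_semiring_1) wnwa \<Rightarrow> (nat \<Rightarrow> nat) \<Rightarrow> nat \<Rightarrow> 'a nt \<Rightarrow> 'k" where
  "run_weight A R k Emp = 1"
| "run_weight A R k (Itl a t) = dint A (R k) a (R (Suc k)) * run_weight A R (Suc k) t"
| "run_weight A R k (Arc a t b s) = dcall A (R k) a (R (Suc k)) * run_weight A R (Suc k) t *
     (dret A (R (k + len t + 1)) (R k) b (R (k + len t + 2)) * run_weight A R (k + len t + 2) s)"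

lemma run_weight_cong:
  "(\<And>i. i \<le> len t \<Longrightarrow> R (k + i) = R' (k' + i)) \<Longrightarrow> run_weight A R k t = run_weight A R' k' t"
proof (induction t arbitrary: k k')
  case (Itl a t)
  have "run_weight A R (Suc k) t = run_weight A R' (Suc k') t"
    using Itl.prems[of "Suc _"] by (intro Itl.IH) simp
  then show ?case using Itl.prems[of 0] Itl.prems[of 1] by simp
next
  case (Arc a t b s)
  have "run_weight A R (Suc k) t = run_weight A R' (Suc k') t"
    using Arc.prems[of "Suc _"] by (intro Arc.IH) simp
  moreover have "run_weight A R (k + len t + 2) s = run_weight A R' (k' + len t + 2) s"
    using Arc.prems[of "len t + 2 + _"] by (intro Arc.IH) (simp add: add.assoc)
  ultimately show ?case
    using Arc.prems[of 0] Arc.prems[of 1] Arc.prems[of "len t + 1"] Arc.prems[of "len t + 2"]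
    by (simp add: add.assoc)
qed simp

lemma prod_pos_weight:
  assumes N: "\<nu> \<in> Nest n" and "emb w \<nu> k t"
  shows "(\<Prod>j\<in>{k<..k + len t}. pos_weight A (w, \<nu>) r j) = run_weight A (nth r) k t"
  using assms(2)
proof (induction t arbitrary: k)
  case (Itl a t)
  then have "(Suc k, j) \<notin> \<nu>" "(j, Suc k) \<notin> \<nu>" for j by (auto intro: FieldI1 FieldI2)
  then have "pos_weight A (w, \<nu>) r (Suc k) = dint A (r ! k) a (r ! Suc k)"
    using Itl.prems by (simp add: pos_weight_def)
  moreover have "(\<Prod>j\<in>{Suc k<..Suc k + len t}. pos_weight A (w, \<nu>) r j) = run_weight A (nth r) (Suc k) t"
    using Itl.IH[of "Suc k"] Itl.prems by simp
  ultimately show ?case using prod.split_Itl[of "pos_weight A (w, \<nu>) r" k "len t"] by simp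
next
  case (Arc a t b s)
  let ?r = "k + len t + 2"
  have arc: "(Suc k, ?r) \<in> \<nu>" using Arc.prems by simp
  then have "pos_weight A (w, \<nu>) r (Suc k) = dcall A (r ! k) a (r ! Suc k)"
    using Arc.prems by (auto simp: pos_weight_def)
  moreover have "pos_weight A (w, \<nu>) r ?r = dret A (r ! (k + len t + 1)) (r ! k) b (r ! ?r)"
  proof -
    have "(?r, j) \<notin> \<nu>" for j using Nest_call_not_return[OF N arc] by blast
    moreover have "(THE i. (i, ?r) \<in> \<nu>) = Suc k" using arc Nest_injective[OF N _ arc] by blast
    ultimately show ?thesis using arc Arc.prems by (auto simp: pos_weight_def)
  qed
  moreover have "(\<Prod>j\<in>{Suc k<..Suc k + len t}. pos_weight A (w, \<nu>) r j) = run_weight A (nth r) (Suc k) t"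
    using Arc.IH(1)[of "Suc k"] Arc.prems by simp
  moreover have "(\<Prod>j\<in>{?r<..?r + len s}. pos_weight A (w, \<nu>) r j) = run_weight A (nth r) ?r s"
    using Arc.IH(2)[of ?r] Arc.prems by simp
  ultimately show ?case using prod.split_Arc[of "pos_weight A (w, \<nu>) r" k "len t" "len s"] by simp
qed simp

definition paths :: "'s set \<Rightarrow> nat \<Rightarrow> 's list set" where
  "paths Q n = {\<rho>. length \<rho> = n \<and> set \<rho> \<subseteq> Q}"

lemma sum_paths_0: "sum f (paths Q 0) = f []"
proof -
  have "paths Q 0 = {[]}" by (auto simp: paths_def)
  then show ?thesis by simp
qed

lemma sum_paths_Suc:
  assumes "finite Q"
  shows "sum f (paths Q (Suc n)) = (\<Sum>p\<in>Q. \<Sum>\<rho>\<in>paths Q n. f (p # \<rho>))"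
proof -
  have "paths Q (Suc n) = (\<lambda>(p, \<rho>). p # \<rho>) ` (Q \<times> paths Q n)"
    by (auto simp: paths_def length_Suc_conv image_iff)
  then have "sum f (paths Q (Suc n)) = (\<Sum>(p, \<rho>)\<in>Q \<times> paths Q n. f (p # \<rho>))"
    by (simp only:) (subst sum.reindex, auto simp: inj_on_def case_prod_unfold)
  then show ?thesis by (simp add: sum.cartesian_product)
qed

lemma sum_paths_add:
  assumes "finite Q"
  shows "sum f (paths Q (m + n)) = (\<Sum>\<rho>\<in>paths Q m. \<Sum>\<rho>'\<in>paths Q n. f (\<rho> @ \<rho>'))"
  by (induction m arbitrary: f) (simp_all add: sum_paths_0 sum_paths_Suc[OF assms])

text \<open>The arbitrary final weight \<open>G\<close> carries the induction: for the inside of an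
  arc, \<open>G\<close> becomes the whole continuation, consisting of the return and the run on the
  rest.\<close>

lemma sum_runs_run_matrix:
  fixes A :: "('a, 'k::comm_semiring_1) wnwa"
  assumes Q: "finite (states A)" and p: "p \<in> states A"
  shows "(\<Sum>\<rho>\<in>paths (states A) (len t). run_weight A (nth (p # \<rho>)) 0 t * G (last (p # \<rho>)))
    = (\<Sum>q\<in>states A. run_matrix A t p q * G q)"
  using p
proof (induction t arbitrary: p G)
  case Emp
  have "(\<Sum>q\<in>states A. (if p = q then 1 else 0) * G q) = (\<Sum>q\<in>states A. if p = q then G q else 0)"
    by (intro sum.cong) auto
  then show ?case using Q Emp by (simp add: sum_paths_0)
next
  case (Itl a t)
  have "run_weight A (nth (p # r # \<rho>)) (Suc 0) t = run_weight A (nth (r # \<rho>)) 0 t" for r \<rho>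
    by (rule run_weight_cong) simp
  then have "(\<Sum>\<rho>\<in>paths (states A) (len (Itl a t)). run_weight A (nth (p # \<rho>)) 0 (Itl a t) * G (last (p # \<rho>)))
    = (\<Sum>r\<in>states A. dint A p a r * (\<Sum>\<rho>\<in>paths (states A) (len t). run_weight A (nth (r # \<rho>)) 0 t * G (last (r # \<rho>))))"
    by (simp add: sum_paths_Suc[OF Q] sum_distrib_left mult.assoc)
  also have "\<dots> = (\<Sum>r\<in>states A. dint A p a r * (\<Sum>q\<in>states A. run_matrix A t r q * G q))"
    by (intro sum.cong refl arg_cong2[of _ _ _ _ times] Itl.IH)
  also have "\<dots> = (\<Sum>q\<in>states A. run_matrix A (Itl a t) p q * G q)"
    by (simp add: sum_distrib_left sum_distrib_right mult.assoc) (rule sum.swap)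
  finally show ?case .
next
  case (Arc a t b s)
  let ?Q = "states A"
  let ?K = "\<lambda>x u. dret A x p b u * (\<Sum>q\<in>?Q. run_matrix A s u q * G q)"
  have run_weight: "run_weight A (nth (p # r # \<rho> @ u # \<rho>')) 0 (Arc a t b s) =
      dcall A p a r * run_weight A (nth (r # \<rho>)) 0 t * (dret A (last (r # \<rho>)) p b u * run_weight A (nth (u # \<rho>')) 0 s)"
    if "length \<rho> = len t" for r \<rho> u \<rho>'
  proof -
    have "run_weight A (nth (p # r # \<rho> @ u # \<rho>')) (Suc 0) t = run_weight A (nth (r # \<rho>)) 0 t"
      by (rule run_weight_cong) (use that in \<open>auto simp: nth_Cons' nth_append\<close>)
    moreover have "run_weight A (nth (p # r # \<rho> @ u # \<rho>')) (len t + 2) s = run_weight A (nth (u # \<rho>')) 0 s"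
      by (rule run_weight_cong) (use that in \<open>simp add: nth_append\<close>)
    moreover have "(p # r # \<rho> @ u # \<rho>') ! (len t + 1) = last (r # \<rho>)"
      using that by (auto simp: nth_append last_conv_nth nth_Cons')
    ultimately show ?thesis using that by (simp add: nth_append)
  qed
  have "(\<Sum>\<rho>\<in>paths ?Q (len (Arc a t b s)). run_weight A (nth (p # \<rho>)) 0 (Arc a t b s) * G (last (p # \<rho>)))
    = (\<Sum>r\<in>?Q. \<Sum>\<rho>\<in>paths ?Q (len t). \<Sum>u\<in>?Q. \<Sum>\<rho>'\<in>paths ?Q (len s).
        run_weight A (nth (p # r # \<rho> @ u # \<rho>')) 0 (Arc a t b s) * G (last (u # \<rho>')))"
  proof -
    have l: "len (Arc a t b s) = Suc (len t + Suc (len s))" by simp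
    show ?thesis
      unfolding l sum_paths_Suc[OF Q, of _ "len t + Suc (len s)"] sum_paths_add[OF Q] sum_paths_Suc[OF Q, of _ "len s"]
      by (intro sum.cong refl) (simp del: run_weight.simps)
  qed
  also have "\<dots> = (\<Sum>r\<in>?Q. \<Sum>\<rho>\<in>paths ?Q (len t). \<Sum>u\<in>?Q. \<Sum>\<rho>'\<in>paths ?Q (len s).
        dcall A p a r * (run_weight A (nth (r # \<rho>)) 0 t * (dret A (last (r # \<rho>)) p b u *
          (run_weight A (nth (u # \<rho>')) 0 s * G (last (u # \<rho>'))))))"
    by (intro sum.cong refl, subst run_weight) (simp_all add: paths_def mult.assoc)
  also have "\<dots> = (\<Sum>r\<in>?Q. dcall A p a r * (\<Sum>\<rho>\<in>paths ?Q (len t). run_weight A (nth (r # \<rho>)) 0 t *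
        (\<Sum>u\<in>?Q. dret A (last (r # \<rho>)) p b u *
          (\<Sum>\<rho>'\<in>paths ?Q (len s). run_weight A (nth (u # \<rho>')) 0 s * G (last (u # \<rho>'))))))"
    by (simp add: sum_distrib_left)
  also have "\<dots> = (\<Sum>r\<in>?Q. dcall A p a r * (\<Sum>\<rho>\<in>paths ?Q (len t). run_weight A (nth (r # \<rho>)) 0 t *
        (\<Sum>u\<in>?Q. ?K (last (r # \<rho>)) u)))"
    by (intro sum.cong refl arg_cong2[of _ _ _ _ times] Arc.IH(2))
  also have "\<dots> = (\<Sum>r\<in>?Q. dcall A p a r * (\<Sum>x\<in>?Q. run_matrix A t r x * (\<Sum>u\<in>?Q. ?K x u)))"
    by (intro sum.cong refl arg_cong2[of _ _ _ _ times] Arc.IH(1))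
  also have "\<dots> = (\<Sum>r\<in>?Q. \<Sum>x\<in>?Q. \<Sum>u\<in>?Q. \<Sum>q\<in>?Q.
       dcall A p a r * run_matrix A t r x * (dret A x p b u * run_matrix A s u q) * G q)"
    by (simp add: sum_distrib_left mult.assoc)
  also have "\<dots> = (\<Sum>q\<in>?Q. \<Sum>r\<in>?Q. \<Sum>x\<in>?Q. \<Sum>u\<in>?Q.
       dcall A p a r * run_matrix A t r x * (dret A x p b u * run_matrix A s u q) * G q)"
    by (rule sym, subst sum.swap, rule sum.cong[OF refl], subst sum.swap, rule sum.cong[OF refl], rule sum.swap)
  finally show ?case by (simp add: sum_distrib_right)
qed

lemma behaviour_tree:
  fixes A :: "('a, 'k::comm_semiring_1) wnwa"
  assumes Q: "finite (states A)"
  shows "behaviour A (yield t, nu t) =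
    (\<Sum>p\<in>states A. \<Sum>q\<in>states A. iota A p * run_matrix A t p q * kappa A q)"
proof -
  have "(\<Prod>j\<in>{1..len t}. pos_weight A (yield t, nu t) r j) = run_weight A (nth r) 0 t" for r
    using prod_pos_weight[OF nu_Nest[of t] emb_self[of t], where A = A and r = r] by (simp add: atLeastSucAtMost_greaterThanAtMost)
  then have "behaviour A (yield t, nu t) =
      (\<Sum>r\<in>paths (states A) (Suc (len t)). iota A (r ! 0) * run_weight A (nth r) 0 t * kappa A (r ! len t))"
    by (simp add: behaviour_def runs_def paths_def)
  also have "\<dots> = (\<Sum>p\<in>states A. \<Sum>\<rho>\<in>paths (states A) (len t).
      iota A p * (run_weight A (nth (p # \<rho>)) 0 t * kappa A (last (p # \<rho>))))"
    unfolding sum_paths_Suc[OF Q] by (intro sum.cong refl) (auto simp: paths_def last_conv_nth nth_Cons' mult.assoc)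
  also have "\<dots> = (\<Sum>p\<in>states A. iota A p * (\<Sum>q\<in>states A. run_matrix A t p q * kappa A q))"
    unfolding sum_distrib_left[symmetric]
    by (intro sum.cong refl arg_cong2[of _ _ _ _ times] sum_runs_run_matrix[OF Q])
  finally show ?thesis by (simp add: sum_distrib_left mult.assoc)
qed

lemma cf_ysum_proj: "proj R w = (if w = [] then 0 else cf (ysum (\<lambda>t. R (yield t, nu t))) w)"
  using cf_ysum_Nest[of "\<lambda>w \<nu>. R (w, \<nu>)" w] by (auto simp: proj_def NW_def)

text \<open>\<open>proj\<close> and \<open>nest_sem\<close> vanish at the empty word while yield
  sums count \<open>Emp\<close>. Every generator except 1 is already proper, so the correction stays
  within the span.\<close>

lemma tree_series_proper_part:
  assumes "tree_series S"
  shows "tree_series (proper_part S)"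
proof -
  obtain U where U: "finite U" "S \<in> U" "U \<subseteq> lspan (tgen U)" using assms unfolding tree_series_def by blast
  have "proper_part S \<in> lspan (tgen U)"
  proof (rule lspan_lin[where T = proper_part and B = "tgen U"])
    fix b assume "b \<in> tgen U"
    then consider "b = 1" | "cf b [] = 0" "b \<in> tgen U" by (auto simp: tgen_def)
    then show "proper_part b \<in> lspan (tgen U)"
    proof cases
      case 1
      have "proper_part (1 :: ('a, 'b) ser) = 0" by (rule ser_eqI) (simp add: cf_proper_part cf_one)
      with 1 show ?thesis by (simp add: lspan.zero)
    qed (simp add: proper_part_id lspan_base)
  qed (use U in \<open>auto intro!: ser_eqI simp: cf_proper_part\<close>)
  moreover have "lspan (tgen U) \<subseteq> lspan (tgen (insert (proper_part S) U))"
    by (rule subsetI, erule lspan_mono) (intro tgen_mono subset_insertI)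
  ultimately show ?thesis unfolding tree_series_def using U
    by (intro exI[of _ "insert (proper_part S) U"]) blast
qed

text \<open>The components of the representation are the matrix entries (p, q). At an arc the inside
  runs from \<open>r\<close> to \<open>x\<close> and the rest from \<open>u\<close> to
  \<open>q\<close>; the weights of call and return form the coefficient.\<close>

lemma regular_imp_tree_series:
  fixes R :: "'a::finite nword \<Rightarrow> 'k::comm_semiring_1"
  assumes "regular_nw_series R"
  shows "tree_series (Ser (proj R))"
proof -
  obtain A where A: "finite (states A)" and R: "\<And>nw. nw \<in> NW \<Longrightarrow> R nw = behaviour A nw"
    using assms unfolding regular_nw_series_def wnwa_ok_def by blast
  let ?Q = "states A"
  have J: "(\<Sum>i\<in>?Q \<times> ?Q. H i) = (\<Sum>p\<in>?Q. \<Sum>q\<in>?Q. H (p, q))" for H :: "nat \<times> nat \<Rightarrow> 'k"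
    by (simp add: sum.cartesian_product)
  have "representable (\<lambda>t. \<Sum>j\<in>?Q \<times> ?Q. (\<lambda>(p, q). iota A p * kappa A q) j * (\<lambda>(p, q) t. run_matrix A t p q) j t)"
  proof (rule representable_lincomb[where cI = "\<lambda>(p, q) a (r, q'). if q' = q then dint A p a r else 0"
        and cC = "\<lambda>(p, q) a b (r, x) (u, q'). if q' = q then dcall A p a r * dret A x p b u else 0"])
    fix j a t assume "j \<in> ?Q \<times> ?Q"
    then show "(\<lambda>(p, q) t. run_matrix A t p q) j (Itl a t) = (\<Sum>i\<in>?Q \<times> ?Q.
        (\<lambda>(p, q) a (r, q'). if q' = q then dint A p a r else 0) j a i * (\<lambda>(p, q) t. run_matrix A t p q) i t)"
      unfolding J using A by (auto simp: if_distrib[of "\<lambda>x. x * _"] cong: if_cong)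
  next
    fix j a t b s assume "j \<in> ?Q \<times> ?Q"
    then show "(\<lambda>(p, q) t. run_matrix A t p q) j (Arc a t b s) = (\<Sum>i\<in>?Q \<times> ?Q. \<Sum>k\<in>?Q \<times> ?Q.
        (\<lambda>(p, q) a b (r, x) (u, q'). if q' = q then dcall A p a r * dret A x p b u else 0) j a b i k *
        (\<lambda>(p, q) t. run_matrix A t p q) i t * (\<lambda>(p, q) t. run_matrix A t p q) k s)"
      unfolding J using A 
      by (auto simp: if_distrib[of "\<lambda>x. x * _"] if_distrib[of "\<lambda>x. _ * x"] mult_ac cong: if_cong intro!: sum.cong)
  qed (use A in simp)
  then have "tree_series (ysum (\<lambda>t. behaviour A (yield t, nu t)))"
    unfolding behaviour_tree[OF A] J by (intro tree_series_ysum) (simp add: mult_ac)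
  moreover have "Ser (proj R) = proper_part (ysum (\<lambda>t. behaviour A (yield t, nu t)))"
  proof (rule ser_eqI)
    fix w
    have "proj R w = proj (behaviour A) w" unfolding proj_def by (intro sum.cong) (auto simp: R)
    then show "cf (Ser (proj R)) w = cf (proper_part (ysum (\<lambda>t. behaviour A (yield t, nu t)))) w"
      by (simp add: cf_ysum_proj cf_proper_part)
  qed
  ultimately show ?thesis by (simp add: tree_series_proper_part)
qed

text \<open>A state pairs a component of the representation with the guess of what follows a call:
  the letter at the matching return and the component that continues after it.\<close>

lemma representable_imp_behaviour:
  fixes f :: "'a::finite nt \<Rightarrow> 'k::comm_semiring_1"
  assumes "representable f"
  obtains A where "wnwa_ok A" "\<And>t. behaviour A (yield t, nu t) = f t"
proof -
  obtain F cI cC where F: "finite F" "f \<in> F"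
    and I: "\<And>g a t. g \<in> F \<Longrightarrow> g (Itl a t) = (\<Sum>h\<in>F. cI g a h * h t)"
    and C: "\<And>g a t b s. g \<in> F \<Longrightarrow> g (Arc a t b s) = (\<Sum>h\<in>F. \<Sum>h'\<in>F. cC g a b h h' * h t * h' s)"
    using assms by (rule representableE) (rule that; assumption)
  \<comment> \<open>\<open>None\<close> announces that the factor ends or goes on with an internal
    letter, \<open>Some (b, g)\<close> is the guess made before a call.\<close>
  define Op where "Op = insert None (Some ` ((UNIV :: 'a set) \<times> F))"
  have Op: "finite Op" using F by (simp add: Op_def)
  have sumOp: "(\<Sum>x\<in>Op. H x) = H None + (\<Sum>b\<in>UNIV. \<Sum>g\<in>F. H (Some (b, g)))"
    for H :: "('a \<times> ('a nt \<Rightarrow> 'k)) option \<Rightarrow> 'k"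
    unfolding Op_def using F by (simp add: sum.reindex sum.cartesian_product)
  obtain e :: "('a nt \<Rightarrow> 'k) \<times> ('a \<times> ('a nt \<Rightarrow> 'k)) option \<Rightarrow> nat" where e: "inj_on e (F \<times> Op)"
    using finite_imp_inj_to_nat_seg[of "F \<times> Op"] F(1) Op by blast
  define d where "d = inv_into (F \<times> Op) e"
  have d: "d (e x) = x" if "x \<in> F \<times> Op" for x using that e by (simp add: d_def)
  \<comment> \<open>Only a state without a pending guess may end a factor.\<close>
  define fin where "fin x = (case d x of (h, None) \<Rightarrow> h Emp | _ \<Rightarrow> 0)" for x
  \<comment> \<open>In \<open>dret\<close>, the inside of the arc ends at state \<open>x\<close>, so
    its final weight \<open>fin x\<close> is charged there; the guess is checked against
    \<open>p\<close>, the state before the call.\<close>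
  define A :: "('a, 'k) wnwa" where "A = \<lparr>states = e ` (F \<times> Op),
    iota = (\<lambda>p. if fst (d p) = f then 1 else 0),
    dcall = (\<lambda>p a q. case d p of (h, Some (b, g)) \<Rightarrow> cC h a b (fst (d q)) g | _ \<Rightarrow> 0),
    dint = (\<lambda>p a q. case d p of (h, None) \<Rightarrow> cI h a (fst (d q)) | _ \<Rightarrow> 0),
    dret = (\<lambda>x p b u. fin x * (case d p of (h, Some (b', g)) \<Rightarrow> if b' = b \<and> fst (d u) = g then 1 else 0 | _ \<Rightarrow> 0)),
    kappa = fin\<rparr>"
  have dret: "dret A x p b u = fin x * (case d p of (h, Some (b', g)) \<Rightarrow> if b' = b \<and> fst (d u) = g then 1 else 0 | _ \<Rightarrow> 0)"
    for x p b u by (simp add: A_def)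
  have sumA: "(\<Sum>x\<in>states A. H x) = (\<Sum>h\<in>F. \<Sum>y\<in>Op. H (e (h, y)))" for H :: "nat \<Rightarrow> 'k"
    unfolding A_def using e by (simp add: sum.reindex sum.cartesian_product)
  have A: "finite (states A)" unfolding A_def using F(1) Op by simp
  define V where "V t p = (\<Sum>q\<in>states A. run_matrix A t p q * fin q)" for t p
  have V0: "V Emp p = fin p" if "p \<in> states A" for p
    using that A by (simp add: V_def if_distrib[of "\<lambda>x. x * _"] cong: if_cong)
  have VI: "V (Itl a t) p = (\<Sum>r\<in>states A. dint A p a r * V t r)" for a t p
    unfolding V_def by (simp add: sum_distrib_left sum_distrib_right mult.assoc) (rule sum.swap)
  have VC: "V (Arc a t b s) p = (\<Sum>r\<in>states A. \<Sum>u\<in>states A. dcall A p a r * V t r *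
      ((case d p of (h, Some (b', g)) \<Rightarrow> if b' = b \<and> fst (d u) = g then 1 else 0 | _ \<Rightarrow> 0) * V s u))"
    (is "_ = (\<Sum>r\<in>_. \<Sum>u\<in>_. _ * _ * (?g u * _))") for a t b s p
  proof -
    have "V (Arc a t b s) p = (\<Sum>q\<in>states A. \<Sum>r\<in>states A. \<Sum>x\<in>states A. \<Sum>u\<in>states A.
        dcall A p a r * (run_matrix A t r x * fin x) * (?g u * (run_matrix A s u q * fin q)))"
      unfolding V_def run_matrix.simps dret sum_distrib_right by (intro sum.cong refl) (simp only: mult_ac)
    also have "\<dots> = (\<Sum>r\<in>states A. \<Sum>x\<in>states A. \<Sum>u\<in>states A. \<Sum>q\<in>states A.
        dcall A p a r * (run_matrix A t r x * fin x) * (?g u * (run_matrix A s u q * fin q)))"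
      by (subst sum.swap) (rule sum.cong[OF refl], subst sum.swap, rule sum.cong[OF refl], rule sum.swap)
    also have "\<dots> = (\<Sum>r\<in>states A. \<Sum>u\<in>states A. \<Sum>x\<in>states A. \<Sum>q\<in>states A.
        dcall A p a r * (run_matrix A t r x * fin x) * (?g u * (run_matrix A s u q * fin q)))"
      by (rule sum.cong[OF refl], rule sum.swap)
    finally show ?thesis unfolding V_def by (simp only: sum_distrib_left[symmetric] sum_distrib_right[symmetric])
  qed
  \<comment> \<open>Summing over all guesses recovers \<open>h\<close>, because only guesses that
    fit the first symbol of the tree contribute.\<close>
  have claim: "(\<Sum>y\<in>Op. V t (e (h, y))) = h t" if "h \<in> F" for h t
    using that
  proof (induction t arbitrary: h)
    case Emp
    have "(\<Sum>y\<in>Op. V Emp (e (h, y))) = (\<Sum>y\<in>Op. fin (e (h, y)))"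
      using Emp by (intro sum.cong refl V0) (simp add: A_def)
    also have "\<dots> = h Emp" unfolding sumOp using Emp by (simp add: fin_def d Op_def)
    finally show ?case .
  next
    case (Itl a t)
    have "(\<Sum>y\<in>Op. V (Itl a t) (e (h, y))) = V (Itl a t) (e (h, None))"
      unfolding sumOp VI using Itl.prems by (simp add: A_def d Op_def)
    also have "\<dots> = (\<Sum>h'\<in>F. \<Sum>y\<in>Op. cI h a h' * V t (e (h', y)))"
      unfolding VI sumA using Itl.prems by (intro sum.cong refl) (simp add: A_def d Op_def)
    also have "\<dots> = h (Itl a t)"
      unfolding I[OF Itl.prems] sum_distrib_left[symmetric] using Itl.IH by (intro sum.cong refl) simp
    finally show ?case .
  next
    case (Arc a t b s)
    have "(\<Sum>y\<in>Op. V (Arc a t b s) (e (h, y))) = (\<Sum>b'\<in>UNIV. \<Sum>g\<in>F. V (Arc a t b s) (e (h, Some (b', g))))"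
      unfolding sumOp VC using Arc.prems by (simp add: A_def d Op_def)
    also have "\<dots> = (\<Sum>b'\<in>UNIV. \<Sum>g\<in>F. \<Sum>r\<in>F. \<Sum>y\<in>Op. \<Sum>u\<in>F. \<Sum>z\<in>Op.
        if b' = b then if u = g then cC h a b r g * V t (e (r, y)) * V s (e (u, z)) else 0 else 0)"
      unfolding VC sumA using Arc.prems by (intro sum.cong refl) (simp add: A_def d Op_def)
    also have "\<dots> = (\<Sum>b'\<in>UNIV. if b' = b then \<Sum>g\<in>F. \<Sum>r\<in>F. \<Sum>y\<in>Op. \<Sum>u\<in>F. 
        if u = g then \<Sum>z\<in>Op. cC h a b r g * V t (e (r, y)) * V s (e (u, z)) else 0 else 0)"
      by (intro sum.cong refl) (auto intro!: sum.cong)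
    also have "\<dots> = (\<Sum>g\<in>F. \<Sum>r\<in>F. \<Sum>y\<in>Op. \<Sum>z\<in>Op. cC h a b r g * V t (e (r, y)) * V s (e (g, z)))"
      using F(1) by (simp cong: if_cong)
    also have "\<dots> = (\<Sum>g\<in>F. \<Sum>r\<in>F. cC h a b r g * (\<Sum>y\<in>Op. V t (e (r, y))) * (\<Sum>z\<in>Op. V s (e (g, z))))"
      by (simp only: sum_distrib_left[symmetric] sum_distrib_right[symmetric])
    also have "\<dots> = (\<Sum>g\<in>F. \<Sum>r\<in>F. cC h a b r g * r t * g s)"
      using Arc.IH by (intro sum.cong refl) simp
    also have "\<dots> = h (Arc a t b s)" unfolding C[OF Arc.prems] by (rule sum.swap)
    finally show ?case .
  qed
  have "behaviour A (yield t, nu t) = f t" for t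
  proof -
    have "behaviour A (yield t, nu t) = (\<Sum>p\<in>states A. iota A p * V t p)"
      unfolding behaviour_tree[OF A] V_def by (simp add: sum_distrib_left mult.assoc A_def)
    also have "\<dots> = (\<Sum>h\<in>F. \<Sum>y\<in>Op. if h = f then V t (e (h, y)) else 0)"
      unfolding sumA by (intro sum.cong refl) (simp add: A_def d)
    also have "\<dots> = (\<Sum>h\<in>F. if h = f then \<Sum>y\<in>Op. V t (e (h, y)) else 0)"
      by (intro sum.cong refl) auto
    also have "\<dots> = f t" using F claim by simp
    finally show ?thesis .
  qed
  then show ?thesis using A by (intro that[of A]) (auto simp: wnwa_ok_def)
qed

lemma algebraic_iff_regular:
  fixes S :: "'a::finite list \<Rightarrow> 'k::comm_semiring_1"
  shows "algebraic S \<longleftrightarrow> (\<exists>R :: 'a nword \<Rightarrow> 'k. regular_nw_series R \<and> S = proj R)"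
proof
  assume "algebraic S"
  then have S: "tree_series (Ser S)" "S [] = 0" by (simp_all add: algebraic_iff_tree_series)
  obtain f where f: "representable f" "Ser S = ysum f" using S(1) by (rule tree_series_imp_representable)
  obtain A where A: "wnwa_ok A" "\<And>t. behaviour A (yield t, nu t) = f t"
    using f(1) by (rule representable_imp_behaviour) (rule that; assumption)
  have "S w = proj (behaviour A) w" for w
    using f(2) S(2) by (simp add: cf_ysum_proj A(2)) (metis cf_Ser)
  moreover have "regular_nw_series (behaviour A)"
    unfolding regular_nw_series_def using A(1) by blast
  ultimately show "\<exists>R :: 'a nword \<Rightarrow> 'k. regular_nw_series R \<and> S = proj R" by blast
next
  assume "\<exists>R :: 'a nword \<Rightarrow> 'k. regular_nw_series R \<and> S = proj R"
  then show "algebraic S" using regular_imp_tree_series by (auto simp: algebraic_iff_tree_series cf_ysum_proj)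
qed

section \<open>First-order semantics of the translations\<close>

text \<open>Formulas in \<open>sRFO\<close> contain no set quantifiers, so set variables keep the value \<open>{}\<close>
  throughout and the clause for \<open>MEx2\<close> is never used.\<close>

fun msat :: "'a nword \<Rightarrow> (nat \<Rightarrow> nat) \<Rightarrow> 'a mso \<Rightarrow> bool" where
  "msat nw s (MAt a) = atom_holds nw s (\<lambda>_. {}) a"
| "msat nw s (MNeg p) = (\<not> msat nw s p)"
| "msat nw s (MOr p q) = (msat nw s p \<or> msat nw s q)"
| "msat nw s (MEx1 x p) = (\<exists>i\<in>{1..length (fst nw)}. msat nw (s(x := i)) p)"
| "msat nw s (MEx2 X p) = False"

fun fo :: "'a mso \<Rightarrow> bool" where
  "fo (MAt a) = True"
| "fo (MNeg p) = fo p"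
| "fo (MOr p q) = (fo p \<and> fo q)"
| "fo (MEx1 x p) = fo p"
| "fo (MEx2 X p) = False"

lemma atom_agree: "(\<And>x. x \<in> atom_vars1 a \<Longrightarrow> s x = s' x) \<Longrightarrow> atom_holds nw s s2 a = atom_holds nw s' s2 a"
  by (cases a) auto

lemma msat_agree: "(\<And>x. x \<in> vars1 p \<Longrightarrow> s x = s' x) \<Longrightarrow> msat nw s p = msat nw s' p"
proof (induction p arbitrary: s s')
  case (MAt a)
  then show ?case by (simp add: atom_agree[of a s s'])
next
  case (MOr p q)
  then show ?case by (metis UnCI msat.simps(3) vars1.simps(3))
next
  case (MEx1 x p)
  have "msat nw (s(x := i)) p = msat nw (s'(x := i)) p" for i
    by (rule MEx1.IH) (use MEx1.prems in auto)
  then show ?case by simp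
next
  case (MNeg p)
  then show ?case by (metis msat.simps(2) vars1.simps(2))
next
  case (MEx2 X p)
  show ?case by simp
qed

lemma msat_subst1: "y \<notin> vars1 p \<Longrightarrow> msat nw s (subst1 x y p) = msat nw (s(x := s y)) p"
proof (induction p arbitrary: s)
  case (MAt a)
  then show ?case by (cases a) auto
next
  case (MEx1 z p)
  show ?case
  proof (cases "z = x")
    case False
    have "msat nw (s(z := i)) (subst1 x y p) = msat nw (s(x := s y, z := i)) p" for i
    proof -
      have "msat nw (s(z := i)) (subst1 x y p) = msat nw (s(z := i, x := (s(z := i)) y)) p"
        by (rule MEx1.IH) (use MEx1.prems in simp)
      also have "s(z := i, x := (s(z := i)) y) = s(x := s y, z := i)"
        using False MEx1.prems by (simp add: fun_upd_twist[of x z])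
      finally show ?thesis .
    qed
    with False show ?thesis by (simp only: if_False subst1.simps msat.simps)
  qed (simp only: simp_thms if_True subst1.simps msat.simps fun_upd_upd)
qed auto

lemma fo_subst1 [simp]: "fo (subst1 x y p) = fo p"
  by (induction p) auto

lemma fo_mand [simp]: "fo (mand p q) = (fo p \<and> fo q)"
  and fo_mlt [simp]: "fo (mlt x y)"
  by (simp_all add: mand_def mlt_def)

lemma msat_mand [simp]: "msat nw s (mand p q) = (msat nw s p \<and> msat nw s q)"
  and msat_mlt [simp]: "msat nw s (mlt x y) = (s x < s y)"
  by (auto simp: mand_def mlt_def)

lemma fresh1_notin: "fresh1 p \<notin> vars1 p"
proof
  assume "fresh1 p \<in> vars1 p"
  then have "fresh1 p \<le> Max (insert 0 (vars1 p))" by (intro Max_ge) auto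
  then show False by (simp add: fresh1_def)
qed

lemma no_so_pm: "no_so_quant (pm b p) \<longleftrightarrow> fo p"
  by (induction b p rule: pm.induct) auto

text \<open>At most one summand is nonzero, the one at the least witness; so the truth value
  survives summation in any semiring.\<close>

lemma sum_least:
  fixes n :: nat
  shows "(\<Sum>i\<in>{1..n}. if P i \<and> (\<forall>j\<in>{1..n}. \<not> (j < i \<and> P j)) then 1 else (0 :: 'k::comm_semiring_1))
    = (if \<exists>i\<in>{1..n}. P i then 1 else 0)"
proof (cases "\<exists>i\<in>{1..n}. P i")
  case True
  define m where "m = (LEAST i. i \<in> {1..n} \<and> P i)"
  have m: "m \<in> {1..n} \<and> P m" unfolding m_def by (rule LeastI_ex) (use True in auto)
  have "(P i \<and> (\<forall>j\<in>{1..n}. \<not> (j < i \<and> P j))) = (i = m)" if "i \<in> {1..n}" for i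
    using m that not_less_Least[of _ "\<lambda>i. i \<in> {1..n} \<and> P i", folded m_def]
    by (metis linorder_neqE_nat)
  then have "(\<Sum>i\<in>{1..n}. if P i \<and> (\<forall>j\<in>{1..n}. \<not> (j < i \<and> P j)) then 1 else (0 :: 'k))
      = (\<Sum>i\<in>{1..n}. if i = m then 1 else 0)"
    by (intro sum.cong) auto
  then show ?thesis using True m by simp
next
  case False
  then show ?thesis by (auto intro!: sum.neutral)
qed

lemma prod_bool: "finite A \<Longrightarrow> (\<Prod>i\<in>A. if P i then 1 else (0 :: 'k::comm_semiring_1)) = (if \<forall>i\<in>A. P i then 1 else 0)"
  by (induction A rule: finite_induct) auto

text \<open>Unambiguity: at an existential quantifier the added conjunct rejects every witness but
  the least, and the sum reduces by \<open>sum_least\<close>.\<close>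

lemma wsem_pm:
  fixes p :: "'a mso"
  shows "fo p \<Longrightarrow> wsem nw s (\<lambda>_. {}) (pm b p) = (if msat nw s p = b then 1 else (0 :: 'k::comm_semiring_1))"
proof (induction b p arbitrary: s rule: pm.induct)
  case (6 x p)
  let ?n = "length (fst nw)"
  let ?y = "fresh1 (MEx1 x p)"
  have y: "?y \<noteq> x" "?y \<notin> vars1 p" using fresh1_notin[of "MEx1 x p"] by auto
  have 1: "wsem nw s (\<lambda>_. {}) (pm True p) = (if msat nw s p then 1 else (0 :: 'k))" for s
    using 6 by simp
  have 2: "wsem nw s (\<lambda>_. {}) (pm False (mand (mlt ?y x) (subst1 x ?y p)))
      = (if \<not> (s ?y < s x \<and> msat nw (s(x := s ?y)) p) then 1 else (0 :: 'k))" for s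
    using 6 by (simp add: msat_subst1[OF y(2)])
  have 3: "msat nw (s(?y := j, x := j)) p = msat nw (s(x := j)) p" for j
    by (rule msat_agree) (use y in auto)
  have "wsem nw s (\<lambda>_. {}) (pm True (MEx1 x p)) = (\<Sum>i\<in>{1..?n}. (if msat nw (s(x := i)) p then 1 else 0) *
      (\<Prod>j\<in>{1..?n}. if \<not> (j < i \<and> msat nw (s(x := j)) p) then 1 else (0 :: 'k)))"
    using y(1) by (simp add: 1 2 3)
  also have "\<dots> = (\<Sum>i\<in>{1..?n}. if msat nw (s(x := i)) p
      \<and> (\<forall>j\<in>{1..?n}. \<not> (j < i \<and> msat nw (s(x := j)) p)) then 1 else 0)"
    by (intro sum.cong refl) (simp add: prod_bool del: not_less de_Morgan_conj)
  also have "\<dots> = (if msat nw s (MEx1 x p) = True then 1 else 0)" by (subst sum_least) simp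
  finally show ?case .
next
  case (7 x p)
  then show ?case by (simp add: prod_bool)
qed auto

lemma wsem_agree:
  "(\<And>x. x \<in> wfree1 p \<Longrightarrow> s x = s' x) \<Longrightarrow> wsem nw s s2 p = wsem nw s' s2 p"
proof (induction p arbitrary: s s' s2)
  case (WAt a)
  then show ?case by (simp add: atom_agree[of a s s'])
next
  case (WNAt a)
  then show ?case by (simp add: atom_agree[of a s s'])
next
  case (WOr p q)
  then show ?case by (metis UnCI wfree1.simps(4) wsem.simps(4))
next
  case (WAnd p q)
  then show ?case by (metis UnCI wfree1.simps(5) wsem.simps(5))
next
  case (WEx1 x p)
  have "wsem nw (s(x := i)) s2 p = wsem nw (s'(x := i)) s2 p" for i
    by (rule WEx1.IH) (use WEx1.prems in auto)
  then show ?case by simp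
next
  case (WAll1 x p)
  have "wsem nw (s(x := i)) s2 p = wsem nw (s'(x := i)) s2 p" for i
    by (rule WAll1.IH) (use WAll1.prems in auto)
  then show ?case by simp
next
  case (WEx2 X p)
  have "wsem nw s (s2(X := i)) p = wsem nw s' (s2(X := i)) p" for i
    by (rule WEx2.IH) (use WEx2.prems in auto)
  then show ?case by simp
next
  case (WAll2 X p)
  have "wsem nw s (s2(X := i)) p = wsem nw s' (s2(X := i)) p" for i
    by (rule WAll2.IH) (use WAll2.prems in auto)
  then show ?case by simp
qed simp

section \<open>Trees annotated with an assignment\<close>

fun amap :: "(nat \<Rightarrow> 'a \<Rightarrow> 'b) \<Rightarrow> 'a nt \<Rightarrow> 'b nt" where
  "amap g Emp = Emp"
| "amap g (Itl a t) = Itl (g 1 a) (amap (\<lambda>i. g (Suc i)) t)"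
| "amap g (Arc a t b s) = Arc (g 1 a) (amap (\<lambda>i. g (Suc i)) t)
     (g (len t + 2) b) (amap (\<lambda>i. g (i + len t + 2)) s)"

lemma len_amap [simp]: "len (amap g t) = len t"
  by (induction t arbitrary: g) auto

lemma nth_yield_amap: "i < len t \<Longrightarrow> yield (amap g t) ! i = g (Suc i) (yield t ! i)"
proof (induction t arbitrary: g i)
  case (Itl a t)
  then show ?case by (cases i) auto
next
  case (Arc a t b s)
  show ?case
  proof (cases i)
    case (Suc i')
    consider "i' < len t" | "i' = len t" | "len t < i'" by linarith
    then show ?thesis
    proof cases
      case 3
      then obtain j where j: "i' = Suc (len t + j)" using less_imp_Suc_add by blast
      with Arc.prems Suc have "j < len s" by simp
      with j Suc Arc.IH(2) show ?thesis by (simp add: nth_append add_ac)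
    qed (use Suc Arc.IH(1) in \<open>auto simp: nth_append\<close>)
  qed simp
qed simp

lemma amap_amap: "amap g (amap h t) = amap (\<lambda>i a. g i (h i a)) t"
  by (induction t arbitrary: g h) auto

lemma amap_cong: "(\<And>i a. 1 \<le> i \<Longrightarrow> i \<le> len t \<Longrightarrow> g i a = h i a) \<Longrightarrow> amap g t = amap h t"
proof (induction t arbitrary: g h)
  case (Itl a t)
  have "amap (\<lambda>i. g (Suc i)) t = amap (\<lambda>i. h (Suc i)) t"
    by (rule Itl.IH) (use Itl.prems in auto)
  then show ?case using Itl.prems[of 1] by simp
next
  case (Arc a t b s)
  have "amap (\<lambda>i. g (Suc i)) t = amap (\<lambda>i. h (Suc i)) t"
    by (rule Arc.IH) (use Arc.prems in auto)
  moreover have "amap (\<lambda>i. g (i + len t + 2)) s = amap (\<lambda>i. h (i + len t + 2)) s"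
    by (rule Arc.IH) (use Arc.prems in auto)
  ultimately show ?case using Arc.prems[of 1] Arc.prems[of "len t + 2"] by simp
qed simp

text \<open>All variables are recorded at once. The alphabet becomes infinite, but finiteness is
  later required of state sets only.\<close>

definition annot :: "'a nt \<Rightarrow> (nat \<Rightarrow> nat) \<Rightarrow> ('a \<times> nat set) nt" where
  "annot t s = amap (\<lambda>i a. (a, {x. s x = i})) t"

definition mk :: "nat \<Rightarrow> bool \<Rightarrow> 'a \<times> nat set \<Rightarrow> 'a \<times> nat set" where
  "mk x b l = (fst l, if b then insert x (snd l) else snd l - {x})"

text \<open>Positions start at 1, so \<open>mark x 0\<close> erases \<open>x\<close>; this is what
  happens to a subtree that does not contain the marked position.\<close>

definition mark :: "nat \<Rightarrow> nat \<Rightarrow> ('a \<times> nat set) nt \<Rightarrow> ('a \<times> nat set) nt" where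
  "mark x i u = amap (\<lambda>j. mk x (j = i)) u"

lemma annot_upd: "annot t (s(x := i)) = mark x i (annot t s)"
  unfolding annot_def mark_def amap_amap
  by (rule amap_cong) (auto simp: mk_def)

lemma len_annot [simp]: "len (annot t s) = len t"
  and len_mark [simp]: "len (mark x i u) = len u"
  by (simp_all add: annot_def mark_def)

lemma mark_Itl:
  "mark x 0 (Itl a u) = Itl (mk x False a) (mark x 0 u)"
  "mark x (Suc 0) (Itl a u) = Itl (mk x True a) (mark x 0 u)"
  "1 \<le> i \<Longrightarrow> mark x (Suc i) (Itl a u) = Itl (mk x False a) (mark x i u)"
  by (auto simp: mark_def intro: amap_cong)

lemma mark_Arc:
  "mark x 0 (Arc a u b v) = Arc (mk x False a) (mark x 0 u) (mk x False b) (mark x 0 v)"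
  "mark x (Suc 0) (Arc a u b v) = Arc (mk x True a) (mark x 0 u) (mk x False b) (mark x 0 v)"
  "1 \<le> i \<Longrightarrow> i \<le> len u \<Longrightarrow>
     mark x (Suc i) (Arc a u b v) = Arc (mk x False a) (mark x i u) (mk x False b) (mark x 0 v)"
  "mark x (len u + 2) (Arc a u b v) = Arc (mk x False a) (mark x 0 u) (mk x True b) (mark x 0 v)"
  "1 \<le> i \<Longrightarrow>
     mark x (i + len u + 2) (Arc a u b v) = Arc (mk x False a) (mark x 0 u) (mk x False b) (mark x i v)"
  by (auto simp: mark_def intro!: amap_cong)

lemma pos_Itl: "{1..Suc m} = insert 1 (Suc ` {1..m})"
  by (auto simp: image_iff Bex_def)

lemma pos_Arc:
  "{1..Suc (m + Suc n)} = insert 1 (Suc ` {1..m}) \<union> insert (m + 2) ((\<lambda>i. i + m + 2) ` {1..n})"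
proof -
  have "{1..Suc (m + Suc n)} = {1..Suc m} \<union> insert (m + 2) {m + 3..m + 2 + n}" by auto
  also have "{m + 3..m + 2 + n} = (\<lambda>i. i + m + 2) ` {1..n}"
    using image_add_atLeastAtMost[of "m + 2" 1 n] by (simp add: add_ac)
  finally show ?thesis unfolding pos_Itl .
qed

context comm_monoid_set
begin

text \<open>Stated for \<open>comm_monoid_set\<close>, so that one splitting serves both sums and
  products over positions.\<close>

lemma positions_Itl: "F g {1..Suc m} = g 1 \<^bold>* F (\<lambda>i. g (Suc i)) {1..m}"
proof -
  have "F g (Suc ` {1..m}) = F (\<lambda>i. g (Suc i)) {1..m}" by (subst reindex) (auto simp: o_def)
  then show ?thesis unfolding pos_Itl by (subst insert) (simp, force, simp only:)
qed

lemma positions_Arc: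
  "F g {1..Suc (m + Suc n)} = 
     (g 1 \<^bold>* F (\<lambda>i. g (Suc i)) {1..m}) \<^bold>* (g (m + 2) \<^bold>* F (\<lambda>i. g (i + m + 2)) {1..n})"
proof -
  have "F g (Suc ` {1..m}) = F (\<lambda>i. g (Suc i)) {1..m}" by (subst reindex) (auto simp: o_def)
  moreover have "F g ((\<lambda>i. i + m + 2) ` {1..n}) = F (\<lambda>i. g (i + m + 2)) {1..n}"
    by (subst reindex) (auto simp: o_def inj_on_def)
  ultimately show ?thesis unfolding pos_Arc
    by (subst union_disjoint, simp, simp, force)
       (subst insert, simp, force, subst insert, simp, force, simp only:)
qed

end

section \<open>Step functions\<close>

text \<open>A homomorphism into a finite algebra, that is, a deterministic bottom-up tree automaton;
  its transitions may depend on letters of an infinite alphabet.\<close>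

definition fhom :: "('b nt \<Rightarrow> 'v) \<Rightarrow> bool" where
  "fhom h \<longleftrightarrow> finite (range h) \<and> (\<exists>hI. \<forall>a t. h (Itl a t) = hI a (h t))
     \<and> (\<exists>hC. \<forall>a b t s. h (Arc a t b s) = hC a b (h t) (h s))"

text \<open>States are naturals because a definition cannot quantify over the type of states;
  \<open>stepfI\<close> renumbers any finite carrier.\<close>

definition stepf :: "('b nt \<Rightarrow> 'c) \<Rightarrow> bool" where
  "stepf f \<longleftrightarrow> (\<exists>(h :: 'b nt \<Rightarrow> nat) v. fhom h \<and> f = (\<lambda>t. v (h t)))"

lemma fhomI:
  "finite (range h) \<Longrightarrow> (\<And>a t. h (Itl a t) = hI a (h t)) \<Longrightarrow>
    (\<And>a b t s. h (Arc a t b s) = hC a b (h t) (h s)) \<Longrightarrow> fhom h"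
  unfolding fhom_def by blast

lemma fhomE:
  assumes "fhom h"
  obtains hI hC where "finite (range h)" "\<And>a t. h (Itl a t) = hI a (h t)"
    "\<And>a b t s. h (Arc a t b s) = hC a b (h t) (h s)"
  using assms unfolding fhom_def by blast

lemma stepfI:
  fixes h :: "'b nt \<Rightarrow> 'v"
  assumes "fhom h"
  shows "stepf (\<lambda>t. v (h t))"
proof -
  obtain hI hC where h: "finite (range h)" "\<And>a t. h (Itl a t) = hI a (h t)"
    "\<And>a b t s. h (Arc a t b s) = hC a b (h t) (h s)"
    using assms by (rule fhomE) (rule that; assumption)
  obtain e :: "'v \<Rightarrow> nat" where e: "inj_on e (range h)"
    using finite_imp_inj_to_nat_seg[OF h(1)] by blast
  define d where "d = inv_into (range h) e"
  have d: "d (e (h t)) = h t" for t using e by (simp add: d_def)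
  have "fhom (\<lambda>t. e (h t))"
  proof (rule fhomI)
    have "range (\<lambda>t. e (h t)) = e ` range h" by auto
    then show "finite (range (\<lambda>t. e (h t)))" using h(1) by simp
    show "e (h (Itl a t)) = e (hI a (d (e (h t))))" for a t by (simp add: d h)
    show "e (h (Arc a t b s)) = e (hC a b (d (e (h t))) (d (e (h s))))" for a b t s by (simp add: d h)
  qed
  then show ?thesis unfolding stepf_def
    by (intro exI[of _ "\<lambda>t. e (h t)"] exI[of _ "\<lambda>n. v (d n)"]) (simp add: d)
qed

lemma fhom_pair:
  assumes "fhom g" "fhom h"
  shows "fhom (\<lambda>t. (g t, h t))"
proof -
  obtain gI gC where g: "finite (range g)" "\<And>a t. g (Itl a t) = gI a (g t)"
    "\<And>a b t s. g (Arc a t b s) = gC a b (g t) (g s)"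
    using assms(1) by (rule fhomE) (rule that; assumption)
  obtain hI hC where h: "finite (range h)" "\<And>a t. h (Itl a t) = hI a (h t)"
    "\<And>a b t s. h (Arc a t b s) = hC a b (h t) (h s)"
    using assms(2) by (rule fhomE) (rule that; assumption)
  show ?thesis
  proof (rule fhomI)
    have "range (\<lambda>t. (g t, h t)) \<subseteq> range g \<times> range h" by auto
    then show "finite (range (\<lambda>t. (g t, h t)))" by (rule finite_subset) (simp add: g h)
    show "(g (Itl a t), h (Itl a t)) = (gI a (fst (g t, h t)), hI a (snd (g t, h t)))" for a t
      by (simp add: g h)
    show "(g (Arc a t b s), h (Arc a t b s)) = (gC a b (fst (g t, h t)) (fst (g s, h s)),
        hC a b (snd (g t, h t)) (snd (g s, h s)))" for a t b s
      by (simp add: g h)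
  qed
qed

lemma stepf_comb:
  assumes "stepf f" "stepf g"
  shows "stepf (\<lambda>t. c (f t) (g t))"
proof -
  obtain h v where h: "fhom (h :: 'a nt \<Rightarrow> nat)" "f = (\<lambda>t. v (h t))"
    using assms(1) unfolding stepf_def by blast
  obtain h' v' where h': "fhom (h' :: 'a nt \<Rightarrow> nat)" "g = (\<lambda>t. v' (h' t))"
    using assms(2) unfolding stepf_def by blast
  show ?thesis using stepfI[OF fhom_pair[OF h(1) h'(1)], of "\<lambda>(m, n). c (v m) (v' n)"] h h' by simp
qed

lemma stepf_const: "stepf (\<lambda>_. c)"
  using stepfI[of "\<lambda>_. ()" "\<lambda>_. c"] by (simp add: fhom_def)

lemma stepf_app: "stepf f \<Longrightarrow> stepf (\<lambda>t. c (f t))"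
  using stepf_comb[of f f "\<lambda>x _. c x"] .

section \<open>Atomic formulas and first-order quantifiers as tree automata\<close>

lemma fhom_exists: "fhom (\<lambda>u. \<exists>a\<in>set (yield u). P a)"
  by (rule fhomI[where hI = "\<lambda>a v. P a \<or> v" and hC = "\<lambda>a b v v'. P a \<or> v \<or> P b \<or> v'"])
     (auto intro: finite_subset[of _ UNIV])

fun ordered :: "('b \<Rightarrow> bool) \<Rightarrow> ('b \<Rightarrow> bool) \<Rightarrow> 'b list \<Rightarrow> bool" where
  "ordered P Q [] = False"
| "ordered P Q (a # l) = (P a \<and> (\<exists>c\<in>set (a # l). Q c) \<or> ordered P Q l)"

lemma ordered_append:
  "ordered P Q (l @ m) \<longleftrightarrow> ordered P Q l \<or> ordered P Q m \<or> (\<exists>a\<in>set l. P a) \<and> (\<exists>c\<in>set m. Q c)"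
  by (induction l) auto

lemma ordered_nth: "ordered P Q l \<longleftrightarrow> (\<exists>i j. i \<le> j \<and> j < length l \<and> P (l ! i) \<and> Q (l ! j))"
proof (induction l)
  case (Cons a l)
  have "(\<exists>i j. i \<le> j \<and> j < length (a # l) \<and> P ((a # l) ! i) \<and> Q ((a # l) ! j)) \<longleftrightarrow>
      P a \<and> (\<exists>j < length (a # l). Q ((a # l) ! j)) \<or>
      (\<exists>i j. i \<le> j \<and> j < length l \<and> P (l ! i) \<and> Q (l ! j))" (is "?L = ?R")
  proof
    assume ?L
    then obtain i j where ij: "i \<le> j" "j < length (a # l)" "P ((a # l) ! i)" "Q ((a # l) ! j)" by blast
    show ?R
    proof (cases i)
      case 0 with ij show ?thesis by auto
    next
      case (Suc i')
      then obtain j' where "j = Suc j'" using ij by (cases j) auto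
      with Suc ij show ?thesis by auto
    qed
  next
    assume ?R
    then show ?L
    proof
      assume "P a \<and> (\<exists>j < length (a # l). Q ((a # l) ! j))"
      then show ?thesis by (metis le0 nth_Cons_0)
    next
      assume "\<exists>i j. i \<le> j \<and> j < length l \<and> P (l ! i) \<and> Q (l ! j)"
      then show ?thesis by (metis Suc_le_mono Suc_less_eq length_Cons nth_Cons_Suc)
    qed
  qed
  then show ?case unfolding ordered.simps Cons.IH by (simp only: in_set_conv_nth Bex_def) blast
qed simp

lemma stepf_ordered: "stepf (\<lambda>u. ordered P Q (yield u))"
proof -
  have "fhom (\<lambda>u. (\<exists>a\<in>set (yield u). P a, \<exists>a\<in>set (yield u). Q a, ordered P Q (yield u)))"
    by (rule fhomI[where
          hI = "\<lambda>a (p, q, r). (P a \<or> p, Q a \<or> q, P a \<and> (Q a \<or> q) \<or> r)"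
          and hC = "\<lambda>a b (p, q, r) (p', q', r'). (P a \<or> p \<or> P b \<or> p', Q a \<or> q \<or> Q b \<or> q',
            P a \<and> (Q a \<or> q \<or> Q b \<or> q') \<or> p \<and> (Q b \<or> q') \<or> r \<or> P b \<and> (Q b \<or> q') \<or> r')"])
       (auto intro: finite_subset[of _ UNIV] simp: ordered_append)
  from stepfI[OF this, of "\<lambda>(p, q, r). r"] show ?thesis by simp
qed

fun matched :: "('b \<Rightarrow> bool) \<Rightarrow> ('b \<Rightarrow> bool) \<Rightarrow> 'b nt \<Rightarrow> bool" where
  "matched P Q Emp = False"
| "matched P Q (Itl a u) = matched P Q u"
| "matched P Q (Arc a u b v) = (P a \<and> Q b \<or> matched P Q u \<or> matched P Q v)"

lemma fhom_matched: "fhom (matched P Q)"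
  by (rule fhomI[where hI = "\<lambda>a r. r" and hC = "\<lambda>a b r r'. P a \<and> Q b \<or> r \<or> r'"])
     (auto intro: finite_subset[of _ UNIV])

lemma matched_amap:
  "(\<And>i a. P (g i a) = p i) \<Longrightarrow> (\<And>i a. Q (g i a) = q i) \<Longrightarrow>
    matched P Q (amap g t) \<longleftrightarrow> (\<exists>(i, j)\<in>nu t. p i \<and> q j)"
proof (induction t arbitrary: g p q)
  case (Itl a t)
  from Itl.IH[of "\<lambda>i. g (Suc i)" "\<lambda>i. p (Suc i)" "\<lambda>i. q (Suc i)"] Itl.prems
  show ?case by (force simp: sh_def)
next
  case (Arc a t b s)
  from Arc.IH(1)[of "\<lambda>i. g (Suc i)" "\<lambda>i. p (Suc i)" "\<lambda>i. q (Suc i)"]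
    Arc.IH(2)[of "\<lambda>i. g (i + len t + 2)" "\<lambda>i. p (i + len t + 2)" "\<lambda>i. q (i + len t + 2)"] Arc.prems
  show ?case by (simp add: sh_def bex_Un case_prod_unfold)
qed simp

text \<open>Subset construction: the state consists of the value with \<open>x\<close> erased and
  the set of values obtained by placing \<open>x\<close> at some position of the subtree.\<close>

lemma stepf_exists_mark:
  assumes "stepf f"
  shows "stepf (\<lambda>u. \<exists>i\<in>{1..len u}. f (mark x i u))"
proof -
  obtain h v where f: "f = (\<lambda>t. v (h t))" and h0: "fhom (h :: ('a \<times> nat set) nt \<Rightarrow> nat)"
    using assms unfolding stepf_def by blast
  obtain hI hC where h: "finite (range h)" "\<And>a t. h (Itl a t) = hI a (h t)"
    "\<And>a b t s. h (Arc a t b s) = hC a b (h t) (h s)"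
    using h0 by (rule fhomE) (rule that; assumption)
  define H where "H u = (h (mark x 0 u), (\<lambda>i. h (mark x i u)) ` {1..len u})" for u
  have "fhom H"
  proof (rule fhomI)
    have "range H \<subseteq> range h \<times> Pow (range h)" by (auto simp: H_def)
    then show "finite (range H)" by (rule finite_subset) (simp add: h)
  next
    fix a u
    have "(\<lambda>i. h (mark x i (Itl a u))) ` {1..len (Itl a u)} =
        insert (hI (mk x True a) (h (mark x 0 u))) ((\<lambda>i. hI (mk x False a) (h (mark x i u))) ` {1..len u})"
    proof -
      have "(\<lambda>i. h (mark x i (Itl a u))) ` {1..len (Itl a u)} =
          insert (h (mark x 1 (Itl a u))) ((\<lambda>i. h (mark x (Suc i) (Itl a u))) ` {1..len u})"
        by (simp only: yield.simps length_Cons pos_Itl image_insert image_image)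
      also have "(\<lambda>i. h (mark x (Suc i) (Itl a u))) ` {1..len u} = (\<lambda>i. hI (mk x False a) (h (mark x i u))) ` {1..len u}"
        by (rule image_cong) (auto simp: mark_Itl h)
      finally show ?thesis by (simp only: One_nat_def mark_Itl(2) h)
    qed
    then show "H (Itl a u) = (\<lambda>(n, N). (hI (mk x False a) n,
        insert (hI (mk x True a) n) (hI (mk x False a) ` N))) (H u)"
      by (simp add: H_def mark_Itl h image_image)
  next
    fix a b u w
    have "(\<lambda>i. h (mark x i (Arc a u b w))) ` {1..len (Arc a u b w)} =
        insert (hC (mk x True a) (mk x False b) (h (mark x 0 u)) (h (mark x 0 w)))
          ((\<lambda>i. hC (mk x False a) (mk x False b) (h (mark x i u)) (h (mark x 0 w))) ` {1..len u}) \<union>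
        insert (hC (mk x False a) (mk x True b) (h (mark x 0 u)) (h (mark x 0 w)))
          ((\<lambda>i. hC (mk x False a) (mk x False b) (h (mark x 0 u)) (h (mark x i w))) ` {1..len w})"
    proof -
      have "(\<lambda>i. h (mark x i (Arc a u b w))) ` {1..len (Arc a u b w)} =
          insert (h (mark x 1 (Arc a u b w))) ((\<lambda>i. h (mark x (Suc i) (Arc a u b w))) ` {1..len u}) \<union>
          insert (h (mark x (len u + 2) (Arc a u b w))) ((\<lambda>i. h (mark x (i + len u + 2) (Arc a u b w))) ` {1..len w})"
        by (simp only: yield.simps length_Cons length_append pos_Arc image_insert image_image image_Un)
      also have "(\<lambda>i. h (mark x (Suc i) (Arc a u b w))) ` {1..len u} =
          (\<lambda>i. hC (mk x False a) (mk x False b) (h (mark x i u)) (h (mark x 0 w))) ` {1..len u}"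
        by (rule image_cong) (auto simp: mark_Arc h)
      also have "(\<lambda>i. h (mark x (i + len u + 2) (Arc a u b w))) ` {1..len w} =
          (\<lambda>i. hC (mk x False a) (mk x False b) (h (mark x 0 u)) (h (mark x i w))) ` {1..len w}"
        by (rule image_cong[OF refl]) (simp only: atLeastAtMost_iff mark_Arc(5) h)
      finally show ?thesis by (simp only: One_nat_def mark_Arc(2,4) h)
    qed
    then show "H (Arc a u b w) = (\<lambda>(n, N) (m, M). (hC (mk x False a) (mk x False b) n m,
        insert (hC (mk x True a) (mk x False b) n m) ((\<lambda>k. hC (mk x False a) (mk x False b) k m) ` N) \<union>
        insert (hC (mk x False a) (mk x True b) n m) (hC (mk x False a) (mk x False b) n ` M))) (H u) (H w)"
      by (simp add: H_def mark_Arc h image_image)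
  qed
  from stepfI[OF this, of "\<lambda>(n, N). \<exists>k\<in>N. v k"] show ?thesis by (simp add: H_def f)
qed

lemma position_pred: "n \<in> {1..m::nat} \<Longrightarrow> \<exists>i<m. n = Suc i"
  by (cases n) auto

text \<open>Connectives combine automata and the quantifier uses \<open>stepf_exists_mark\<close>.
  Assignments are restricted to positions, since the annotation forgets every other value.\<close>

lemma recognizable_msat:
  assumes "fo (p :: 'a mso)"
  shows "\<exists>f. stepf f \<and> (\<forall>t s. (\<forall>x. s x \<in> {1..len t}) \<longrightarrow> msat (yield t, nu t) s p = f (annot t s))"
  using assms
proof (induction p)
  case (MAt a)
  have ex: "(\<exists>l\<in>set (yield (annot t s)). P l) \<longleftrightarrow> (\<exists>i<len t. P (yield t ! i, {x. s x = Suc i}))"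
    for t :: "'a nt" and s P
  proof -
    have "set (yield (annot t s)) = (\<lambda>i. (yield t ! i, {x. s x = Suc i})) ` {..<len t}"
    proof -
      have "set (yield (annot t s)) = (\<lambda>i. yield (annot t s) ! i) ` {..<len t}"
        by (auto simp: set_conv_nth)
      also have "\<dots> = (\<lambda>i. (yield t ! i, {x. s x = Suc i})) ` {..<len t}"
        by (rule image_cong) (auto simp: annot_def nth_yield_amap)
      finally show ?thesis .
    qed
    then show ?thesis by auto
  qed
  show ?case
  proof (cases a)
    case (ALab c x)
    have "msat (yield t, nu t) s (MAt a) = (\<exists>l\<in>set (yield (annot t s)). fst l = c \<and> x \<in> snd l)"
      if r: "\<forall>x. s x \<in> {1..len t}" for t :: "'a nt" and s
    proof -
      obtain i where "s x = Suc i" "i < len t" using position_pred[OF r[rule_format, of x]] by blast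
      then show ?thesis by (auto simp: ALab ex)
    qed
    then show ?thesis using stepfI[OF fhom_exists, of "\<lambda>b. b"] by blast
  next
    case (AEq x y)
    have "msat (yield t, nu t) s (MAt a) = (\<exists>l\<in>set (yield (annot t s)). x \<in> snd l \<and> y \<in> snd l)"
      if r: "\<forall>x. s x \<in> {1..len t}" for t :: "'a nt" and s
    proof -
      obtain i where "s x = Suc i" "i < len t" using position_pred[OF r[rule_format, of x]] by blast
      then show ?thesis by (auto simp: AEq ex)
    qed
    then show ?thesis using stepfI[OF fhom_exists, of "\<lambda>b. b"] by blast
  next
    case (ALeq x y)
    have "msat (yield t, nu t) s (MAt a) = ordered (\<lambda>l. x \<in> snd l) (\<lambda>l. y \<in> snd l) (yield (annot t s))"
      if r: "\<forall>x. s x \<in> {1..len t}" for t :: "'a nt" and s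
    proof -
      obtain i where i: "s x = Suc i" "i < len t" using position_pred[OF r[rule_format, of x]] by blast
      obtain j where j: "s y = Suc j" "j < len t" using position_pred[OF r[rule_format, of y]] by blast
      have e: "z \<in> snd (yield (annot t s) ! k) \<longleftrightarrow> s z = Suc k" if "k < len t" for z k
        using that by (simp add: annot_def nth_yield_amap)
      have "ordered (\<lambda>l. x \<in> snd l) (\<lambda>l. y \<in> snd l) (yield (annot t s)) \<longleftrightarrow>
          (\<exists>i' j'. i' \<le> j' \<and> j' < len t \<and> s x = Suc i' \<and> s y = Suc j')"
        unfolding ordered_nth len_annot using e by (metis le_less_trans)
      also have "\<dots> \<longleftrightarrow> i \<le> j" using i j by auto
      finally show ?thesis using i j by (simp add: ALeq)
    qed
    then show ?thesis using stepf_ordered by blast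
  next
    case (ANu x y)
    have "msat (yield t, nu t) s (MAt a) = matched (\<lambda>l. x \<in> snd l) (\<lambda>l. y \<in> snd l) (annot t s)"
      for t :: "'a nt" and s
      unfolding annot_def by (subst matched_amap[where p = "\<lambda>i. s x = i" and q = "\<lambda>i. s y = i"]) (auto simp: ANu)
    then show ?thesis using stepfI[OF fhom_matched, of "\<lambda>b. b"] by blast
  next
    \<comment> \<open>\<open>msat\<close> interprets every set variable by the empty set, so
      membership is false.\<close>
    case (AIn x X)
    then show ?thesis by (intro exI[of _ "\<lambda>_. False"]) (simp add: stepf_const)
  qed
next
  case (MNeg p)
  then obtain f where "stepf f" "\<forall>t s. (\<forall>x. s x \<in> {1..len t}) \<longrightarrow> msat (yield t, nu t) s p = f (annot t s)"
    by auto
  then show ?case by (intro exI[of _ "\<lambda>t. \<not> f t"]) (auto intro: stepf_app[of f Not])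
next
  case (MOr p q)
  then obtain f g where "stepf f" "\<forall>t s. (\<forall>x. s x \<in> {1..len t}) \<longrightarrow> msat (yield t, nu t) s p = f (annot t s)"
     "stepf g" "\<forall>t s. (\<forall>x. s x \<in> {1..len t}) \<longrightarrow> msat (yield t, nu t) s q = g (annot t s)"
    by auto
  then show ?case by (intro exI[of _ "\<lambda>t. f t \<or> g t"]) (auto intro: stepf_comb[of f g "(\<or>)"])
next
  case (MEx1 x p)
  then obtain f where f: "stepf f" "\<And>t s. (\<forall>x. s x \<in> {1..len t}) \<Longrightarrow> msat (yield t, nu t) s p = f (annot t s)"
    by auto
  show ?case
  proof (intro exI[of _ "\<lambda>u. \<exists>i\<in>{1..len u}. f (mark x i u)"] conjI allI impI stepf_exists_mark f(1))
    fix t :: "'a nt" and s :: "nat \<Rightarrow> nat" assume "\<forall>x. s x \<in> {1..len t}"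
    then have "msat (yield t, nu t) (s(x := i)) p = f (mark x i (annot t s))" if "i \<in> {1..len t}" for i
      using that by (subst f(2)) (auto simp: annot_upd)
    then show "msat (yield t, nu t) s (MEx1 x p) = (\<exists>i\<in>{1..len (annot t s)}. f (mark x i (annot t s)))"
      by simp
  qed
qed simp

lemma pm_aUMSO: "pm b p \<in> aUMSO"
  by (rule aUMSO.su) (unfold synt_unamb_def, blast)

text \<open>Step functions are closed under pointwise sums and products. Hence such a formula takes
  only finitely many values, which the universal quantifier will rely on.\<close>

lemma recognizable_aUMSO:
  fixes p :: "('a, 'k::comm_semiring_1) wf"
  assumes "p \<in> aUMSO" "no_so_quant p"
  shows "\<exists>f. stepf f \<and> (\<forall>t s. (\<forall>x. s x \<in> {1..len t}) \<longrightarrow>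
    wsem (yield t, nu t) s (\<lambda>_. {}) p = f (annot t s))"
  using assms
proof induction
  case (const k)
  show ?case by (intro exI[of _ "\<lambda>_. k"]) (simp add: stepf_const)
next
  case (su p)
  then obtain b q where p: "p = pm b q" by (auto simp: synt_unamb_def)
  with su have "fo q" by (simp add: no_so_pm)
  then obtain f where f: "stepf f" "\<And>t s. (\<forall>x. s x \<in> {1..len t}) \<Longrightarrow> msat (yield t, nu t) s q = f (annot t s)"
    using recognizable_msat[OF \<open>fo q\<close>] by auto
  show ?case
    by (intro exI[of _ "\<lambda>t. if f t = b then 1 else 0"] conjI)
       (auto simp: p wsem_pm[OF \<open>fo q\<close>] f intro: stepf_app[OF f(1), of "\<lambda>x. if x = b then 1 else 0"])
next
  case (conj p q)
  then obtain f g where 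
    "stepf f" "\<forall>t s. (\<forall>x. s x \<in> {1..len t}) \<longrightarrow> wsem (yield t, nu t) s (\<lambda>_. {}) p = f (annot t s)"
    "stepf g" "\<forall>t s. (\<forall>x. s x \<in> {1..len t}) \<longrightarrow> wsem (yield t, nu t) s (\<lambda>_. {}) q = g (annot t s)"
    by auto
  then show ?case by (intro exI[of _ "\<lambda>t. f t * g t"]) (auto intro: stepf_comb[of f g "(*)"])
next
  case (disj p q)
  then obtain f g where 
    "stepf f" "\<forall>t s. (\<forall>x. s x \<in> {1..len t}) \<longrightarrow> wsem (yield t, nu t) s (\<lambda>_. {}) p = f (annot t s)"
    "stepf g" "\<forall>t s. (\<forall>x. s x \<in> {1..len t}) \<longrightarrow> wsem (yield t, nu t) s (\<lambda>_. {}) q = g (annot t s)"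
    by auto
  then show ?case by (intro exI[of _ "\<lambda>t. f t + g t"]) (auto intro: stepf_comb[of f g "(+)"])
qed

subsection \<open>Closure properties of representable tree series\<close>

lemma sum_single:
  assumes "finite J" "j \<in> J" "\<And>i. i \<in> J \<Longrightarrow> i \<noteq> j \<Longrightarrow> g i = 0"
  shows "sum g J = (g j :: 'k::comm_monoid_add)"
  using assms sum.mono_neutral_right[of J "{j}" g] by auto

text \<open>The indicator functions of the states form the finite family, and \<open>f\<close> is
  their combination with coefficients \<open>v\<close>.\<close>

lemma stepf_imp_representable:
  fixes f :: "'b nt \<Rightarrow> 'k::comm_semiring_1"
  assumes "stepf f"
  shows "representable f"
proof -
  obtain h v where f: "f = (\<lambda>t. v (h t))" and h0: "fhom (h :: 'b nt \<Rightarrow> nat)"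
    using assms unfolding stepf_def by blast
  obtain hI hC where h: "finite (range h)" "\<And>a t. h (Itl a t) = hI a (h t)"
    "\<And>a b t s. h (Arc a t b s) = hC a b (h t) (h s)"
    using h0 by (rule fhomE) (rule that; assumption)
  have "representable (\<lambda>t. \<Sum>n\<in>range h. v n * (if h t = n then 1 else 0))"
  proof (rule representable_lincomb[OF h(1), where cI = "\<lambda>n a m. if hI a m = n then 1 else 0"
        and cC = "\<lambda>n a b m m'. if hC a b m m' = n then 1 else 0"])
    fix n a t
    show "(if h (Itl a t) = n then 1 else 0) =
      (\<Sum>m\<in>range h. (if hI a m = n then 1 else 0) * (if h t = m then 1 else (0 :: 'k)))"
      by (subst sum_single[OF h(1), of "h t"]) (auto simp: h)
  next
    fix n a t b s
    show "(if h (Arc a t b s) = n then 1 else 0) =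
      (\<Sum>m\<in>range h. \<Sum>m'\<in>range h. (if hC a b m m' = n then 1 else 0) * (if h t = m then 1 else 0)
        * (if h s = m' then 1 else (0 :: 'k)))"
      by (subst sum_single[OF h(1), of "h t"], simp, simp, subst sum_single[OF h(1), of "h s"]) (auto simp: h)
  qed
  moreover have "(\<Sum>n\<in>range h. v n * (if h t = n then 1 else 0)) = f t" for t
    by (subst sum_single[OF h(1), of "h t"]) (auto simp: f)
  ultimately show ?thesis by simp
qed

lemma representable_add:
  fixes f g :: "'b nt \<Rightarrow> 'k::comm_semiring_1"
  assumes "representable f" "representable g"
  shows "representable (\<lambda>t. f t + g t)"
proof -
  obtain F cI cC where F: "finite F" "f \<in> F"
    and FI: "\<And>g a t. g \<in> F \<Longrightarrow> g (Itl a t) = (\<Sum>h\<in>F. cI g a h * h t)"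
    and FC: "\<And>g a t b s. g \<in> F \<Longrightarrow> g (Arc a t b s) = (\<Sum>h\<in>F. \<Sum>h'\<in>F. cC g a b h h' * h t * h' s)"
    using assms(1) by (rule representableE) (rule that; assumption)
  obtain G dI dC where G: "finite G" "g \<in> G"
    and GI: "\<And>g a t. g \<in> G \<Longrightarrow> g (Itl a t) = (\<Sum>h\<in>G. dI g a h * h t)"
    and GC: "\<And>g a t b s. g \<in> G \<Longrightarrow> g (Arc a t b s) = (\<Sum>h\<in>G. \<Sum>h'\<in>G. dC g a b h h' * h t * h' s)"
    using assms(2) by (rule representableE) (rule that; assumption)
  have S: "(\<Sum>x\<in>F <+> G. H x) = (\<Sum>x\<in>F. H (Inl x)) + (\<Sum>x\<in>G. H (Inr x))" for H :: "_ \<Rightarrow> 'k"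
    by (subst sum.Plus[OF F(1) G(1)]) (simp add: o_def)
  have "representable (\<lambda>t. \<Sum>j\<in>F <+> G. (if j = Inl f \<or> j = Inr g then 1 else 0) * case_sum (\<lambda>h. h) (\<lambda>h. h) j t)"
  proof (rule representable_lincomb[where
        cI = "\<lambda>j a i. case (j, i) of (Inl x, Inl y) \<Rightarrow> cI x a y | (Inr x, Inr y) \<Rightarrow> dI x a y | _ \<Rightarrow> 0"
        and cC = "\<lambda>j a b i k. case (j, i, k) of (Inl x, Inl y, Inl z) \<Rightarrow> cC x a b y z
          | (Inr x, Inr y, Inr z) \<Rightarrow> dC x a b y z | _ \<Rightarrow> 0"])
  qed (use F G in \<open>auto simp: S FI GI FC GC\<close>)
  then show ?thesis unfolding S using F G by (simp add: if_distrib[of "\<lambda>x. x * _"] cong: if_cong)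
qed

text \<open>Tensor product of two representations; commutativity brings the product of two bilinear
  expressions into bilinear form.\<close>

lemma representable_mult:
  fixes f g :: "'b nt \<Rightarrow> 'k::comm_semiring_1"
  assumes "representable f" "representable g"
  shows "representable (\<lambda>t. f t * g t)"
proof -
  obtain F cI cC where F: "finite F" "f \<in> F"
    and FI: "\<And>g a t. g \<in> F \<Longrightarrow> g (Itl a t) = (\<Sum>h\<in>F. cI g a h * h t)"
    and FC: "\<And>g a t b s. g \<in> F \<Longrightarrow> g (Arc a t b s) = (\<Sum>h\<in>F. \<Sum>h'\<in>F. cC g a b h h' * h t * h' s)"
    using assms(1) by (rule representableE) (rule that; assumption)
  obtain G dI dC where G: "finite G" "g \<in> G"
    and GI: "\<And>g a t. g \<in> G \<Longrightarrow> g (Itl a t) = (\<Sum>h\<in>G. dI g a h * h t)"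
    and GC: "\<And>g a t b s. g \<in> G \<Longrightarrow> g (Arc a t b s) = (\<Sum>h\<in>G. \<Sum>h'\<in>G. dC g a b h h' * h t * h' s)"
    using assms(2) by (rule representableE) (rule that; assumption)
  have S: "(\<Sum>x\<in>F \<times> G. H x) = (\<Sum>x\<in>F. \<Sum>y\<in>G. H (x, y))" for H :: "_ \<Rightarrow> 'k"
    by (simp add: sum.cartesian_product)
  have "representable ((\<lambda>(x, y) t. x t * y t) (f, g))"
  proof (rule representableI[of "F \<times> G" "(f, g)" "\<lambda>(x, y) t. x t * y t"
        "\<lambda>(x, y) a (x', y'). cI x a x' * dI y a y'"
        "\<lambda>(x, y) a b (x', y') (x'', y''). cC x a b x' x'' * dC y a b y' y''"])
    fix j a t assume "j \<in> F \<times> G"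
    then show "(\<lambda>(x, y) t. x t * y t) j (Itl a t) = (\<Sum>i\<in>F \<times> G.
        (\<lambda>(x, y) a (x', y'). cI x a x' * dI y a y') j a i * (\<lambda>(x, y) t. x t * y t) i t)"
      unfolding S by (auto simp: FI GI sum_product mult_ac intro!: sum.cong)
  next
    fix j a t b s assume "j \<in> F \<times> G"
    then obtain x y where j: "j = (x, y)" "x \<in> F" "y \<in> G" by auto
    have "x (Arc a t b s) * y (Arc a t b s) = (\<Sum>x'\<in>F. \<Sum>y'\<in>G. \<Sum>x''\<in>F. \<Sum>y''\<in>G.
        (cC x a b x' x'' * x' t * x'' s) * (dC y a b y' y'' * y' t * y'' s))"
      unfolding FC[OF j(2)] GC[OF j(3)] by (simp only: sum_product)
    then show "(\<lambda>(x, y) t. x t * y t) j (Arc a t b s) = (\<Sum>i\<in>F \<times> G. \<Sum>k\<in>F \<times> G.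
        (\<lambda>(x, y) a b (x', y') (x'', y''). cC x a b x' x'' * dC y a b y' y'') j a b i k *
          (\<lambda>(x, y) t. x t * y t) i t * (\<lambda>(x, y) t. x t * y t) k s)"
      unfolding S by (simp add: j mult_ac)
  qed (use F G in auto)
  then show ?thesis by simp
qed

text \<open>The flag says whether the marked position lies in the subtree. A flagged arc has it at
  the call, at the return, in the inside or in the rest, never in two of these; an unflagged one
  erases \<open>x\<close> in both subtrees.\<close>

lemma representable_sum_mark:
  fixes f :: "('a \<times> nat set) nt \<Rightarrow> 'k::comm_semiring_1"
  assumes "representable f"
  shows "representable (\<lambda>u. \<Sum>i\<in>{1..len u}. f (mark x i u))"
proof -
  obtain F cI cC where F: "finite F" "f \<in> F"
    and I: "\<And>g a t. g \<in> F \<Longrightarrow> g (Itl a t) = (\<Sum>h\<in>F. cI g a h * h t)"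
    and C: "\<And>g a t b s. g \<in> F \<Longrightarrow> g (Arc a t b s) = (\<Sum>h\<in>F. \<Sum>h'\<in>F. cC g a b h h' * h t * h' s)"
    using assms by (rule representableE) (rule that; assumption)
  define \<mu> :: "(('a \<times> nat set) nt \<Rightarrow> 'k) \<times> bool \<Rightarrow> ('a \<times> nat set) nt \<Rightarrow> 'k"
    where "\<mu> = (\<lambda>(g, m) u. if m then \<Sum>i\<in>{1..len u}. g (mark x i u) else g (mark x 0 u))"
  have \<mu>: "\<mu> (g, False) u = g (mark x 0 u)" "\<mu> (g, True) u = (\<Sum>i\<in>{1..len u}. g (mark x i u))" for g u
    by (simp_all add: \<mu>_def)
  have S: "(\<Sum>j\<in>F \<times> UNIV. H j) = (\<Sum>h\<in>F. H (h, False)) + (\<Sum>h\<in>F. H (h, True))" for H :: "_ \<times> bool \<Rightarrow> 'k"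
    by (simp add: sum.cartesian_product[symmetric, of "\<lambda>a b. H (a, b)", simplified] UNIV_bool sum.distrib)
  let ?m = "mk x"
  have "representable (\<mu> (f, True))"
  proof (rule representableI[of "F \<times> UNIV" "(f, True)" \<mu>
        "\<lambda>(g, m) a (h, m'). if m' then (if m then cI g (?m False a) h else 0) else cI g (?m m a) h"
        "\<lambda>(g, m) a b (h, n) (h', n'). if n \<and> n' then 0
          else if n \<or> n' then (if m then cC g (?m False a) (?m False b) h h' else 0)
          else if m then cC g (?m True a) (?m False b) h h' + cC g (?m False a) (?m True b) h h'
          else cC g (?m False a) (?m False b) h h'"])
    fix j a u assume "j \<in> F \<times> (UNIV :: bool set)"
    then obtain g m where j: "j = (g, m)" "g \<in> F" by auto
    have "\<mu> (g, True) (Itl a u) = g (mark x 1 (Itl a u)) + (\<Sum>i\<in>{1..len u}. g (mark x (Suc i) (Itl a u)))"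
      by (simp only: \<mu> yield.simps length_Cons sum.positions_Itl)
    also have "(\<Sum>i\<in>{1..len u}. g (mark x (Suc i) (Itl a u))) =
        (\<Sum>h\<in>F. cI g (?m False a) h * (\<Sum>i\<in>{1..len u}. h (mark x i u)))"
      unfolding sum_distrib_left by (subst sum.swap) (auto intro!: sum.cong simp: mark_Itl I[OF j(2)])
    finally show "\<mu> j (Itl a u) = (\<Sum>i\<in>F \<times> UNIV.
        (\<lambda>(g, m) a (h, m'). if m' then (if m then cI g (?m False a) h else 0) else cI g (?m m a) h) j a i * \<mu> i u)"
      unfolding S by (cases m) (simp_all add: j(1) \<mu> mark_Itl I[OF j(2)])
  next
    fix j a u b v assume "j \<in> F \<times> (UNIV :: bool set)"
    then obtain g m where j: "j = (g, m)" "g \<in> F" by auto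
    let ?c = "\<lambda>m m' h h'. cC g (?m m a) (?m m' b) h h'"
    have "\<mu> (g, True) (Arc a u b v) = (g (mark x 1 (Arc a u b v)) + (\<Sum>i\<in>{1..len u}. g (mark x (Suc i) (Arc a u b v))))
       + (g (mark x (len u + 2) (Arc a u b v)) + (\<Sum>i\<in>{1..len v}. g (mark x (i + len u + 2) (Arc a u b v))))"
      by (simp only: \<mu> yield.simps length_Cons length_append sum.positions_Arc)
    also have "(\<Sum>i\<in>{1..len u}. g (mark x (Suc i) (Arc a u b v))) =
        (\<Sum>i\<in>{1..len u}. \<Sum>h\<in>F. \<Sum>h'\<in>F. ?c False False h h' * h (mark x i u) * h' (mark x 0 v))"
      by (intro sum.cong refl) (simp add: mark_Arc C[OF j(2)])
    also have "\<dots> = (\<Sum>h\<in>F. \<Sum>h'\<in>F. ?c False False h h' * \<mu> (h, True) u * \<mu> (h', False) v)"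
      unfolding \<mu> sum_distrib_left sum_distrib_right
      by (subst sum.swap) (intro sum.cong refl sum.swap)
    also have "(\<Sum>i\<in>{1..len v}. g (mark x (i + len u + 2) (Arc a u b v))) =
        (\<Sum>i\<in>{1..len v}. \<Sum>h\<in>F. \<Sum>h'\<in>F. ?c False False h h' * h (mark x 0 u) * h' (mark x i v))"
      by (intro sum.cong refl) (simp only: atLeastAtMost_iff mark_Arc(5) C[OF j(2)])
    also have "\<dots> = (\<Sum>h\<in>F. \<Sum>h'\<in>F. ?c False False h h' * \<mu> (h, False) u * \<mu> (h', True) v)"
      unfolding \<mu> sum_distrib_left sum_distrib_right
      by (subst sum.swap) (intro sum.cong refl sum.swap)
    also have "g (mark x 1 (Arc a u b v)) = (\<Sum>h\<in>F. \<Sum>h'\<in>F. ?c True False h h' * \<mu> (h, False) u * \<mu> (h', False) v)"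
      by (simp add: mark_Arc C[OF j(2)] \<mu>)
    also have "g (mark x (len u + 2) (Arc a u b v)) = (\<Sum>h\<in>F. \<Sum>h'\<in>F. ?c False True h h' * \<mu> (h, False) u * \<mu> (h', False) v)"
      unfolding mark_Arc(4) by (simp add: C[OF j(2)] \<mu>)
    finally have T: "\<mu> (g, True) (Arc a u b v) =
        (\<Sum>h\<in>F. \<Sum>h'\<in>F. (?c True False h h' + ?c False True h h') * \<mu> (h, False) u * \<mu> (h', False) v)
        + (\<Sum>h\<in>F. \<Sum>h'\<in>F. ?c False False h h' * \<mu> (h, True) u * \<mu> (h', False) v)
        + (\<Sum>h\<in>F. \<Sum>h'\<in>F. ?c False False h h' * \<mu> (h, False) u * \<mu> (h', True) v)"
      by (simp add: distrib_right sum.distrib add_ac)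
    have N: "\<mu> (g, False) (Arc a u b v) = (\<Sum>h\<in>F. \<Sum>h'\<in>F. ?c False False h h' * \<mu> (h, False) u * \<mu> (h', False) v)"
      by (simp add: mark_Arc C[OF j(2)] \<mu>)
    show "\<mu> j (Arc a u b v) = (\<Sum>i\<in>F \<times> UNIV. \<Sum>k\<in>F \<times> UNIV.
        (\<lambda>(g, m) a b (h, n) (h', n'). if n \<and> n' then 0
          else if n \<or> n' then (if m then cC g (?m False a) (?m False b) h h' else 0)
          else if m then cC g (?m True a) (?m False b) h h' + cC g (?m False a) (?m True b) h h'
          else cC g (?m False a) (?m False b) h h') j a b i k * \<mu> i u * \<mu> k v)"
      unfolding S by (cases m) (simp_all add: j(1) T N sum.distrib add_ac)
  qed (use F in auto)
  then show ?thesis by (simp add: \<mu>[abs_def])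
qed

text \<open>A product over all positions is evaluated bottom-up by carrying the map \<open>\<tau>\<close> that the
  context of the current subtree induces on the values of \<open>h\<close>, together with the unmarked value.\<close>

lemma representable_prod_mark:
  fixes f :: "('a \<times> nat set) nt \<Rightarrow> 'k::comm_semiring_1"
  assumes "stepf f"
  shows "representable (\<lambda>u. \<Prod>i\<in>{1..len u}. f (mark x i u))"
proof -
  obtain h v where f: "f = (\<lambda>t. v (h t))" and h0: "fhom (h :: ('a \<times> nat set) nt \<Rightarrow> nat)"
    using assms unfolding stepf_def by blast
  obtain hI hC where h: "finite (range h)" "\<And>a t. h (Itl a t) = hI a (h t)"
    "\<And>a b t s. h (Arc a t b s) = hC a b (h t) (h s)"
    using h0 by (rule fhomE) (rule that; assumption)
  \<comment> \<open>Maps are set to 0 off \<open>range h\<close>; otherwise infinitely many of them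
    would agree where it matters.\<close>
  define T where "T = {\<tau>. \<forall>n. (n \<in> range h \<longrightarrow> \<tau> n \<in> range h) \<and> (n \<notin> range h \<longrightarrow> \<tau> n = 0)}"
  define res where "res \<tau> n = (if n \<in> range h then \<tau> n else 0)" for \<tau> :: "nat \<Rightarrow> nat" and n
  have finT: "finite T" unfolding T_def by (rule finite_set_of_finite_funs) (rule h)+
  have res: "res \<tau> (h t) = \<tau> (h t)" for \<tau> t by (simp add: res_def)
  have resT: "res \<tau> \<in> T" if "\<And>t. \<tau> (h t) \<in> range h" for \<tau>
    using that by (auto simp: T_def res_def)
  have T: "\<tau> (h t) \<in> range h" if "\<tau> \<in> T" for \<tau> t using that by (auto simp: T_def)
  let ?J = "T \<times> range h"
  have J: "finite ?J" using finT h by simp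
  let ?m = "mk x False" and ?m1 = "mk x True"
  \<comment> \<open>\<open>n\<close> is a guess of the unmarked value; the component vanishes on
    trees with another value.\<close>
  define \<mu> where "\<mu> = (\<lambda>(\<tau>, n) u. if h (mark x 0 u) = n then \<Prod>i\<in>{1..len u}. v (\<tau> (h (mark x i u))) else 0)"
  define \<tau>I where "\<tau>I \<tau> a = res (\<lambda>m. \<tau> (hI (?m a) m))" for \<tau> a
  define \<tau>l where "\<tau>l \<tau> a b k = res (\<lambda>m. \<tau> (hC (?m a) (?m b) m k))" for \<tau> a b k
  define \<tau>r where "\<tau>r \<tau> a b k = res (\<lambda>m. \<tau> (hC (?m a) (?m b) k m))" for \<tau> a b k
  have \<tau>I: "\<tau>I \<tau> a \<in> T" if "\<tau> \<in> T" for \<tau> a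
    unfolding \<tau>I_def by (rule resT) (simp only: h(2)[symmetric] T[OF that])
  have \<tau>l: "\<tau>l \<tau> a b (h s) \<in> T" if "\<tau> \<in> T" for \<tau> a b s
    unfolding \<tau>l_def by (rule resT) (simp only: h(3)[symmetric] T[OF that])
  have \<tau>r: "\<tau>r \<tau> a b (h s) \<in> T" if "\<tau> \<in> T" for \<tau> a b s
    unfolding \<tau>r_def by (rule resT) (simp only: h(3)[symmetric] T[OF that])
  \<comment> \<open>At the root the context is the identity and all guesses are summed. At an arc
    the context of each subtree depends on the unmarked value of the other one, which is why these
    values belong to the index.\<close>
  have "representable (\<lambda>u. \<Sum>j\<in>?J. (if fst j = res (\<lambda>n. n) then 1 else 0) * \<mu> j u)"
  proof (rule representable_lincomb[OF J, where
        cI = "\<lambda>(\<tau>, n) a (\<sigma>, m). if \<sigma> = \<tau>I \<tau> a \<and> hI (?m a) m = n then v (\<tau> (hI (?m1 a) m)) else 0"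
        and cC = "\<lambda>(\<tau>, n) a b (\<sigma>, m) (\<sigma>', m'). if \<sigma> = \<tau>l \<tau> a b m' \<and> \<sigma>' = \<tau>r \<tau> a b m \<and> hC (?m a) (?m b) m m' = n
          then v (\<tau> (hC (?m1 a) (?m b) m m')) * v (\<tau> (hC (?m a) (?m1 b) m m')) else 0"])
    fix j a u assume "j \<in> ?J"
    then obtain \<tau> n where j: "j = (\<tau>, n)" "\<tau> \<in> T" by auto
    have "(\<Prod>i\<in>{1..len (Itl a u)}. v (\<tau> (h (mark x i (Itl a u))))) =
        v (\<tau> (h (mark x 1 (Itl a u)))) * (\<Prod>i\<in>{1..len u}. v (\<tau> (h (mark x (Suc i) (Itl a u)))))"
      by (simp only: yield.simps length_Cons prod.positions_Itl)
    also have "\<dots> = v (\<tau> (hI (?m1 a) (h (mark x 0 u)))) * (\<Prod>i\<in>{1..len u}. v (\<tau>I \<tau> a (h (mark x i u))))"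
      by (auto simp: mark_Itl h \<tau>I_def res intro!: prod.cong arg_cong2[of _ _ _ _ times])
    finally have P: "\<mu> j (Itl a u) = (if hI (?m a) (h (mark x 0 u)) = n then v (\<tau> (hI (?m1 a) (h (mark x 0 u)))) *
        (\<Prod>i\<in>{1..len u}. v (\<tau>I \<tau> a (h (mark x i u)))) else 0)"
      by (simp add: \<mu>_def j mark_Itl h)
    show "\<mu> j (Itl a u) = (\<Sum>i\<in>?J. 
        (\<lambda>(\<tau>, n) a (\<sigma>, m). if \<sigma> = \<tau>I \<tau> a \<and> hI (?m a) m = n then v (\<tau> (hI (?m1 a) m)) else 0) j a i * \<mu> i u)"
      unfolding P by (subst sum_single[OF J, of "(\<tau>I \<tau> a, h (mark x 0 u))"])
        (auto simp: j \<mu>_def \<tau>I split: if_splits)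
  next
    fix j a u b w assume "j \<in> ?J"
    then obtain \<tau> n where j: "j = (\<tau>, n)" "\<tau> \<in> T" by auto
    let ?k = "h (mark x 0 u)" and ?l = "h (mark x 0 w)"
    have "(\<Prod>i\<in>{1..len (Arc a u b w)}. v (\<tau> (h (mark x i (Arc a u b w))))) =
        (v (\<tau> (h (mark x 1 (Arc a u b w)))) * (\<Prod>i\<in>{1..len u}. v (\<tau> (h (mark x (Suc i) (Arc a u b w)))))) *
        (v (\<tau> (h (mark x (len u + 2) (Arc a u b w)))) *
          (\<Prod>i\<in>{1..len w}. v (\<tau> (h (mark x (i + len u + 2) (Arc a u b w))))))"
      by (simp only: yield.simps length_Cons length_append prod.positions_Arc)
    also have "(\<Prod>i\<in>{1..len u}. v (\<tau> (h (mark x (Suc i) (Arc a u b w))))) =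
        (\<Prod>i\<in>{1..len u}. v (\<tau>l \<tau> a b ?l (h (mark x i u))))"
      by (intro prod.cong refl) (simp add: mark_Arc h \<tau>l_def res)
    also have "(\<Prod>i\<in>{1..len w}. v (\<tau> (h (mark x (i + len u + 2) (Arc a u b w))))) =
        (\<Prod>i\<in>{1..len w}. v (\<tau>r \<tau> a b ?k (h (mark x i w))))"
      by (intro prod.cong refl) (simp only: atLeastAtMost_iff mark_Arc(5) h \<tau>r_def res)
    finally have P: "\<mu> j (Arc a u b w) = (if hC (?m a) (?m b) ?k ?l = n then 
        (v (\<tau> (hC (?m1 a) (?m b) ?k ?l)) * v (\<tau> (hC (?m a) (?m1 b) ?k ?l))) *
        (\<Prod>i\<in>{1..len u}. v (\<tau>l \<tau> a b ?l (h (mark x i u)))) * (\<Prod>i\<in>{1..len w}. v (\<tau>r \<tau> a b ?k (h (mark x i w)))) else 0)"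
      unfolding \<mu>_def j One_nat_def mark_Arc(2,4) by (simp add: mark_Arc(1) h mult_ac)
    show "\<mu> j (Arc a u b w) = (\<Sum>i\<in>?J. \<Sum>k\<in>?J.
        (\<lambda>(\<tau>, n) a b (\<sigma>, m) (\<sigma>', m'). if \<sigma> = \<tau>l \<tau> a b m' \<and> \<sigma>' = \<tau>r \<tau> a b m \<and> hC (?m a) (?m b) m m' = n
          then v (\<tau> (hC (?m1 a) (?m b) m m')) * v (\<tau> (hC (?m a) (?m1 b) m m')) else 0) j a b i k * \<mu> i u * \<mu> k w)"
      unfolding P
      by (subst sum_single[OF J, of "(\<tau>l \<tau> a b ?l, ?k)"], simp add: \<tau>l j, force simp: \<mu>_def j intro!: sum.neutral,
          subst sum_single[OF J, of "(\<tau>r \<tau> a b ?k, ?l)"])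
        (auto simp: j \<mu>_def \<tau>r split: if_splits)
  qed
  moreover have "(\<Sum>j\<in>?J. (if fst j = res (\<lambda>n. n) then 1 else 0) * \<mu> j u) = (\<Prod>i\<in>{1..len u}. f (mark x i u))" for u
    by (subst sum_single[OF J, of "(res (\<lambda>n. n), h (mark x 0 u))"])
       (auto simp: \<mu>_def res f intro: resT split: if_splits)
  ultimately show ?thesis by simp
qed

text \<open>All variables sit at position 1, so the first letter alone carries \<open>UNIV\<close>.
  The flag tells whether the beginning of a subtree is that of the whole tree.\<close>

lemma representable_annot_const:
  fixes f :: "('a \<times> nat set) nt \<Rightarrow> 'k::comm_semiring_1"
  assumes "representable f"
  shows "representable (\<lambda>t. f (annot t (\<lambda>_. 1)))"
proof -
  obtain F cI cC where F: "finite F" "f \<in> F"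
    and I: "\<And>g a t. g \<in> F \<Longrightarrow> g (Itl a t) = (\<Sum>h\<in>F. cI g a h * h t)"
    and C: "\<And>g a t b s. g \<in> F \<Longrightarrow> g (Arc a t b s) = (\<Sum>h\<in>F. \<Sum>h'\<in>F. cC g a b h h' * h t * h' s)"
    using assms by (rule representableE) (rule that; assumption)
  define N where "N = amap (\<lambda>_ (a :: 'a). (a, {} :: nat set))"
  have N: "N (Itl a t) = Itl (a, {}) (N t)" "N (Arc a t b s) = Arc (a, {}) (N t) (b, {}) (N s)" for a b t s
    by (simp_all add: N_def)
  have A: "annot (Itl a t) (\<lambda>_. 1) = Itl (a, UNIV) (N t)"
    "annot (Arc a t b s) (\<lambda>_. 1) = Arc (a, UNIV) (N t) (b, {}) (N s)" for a b t s
    unfolding annot_def N_def by (auto intro!: amap_cong)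
  define \<mu> where "\<mu> = (\<lambda>(g, m) t. g (if m then annot t (\<lambda>_. 1) else N t) :: 'k)"
  have \<mu>: "\<mu> (g, False) t = g (N t)" "\<mu> (g, True) t = g (annot t (\<lambda>_. 1))" for g t by (simp_all add: \<mu>_def)
  have S: "(\<Sum>j\<in>F \<times> UNIV. H j) = (\<Sum>h\<in>F. H (h, False)) + (\<Sum>h\<in>F. H (h, True))" for H :: "_ \<times> bool \<Rightarrow> 'k"
    by (simp add: sum.cartesian_product[symmetric, of "\<lambda>a b. H (a, b)", simplified] UNIV_bool sum.distrib)
  have "representable (\<mu> (f, True))"
    by (rule representableI[of "F \<times> UNIV" "(f, True)" \<mu>
        "\<lambda>(g, m) a (h, m'). if m' then 0 else cI g (a, if m then UNIV else {}) h"
        "\<lambda>(g, m) a b (h, n) (h', n'). if n \<or> n' then 0 else cC g (a, if m then UNIV else {}) (b, {}) h h'"])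
       (use F in \<open>auto simp: S \<mu> N A[unfolded One_nat_def] I C\<close>)
  then show ?thesis by (simp add: \<mu>[abs_def])
qed

section \<open>From logic to algebraic series\<close>

lemma aUMSO_representable:
  fixes p :: "('a, 'k::comm_semiring_1) wf"
  assumes "p \<in> aUMSO" "no_so_quant p"
  shows "\<exists>f. representable f \<and> (\<forall>t s. (\<forall>x. s x \<in> {1..len t}) \<longrightarrow>
    wsem (yield t, nu t) s (\<lambda>_. {}) p = f (annot t s))"
  using recognizable_aUMSO[OF assms] by (elim exE conjE) (intro exI conjI stepf_imp_representable; assumption)

text \<open>Representability survives sums, products and sums over positions. Products over
  positions do not preserve it in general; there the restriction of \<open>sRFO\<close> supplies a
  step function as the body.\<close>

lemma wsem_imp_representable:
  fixes p :: "('a, 'k::comm_semiring_1) wf"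
  assumes "no_so_quant p" "\<And>x q. WAll1 x q \<in> subformulas p \<Longrightarrow> q \<in> aUMSO"
  shows "\<exists>f. representable f \<and> (\<forall>t s. (\<forall>x. s x \<in> {1..len t}) \<longrightarrow>
    wsem (yield t, nu t) s (\<lambda>_. {}) p = f (annot t s))"
  using assms
proof (induction p)
  case (WConst k)
  show ?case by (rule aUMSO_representable) (simp_all add: aUMSO.const)
next
  case (WAt a)
  have "WAt a \<in> (aUMSO :: ('a, 'k) wf set)" using pm_aUMSO[of True "MAt a"] by simp
  then show ?case by (rule aUMSO_representable) simp
next
  case (WNAt a)
  have "WNAt a \<in> (aUMSO :: ('a, 'k) wf set)" using pm_aUMSO[of False "MAt a"] by simp
  then show ?case by (rule aUMSO_representable) simp
next
  case (WOr p q)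
  have "\<exists>f. representable f \<and> (\<forall>t s. (\<forall>x. s x \<in> {1..len t}) \<longrightarrow> wsem (yield t, nu t) s (\<lambda>_. {}) p = f (annot t s))"
    by (rule WOr.IH(1)) (use WOr.prems in auto)
  moreover have "\<exists>f. representable f \<and> (\<forall>t s. (\<forall>x. s x \<in> {1..len t}) \<longrightarrow> wsem (yield t, nu t) s (\<lambda>_. {}) q = f (annot t s))"
    by (rule WOr.IH(2)) (use WOr.prems in auto)
  ultimately obtain f g where 
    "representable f" "\<forall>t s. (\<forall>x. s x \<in> {1..len t}) \<longrightarrow> wsem (yield t, nu t) s (\<lambda>_. {}) p = f (annot t s)"
    "representable g" "\<forall>t s. (\<forall>x. s x \<in> {1..len t}) \<longrightarrow> wsem (yield t, nu t) s (\<lambda>_. {}) q = g (annot t s)"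
    by auto
  then show ?case by (intro exI[of _ "\<lambda>t. f t + g t"]) (auto intro: representable_add)
next
  case (WAnd p q)
  have "\<exists>f. representable f \<and> (\<forall>t s. (\<forall>x. s x \<in> {1..len t}) \<longrightarrow> wsem (yield t, nu t) s (\<lambda>_. {}) p = f (annot t s))"
    by (rule WAnd.IH(1)) (use WAnd.prems in auto)
  moreover have "\<exists>f. representable f \<and> (\<forall>t s. (\<forall>x. s x \<in> {1..len t}) \<longrightarrow> wsem (yield t, nu t) s (\<lambda>_. {}) q = f (annot t s))"
    by (rule WAnd.IH(2)) (use WAnd.prems in auto)
  ultimately obtain f g where 
    "representable f" "\<forall>t s. (\<forall>x. s x \<in> {1..len t}) \<longrightarrow> wsem (yield t, nu t) s (\<lambda>_. {}) p = f (annot t s)"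
    "representable g" "\<forall>t s. (\<forall>x. s x \<in> {1..len t}) \<longrightarrow> wsem (yield t, nu t) s (\<lambda>_. {}) q = g (annot t s)"
    by auto
  then show ?case by (intro exI[of _ "\<lambda>t. f t * g t"]) (auto intro: representable_mult)
next
  case (WEx1 x p)
  have "\<exists>f. representable f \<and> (\<forall>t s. (\<forall>x. s x \<in> {1..len t}) \<longrightarrow> wsem (yield t, nu t) s (\<lambda>_. {}) p = f (annot t s))"
    by (rule WEx1.IH) (use WEx1.prems in auto)
  then obtain f where f: "representable f" "\<And>t s. (\<forall>x. s x \<in> {1..len t}) \<Longrightarrow> wsem (yield t, nu t) s (\<lambda>_. {}) p = f (annot t s)"
    by auto
  show ?case
  proof (intro exI[of _ "\<lambda>u. \<Sum>i\<in>{1..len u}. f (mark x i u)"] conjI allI impI representable_sum_mark f(1))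
    fix t :: "'a nt" and s :: "nat \<Rightarrow> nat" assume "\<forall>x. s x \<in> {1..len t}"
    then have "wsem (yield t, nu t) (s(x := i)) (\<lambda>_. {}) p = f (mark x i (annot t s))" if "i \<in> {1..len t}" for i
      using that by (subst f(2)) (auto simp: annot_upd)
    then show "wsem (yield t, nu t) s (\<lambda>_. {}) (WEx1 x p) = (\<Sum>i\<in>{1..len (annot t s)}. f (mark x i (annot t s)))"
      by simp
  qed
next
  case (WAll1 x p)
  then have p: "p \<in> aUMSO" "no_so_quant p" by auto
  then obtain f where f: "stepf f" "\<And>t s. (\<forall>x. s x \<in> {1..len t}) \<Longrightarrow> wsem (yield t, nu t) s (\<lambda>_. {}) p = f (annot t s)"
    using recognizable_aUMSO[OF p] by auto
  show ?case
  proof (intro exI[of _ "\<lambda>u. \<Prod>i\<in>{1..len u}. f (mark x i u)"] conjI allI impI representable_prod_mark f(1))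
    fix t :: "'a nt" and s :: "nat \<Rightarrow> nat" assume "\<forall>x. s x \<in> {1..len t}"
    then have "wsem (yield t, nu t) (s(x := i)) (\<lambda>_. {}) p = f (mark x i (annot t s))" if "i \<in> {1..len t}" for i
      using that by (subst f(2)) (auto simp: annot_upd)
    then show "wsem (yield t, nu t) s (\<lambda>_. {}) (WAll1 x p) = (\<Prod>i\<in>{1..len (annot t s)}. f (mark x i (annot t s)))"
      by simp
  qed
qed simp_all

lemma logic_imp_algebraic:
  fixes \<phi> :: "('a::finite, 'k::comm_semiring_1) wf"
  assumes "\<phi> \<in> sRFO" "sentence \<phi>"
  shows "algebraic (nest_sem \<phi>)"
proof -
  obtain f where f: "representable f" "\<And>t s. (\<forall>x. s x \<in> {1..len t}) \<Longrightarrow> wsem (yield t, nu t) s (\<lambda>_. {}) \<phi> = f (annot t s)"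
    using wsem_imp_representable[of \<phi>] assms(1) unfolding sRFO_def by auto
  have sem: "sentence_sem \<phi> (yield t, nu t) = f (annot t (\<lambda>_. 1))" if "yield t \<noteq> []" for t
  proof -
    \<comment> \<open>The fixed assignment uses 0, which is not a position; for a sentence it can be
      exchanged for 1.\<close>
    have "sentence_sem \<phi> (yield t, nu t) = wsem (yield t, nu t) (\<lambda>_. 1) (\<lambda>_. {}) \<phi>"
      unfolding sentence_sem_def by (rule wsem_agree) (use assms(2) in \<open>simp add: sentence_def\<close>)
    also have "\<dots> = f (annot t (\<lambda>_. 1))" using that by (intro f(2)) (simp add: Suc_le_eq)
    finally show ?thesis .
  qed
  have "Ser (nest_sem \<phi>) = proper_part (ysum (\<lambda>t. f (annot t (\<lambda>_. 1))))"
  proof (rule ser_eqI)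
    fix w
    show "cf (Ser (nest_sem \<phi>)) w = cf (proper_part (ysum (\<lambda>t. f (annot t (\<lambda>_. 1))))) w"
    proof (cases "w = []")
      case False
      have "nest_sem \<phi> w = cf (ysum (\<lambda>t. sentence_sem \<phi> (yield t, nu t))) w"
        using cf_ysum_Nest[of "\<lambda>w \<nu>. sentence_sem \<phi> (w, \<nu>)" w] False by (simp add: nest_sem_def)
      also have "\<dots> = cf (ysum (\<lambda>t. f (annot t (\<lambda>_. 1)))) w"
        unfolding cf_ysum using False by (intro sum.cong refl sem) auto
      finally show ?thesis using False by (simp add: cf_proper_part)
    qed (simp add: nest_sem_def cf_proper_part)
  qed
  moreover have "tree_series (ysum (\<lambda>t. f (annot t (\<lambda>_. 1))))" by (intro tree_series_ysum representable_annot_const f(1))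
  ultimately show ?thesis by (simp add: algebraic_iff_tree_series tree_series_proper_part nest_sem_def)
qed

section \<open>A double Greibach normal form\<close>

abbreviation evs :: "('a + ('a, 'k::comm_semiring_1) ser) list \<Rightarrow> ('a, 'k) ser" where
  "evs \<equiv> ev (\<lambda>x. x)"

definition syms :: "'v set \<Rightarrow> ('a + 'v) set" where
  "syms R = range Inl \<union> Inr ` R"

lemma syms_simps [simp]: "Inl a \<in> syms R" "Inr r \<in> syms R \<longleftrightarrow> r \<in> R"
  "Inl ` A \<subseteq> syms R"
  by (auto simp: syms_def)

definition dg :: "'v set \<Rightarrow> ('a + 'v) list set" where
  "dg R = insert [] ({[Inl a] |a. True} \<union> {Inl a # u @ [Inl b] |a u b. set u \<subseteq> syms R})"

lemma lspan_evs: "u \<in> D \<Longrightarrow> ev \<sigma> u \<in> lspan (ev \<sigma> ` D)"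
  by (intro lspan_base imageI)

text \<open>Reading a tree series from the left gives \<open>g = c + N g\<close> with entries of \<open>N\<close> that end in letters;
  \<open>N\<^sup>* = 1 + N + N N\<^sup>* N\<close> then yields monomials that start and end with letters.\<close>

lemma tree_series_imp_double_greibach:
  fixes S :: "('a::finite, 'k::comm_semiring_1) ser"
  assumes "tree_series S"
  obtains R where "finite R" "S \<in> lspan R" "\<And>r. r \<in> R \<Longrightarrow> r \<in> lspan (evs ` dg R)"
proof -
  obtain U where U: "finite U" "S \<in> U" "U \<subseteq> lspan (tgen U)" using assms unfolding tree_series_def by blast
  have "\<forall>g\<in>U. \<exists>c cI cC. g = tcomb U c cI cC"
    using tgen_coeffs[OF U(1)] U(3) by blast
  then obtain c cI cC where eq: "\<And>g. g \<in> U \<Longrightarrow> g = tcomb U (c g) (cI g) (cC g)"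
    by metis
  \<comment> \<open>The last factor \<open>h\<close> of each term is split off, so the equations
    become linear and every entry ends in letters.\<close>
  define N where "N g h = (\<Sum>a\<in>UNIV. sc (cI g a h) * lt a)
      + (\<Sum>a\<in>UNIV. \<Sum>b\<in>UNIV. \<Sum>k\<in>U. sc (cC g a b k h) * (lt a * (k * lt b)))" for g h
  have lin: "g = sc (c g) + (\<Sum>h\<in>U. N g h * h)" if g: "g \<in> U" for g
  proof -
    have "(\<Sum>h\<in>U. N g h * h) = (\<Sum>h\<in>U. \<Sum>a\<in>UNIV. sc (cI g a h) * (lt a * h))
        + (\<Sum>h\<in>U. \<Sum>a\<in>UNIV. \<Sum>b\<in>UNIV. \<Sum>k\<in>U. sc (cC g a b k h) * (lt a * (k * (lt b * h))))"
      by (simp add: N_def distrib_right sum.distrib sum_distrib_right mult.assoc)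
    also have "(\<Sum>h\<in>U. \<Sum>a\<in>UNIV. sc (cI g a h) * (lt a * h)) = (\<Sum>a\<in>UNIV. \<Sum>h\<in>U. sc (cI g a h) * (lt a * h))"
      by (rule sum.swap)
    also have "(\<Sum>h\<in>U. \<Sum>a\<in>UNIV. \<Sum>b\<in>UNIV. \<Sum>k\<in>U. sc (cC g a b k h) * (lt a * (k * (lt b * h))))
        = (\<Sum>a\<in>UNIV. \<Sum>b\<in>UNIV. \<Sum>k\<in>U. \<Sum>h\<in>U. sc (cC g a b k h) * (lt a * (k * (lt b * h))))"
      by (subst sum.swap) (rule sum.cong[OF refl], subst sum.swap, rule sum.cong[OF refl], rule sum.swap)
    finally show ?thesis using eq[OF g] by (simp add: tcomb_def add.assoc)
  qed
  have N: "cf (N g h) [] = 0" for g h by (simp add: N_def)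
  obtain L where L1: "\<And>i j. i \<in> U \<Longrightarrow> j \<in> U \<Longrightarrow> L i j = idm i j + (\<Sum>k\<in>U. N i k * L k j)"
    and L2: "\<And>i j. i \<in> U \<Longrightarrow> j \<in> U \<Longrightarrow> L i j = idm i j + (\<Sum>k\<in>U. L i k * N k j)"
    by (rule star_exists[of U N, OF U(1) N]) (assumption | rule that)+
  define R where "R = (\<lambda>(g, h). L g h) ` (U \<times> U)"
  have R: "L g h \<in> R" if "g \<in> U" "h \<in> U" for g h
    using that unfolding R_def by (intro image_eqI[of _ _ "(g, h)"]) auto
  have gL: "g = (\<Sum>h\<in>U. L g h * sc (c h))" if "g \<in> U" for g
    using N lin _ that
  proof (rule linear_unique_left[where x = "\<lambda>g. g" and y = "\<lambda>g. \<Sum>h\<in>U. L g h * sc (c h)"])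
    fix g assume g: "g \<in> U"
    have "(\<Sum>h\<in>U. L g h * sc (c h)) = (\<Sum>h\<in>U. (idm g h + (\<Sum>k\<in>U. N g k * L k h)) * sc (c h))"
      by (intro sum.cong refl) (subst L1, use g in auto)
    also have "\<dots> = sc (c g) + (\<Sum>h\<in>U. \<Sum>k\<in>U. N g k * (L k h * sc (c h)))"
      using U(1) g by (simp add: distrib_right sum.distrib sum_distrib_right mult.assoc
          if_distrib[of "\<lambda>x. x * _"] cong: if_cong)
    also have "(\<Sum>h\<in>U. \<Sum>k\<in>U. N g k * (L k h * sc (c h))) = (\<Sum>k\<in>U. N g k * (\<Sum>h\<in>U. L k h * sc (c h)))"
      by (subst sum.swap) (simp add: sum_distrib_left)
    finally show "(\<Sum>h\<in>U. L g h * sc (c h)) = sc (c g) + (\<Sum>k\<in>U. N g k * (\<Sum>h\<in>U. L k h * sc (c h)))" .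
  qed
  have UR: "g \<in> lspan R" if "g \<in> U" for g
    by (subst gL[OF that]) (simp add: sc_commute, intro lspan_sum lspan_sc lspan_base[OF R] that)
  \<comment> \<open>The monomials in entries of \<open>N\<close>, once the middle series
    \<open>k\<close> is expressed by star entries.\<close>
  define D :: "('a + ('a, 'k) ser) list set" where "D = {[Inl a] |a. True} \<union> {[Inl a, Inr r, Inl b] |a r b. r \<in> R}"
  have ND: "N g h \<in> lspan (evs ` D)" for g h
  proof -
    have "lt a \<in> lspan (evs ` D)" for a
      using lspan_evs[of "[Inl a]" D "\<lambda>x. x"] by (simp add: D_def)
    moreover have "lt a * (k * lt b) \<in> lspan (evs ` D)" if "k \<in> U" for a b k
    proof (rule lspan_left[OF lspan_right[OF UR[OF that]]])
      fix r assume "r \<in> R" then show "r * lt b \<in> lspan {r * lt b |r. r \<in> R}" by (auto intro: lspan_base)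
    next
      fix x assume "x \<in> {r * lt b |r. r \<in> R}"
      then obtain r where "r \<in> R" "x = r * lt b" by blast
      then show "lt a * x \<in> lspan (evs ` D)"
        using lspan_evs[of "[Inl a, Inr r, Inl b]" D "\<lambda>x. x"] by (simp add: D_def)
    qed
    ultimately show ?thesis unfolding N_def by (intro lspan_plus lspan_sum lspan_sc)
  qed
  have D_dg: "D \<subseteq> dg R"
  proof
    fix d :: "('a + ('a, 'k) ser) list" assume "d \<in> D"
    then consider a where "d = [Inl a]" | a r b where "r \<in> R" "d = Inl a # [Inr r] @ [Inl b]"
      unfolding D_def by auto
    then show "d \<in> dg R" unfolding dg_def by cases (blast, force)
  qed
  have "L i j \<in> lspan (evs ` dg R)" if ij: "i \<in> U" "j \<in> U" for i j
  proof -
    have "N i k * L k j \<in> lspan (evs ` dg R)" if k: "k \<in> U" for k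
    proof -
      have "N i k * (L k l * N l j) \<in> lspan (evs ` dg R)" if l: "l \<in> U" for l
        using ND[of i k]
      proof (rule lspan_mult)
        show "L k l * N l j \<in> lspan {L k l * evs d |d. d \<in> D}"
          by (rule lspan_left[OF ND]) (auto intro: lspan_base)
        fix x y assume "x \<in> evs ` D" "y \<in> {L k l * evs d |d. d \<in> D}"
        then obtain d d' where d: "d \<in> D" "x = evs d" "d' \<in> D" "y = L k l * evs d'" by blast
        \<comment> \<open>\<open>d\<close> supplies the leading letter and \<open>d'\<close> the
          final one, with a star entry in between.\<close>
        then have "x * y = evs (d @ [Inr (L k l)] @ d')" by simp
        moreover have "d @ [Inr (L k l)] @ d' \<in> dg R"
        proof -
          obtain a v where "d = Inl a # v" "set v \<subseteq> syms R" using d(1) unfolding D_def by auto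
          moreover obtain v' b where "d' = v' @ [Inl b]" "set v' \<subseteq> syms R"
            using d(3) unfolding D_def by (auto simp: append_eq_Cons_conv)
          ultimately show ?thesis unfolding dg_def using R[OF k l]
            by (intro insertI2 UnI2 CollectI exI[of _ a] exI[of _ "v @ [Inr (L k l)] @ v'"] exI[of _ b]) auto
        qed
        ultimately show "x * y \<in> lspan (evs ` dg R)" by (simp only: lspan_evs)
      qed
      then have "N i k * (\<Sum>l\<in>U. L k l * N l j) \<in> lspan (evs ` dg R)"
        by (simp add: sum_distrib_left lspan_sum)
      moreover have "N i k * idm k j \<in> lspan (evs ` dg R)"
        using lspan_mono[OF ND image_mono[OF D_dg]] by (auto intro: lspan.zero)
      ultimately show ?thesis by (subst L2[OF k ij(2)]) (simp add: distrib_left lspan_plus del: mult_1_right)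
    qed
    moreover have "idm i j \<in> lspan (evs ` dg R)"
      using lspan_evs[of "[]" "dg R" "\<lambda>x. x"] by (auto simp: dg_def intro: lspan.zero)
    ultimately show ?thesis unfolding L1[OF ij] by (intro lspan_plus lspan_sum)
  qed
  then have "r \<in> lspan (evs ` dg R)" if "r \<in> R" for r using that unfolding R_def by auto
  then show ?thesis using U UR[OF U(2)] by (intro that[of R]) (auto simp: R_def)
qed

subsection \<open>Long phrases with a long terminal prefix\<close>

text \<open>The final letter is kept apart from the prefix because it will close the arc around the
  phrase.\<close>

definition lw :: "'v set \<Rightarrow> nat \<Rightarrow> ('a + 'v) list set" where
  "lw R m = {map Inl w @ u @ [Inl b] |w u b. length w = m \<and> set u \<subseteq> syms R}"

lemma lwI: "length w = m \<Longrightarrow> set u \<subseteq> syms R \<Longrightarrow> map Inl w @ u @ [Inl b] \<in> lw R m"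
  unfolding lw_def by blast

lemma lw_mono: "R \<subseteq> F \<Longrightarrow> lw R m \<subseteq> lw F m"
  unfolding lw_def syms_def by blast

text \<open>The symbol after the prefix is a letter or is replaced by a double Greibach monomial. A
  nonempty one lengthens the prefix; the empty one deletes the variable, and the induction on
  \<open>u\<close> continues, at worst until a terminal word is left.\<close>

lemma lw_expand:
  fixes R :: "('a, 'k::comm_semiring_1) ser set"
  assumes R: "\<And>r. r \<in> R \<Longrightarrow> r \<in> lspan (evs ` dg R)"
    and "length w = m" "set u \<subseteq> syms R"
  shows "evs (map Inl w @ u @ [Inl b]) \<in> lspan (evs ` (range (map Inl) \<union> lw R (Suc m)))"
  using assms(3)
proof (induction u)
  case Nil
  have "map Inl w @ [] @ [Inl b] = (map Inl (w @ [b]) :: ('a + ('a, 'k) ser) list)" by simp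
  then show ?case by (intro lspan_evs UnI1) blast
next
  case (Cons s u)
  show ?case
  proof (cases s)
    case (Inl a)
    have "map Inl w @ (s # u) @ [Inl b] = map Inl (w @ [a]) @ u @ [Inl b]" by (simp add: Inl)
    moreover have "map Inl (w @ [a]) @ u @ [Inl b] \<in> lw R (Suc m)"
      by (rule lwI) (use assms(2) Cons.prems in auto)
    ultimately show ?thesis by (intro lspan_evs UnI2) simp
  next
    case (Inr r)
    let ?x = "evs (map Inl w)" and ?y = "evs (u @ [Inl b])"
    have r: "r \<in> lspan (evs ` dg R)" using R Cons.prems Inr by auto
    have "?x * (r * ?y) \<in> lspan (evs ` (range (map Inl) \<union> lw R (Suc m)))"
    proof (rule lspan_left[OF lspan_right[OF r]])
      fix x assume "x \<in> evs ` dg R" then show "x * ?y \<in> lspan {evs d * ?y |d. d \<in> dg R}" by (auto intro: lspan_base)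
    next
      fix x assume "x \<in> {evs d * ?y |d. d \<in> dg R}"
      then obtain d where d: "d \<in> dg R" "x = evs d * ?y" by blast
      show "?x * x \<in> lspan (evs ` (range (map Inl) \<union> lw R (Suc m)))"
      proof (cases d)
        case Nil
        then show ?thesis using d Cons by simp
      next
        case (Cons s' d')
        with d(1) obtain a where d': "s' = Inl a" "set d' \<subseteq> syms R" unfolding dg_def by auto
        have "?x * x = evs (map Inl (w @ [a]) @ (d' @ u) @ [Inl b])" using d Cons d' by (simp add: mult.assoc)
        moreover have "map Inl (w @ [a]) @ (d' @ u) @ [Inl b] \<in> lw R (Suc m)"
          by (rule lwI) (use assms(2) Cons.prems d' \<open>set (s # u) \<subseteq> syms R\<close> in auto)
        ultimately show ?thesis by (simp only: lspan_evs UnI2)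
      qed
    qed
    then show ?thesis using Inr by (simp add: mult.assoc)
  qed
qed

lemma long_prefix:
  fixes R :: "('a, 'k::comm_semiring_1) ser set"
  assumes R: "\<And>r. r \<in> R \<Longrightarrow> r \<in> lspan (evs ` dg R)" and r: "r \<in> R"
  shows "r \<in> lspan (evs ` (range (map Inl) \<union> lw R (Suc m)))"
proof (induction m)
  case 0
  show ?case
  proof (rule lspan_trans[OF R[OF r]])
    fix x assume "x \<in> evs ` dg R"
    then obtain d where d: "d \<in> dg R" "x = evs d" by blast
    then consider "d = map Inl []" | a where "d = map Inl [a]" | a u b where "set u \<subseteq> syms R" "d = map Inl [a] @ u @ [Inl b]"
      unfolding dg_def by auto
    then have "d \<in> range (map Inl) \<union> lw R (Suc 0)"
      by cases (blast, blast, metis UnI2 length_Cons list.size(3) lwI)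
    then show "x \<in> lspan (evs ` (range (map Inl) \<union> lw R (Suc 0)))" using d by (auto intro: lspan_base)
  qed
next
  case (Suc m)
  show ?case
  proof (rule lspan_trans[OF Suc])
    fix x assume "x \<in> evs ` (range (map Inl) \<union> lw R (Suc m))"
    then consider w where "x = evs (map Inl w)" 
      | w u b where "length w = Suc m" "set u \<subseteq> syms R" "x = evs (map Inl w @ u @ [Inl b])"
      unfolding lw_def by blast
    then show "x \<in> lspan (evs ` (range (map Inl) \<union> lw R (Suc (Suc m))))"
    proof cases
      case 1 then show ?thesis by (auto intro: lspan_base)
    next
      case 2 then show ?thesis using lw_expand[OF R] by blast
    qed
  qed
qed

text \<open>Expansion leaves terminal words that may be too short to carry the code. Discarding all
  short words from the series removes them at a finite cost.\<close>

definition longer :: "nat \<Rightarrow> ('a, 'k::comm_semiring_1) ser \<Rightarrow> ('a, 'k) ser" where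
  "longer m f = Ser (\<lambda>w. if length w \<le> m then 0 else cf f w)"

lemma cf_cut: "cf (longer m f) w = (if length w \<le> m then 0 else cf f w)"
  by (simp add: longer_def)

lemma cut_lin: "longer m 0 = 0" "longer m (sc k * f + g) = sc k * longer m f + longer m g"
  by (auto intro!: ser_eqI simp: cf_cut)

lemma cf_ev_word: "cf (ev \<sigma> (map Inl w)) v = (if v = w then 1 else 0)"
proof (induction w arbitrary: v)
  case Nil
  show ?case by (simp add: cf_one)
next
  case (Cons a w)
  then show ?case by (cases v) auto
qed

lemma split_cut:
  fixes f :: "('a::finite, 'k::comm_semiring_1) ser"
  shows "f = (\<Sum>w\<in>{w. length w \<le> m}. sc (cf f w) * ev \<sigma> (map Inl w)) + longer m f"
proof (rule ser_eqI)
  fix v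
  have fin: "finite {w :: 'a list. length w \<le> m}"
    using finite_lists_length_le[of "UNIV :: 'a set" m] by simp
  have "(\<Sum>w\<in>{w. length w \<le> m}. cf f w * (if v = w then 1 else 0)) = (if length v \<le> m then cf f v else 0)"
    using fin by (simp add: if_distrib[of "\<lambda>x. _ * x"] cong: if_cong)
  then show "cf f v = cf ((\<Sum>w\<in>{w. length w \<le> m}. sc (cf f w) * ev \<sigma> (map Inl w)) + longer m f) v"
    by (simp add: cf_ev_word cf_cut)
qed

lemma cut_lw:
  assumes "x \<in> lw R m"
  shows "longer m (ev \<sigma> x) = ev \<sigma> x"
proof -
  obtain w u b where x: "length w = m" "x = map Inl w @ u @ [Inl b]" using assms unfolding lw_def by blast
  have "eqn (Suc (length w)) (ev \<sigma> (map Inl w) * (ev \<sigma> u * lt b)) 0"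
  proof (induction w)
    case Nil
    show ?case by (simp add: eqn_def)
  next
    case (Cons a w)
    from eqn_lt[OF this, of a] show ?case by (simp add: mult.assoc)
  qed
  then show ?thesis by (intro ser_eqI) (auto simp: x cf_cut eqn_def)
qed

text \<open>Each variable is a combination of short words, which are written with letters, plus its
  truncation. So truncated series can take over as variables.\<close>

lemma ev_cut:
  fixes R :: "('a::finite, 'k::comm_semiring_1) ser set"
  assumes "set u \<subseteq> syms R"
  shows "evs u \<in> lspan (evs ` {v. set v \<subseteq> syms (longer m ` R)})"
  using assms
proof (induction u)
  case Nil
  show ?case by (rule lspan_evs) simp
next
  case (Cons s u)
  let ?V = "{v. set v \<subseteq> syms (longer m ` R)} :: ('a + ('a, 'k) ser) list set"
  have mult: "f * g \<in> lspan (evs ` ?V)" if "f \<in> lspan (evs ` ?V)" "g \<in> lspan (evs ` ?V)" for f g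
    using that
  proof (rule lspan_mult)
    fix b c assume "b \<in> evs ` ?V" "c \<in> evs ` ?V"
    then obtain v v' where v: "v \<in> ?V" "b = evs v" "v' \<in> ?V" "c = evs v'" by blast
    then have "b * c = evs (v @ v')" "v @ v' \<in> ?V" by auto
    then show "b * c \<in> lspan (evs ` ?V)" by (simp only: lspan_evs)
  qed
  have "evs [s] \<in> lspan (evs ` ?V)"
  proof (cases s)
    case (Inl a) then show ?thesis by (intro lspan_evs) simp
  next
    case (Inr r)
    then have "longer m r \<in> lspan (evs ` ?V)"
      using lspan_evs[of "[Inr (longer m r)]" ?V "\<lambda>x. x"] Cons.prems by simp
    moreover have "evs (map Inl w) \<in> lspan (evs ` ?V)" for w by (rule lspan_evs) auto
    ultimately have "(\<Sum>w\<in>{w. length w \<le> m}. sc (cf r w) * evs (map Inl w)) + longer m r \<in> lspan (evs ` ?V)"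
      by (intro lspan_plus lspan_sum lspan_sc)
    then show ?thesis using Inr split_cut[where f = r and m = m and \<sigma> = "\<lambda>x. x"] by simp
  qed
  from mult[OF this Cons.IH] Cons.prems show ?case by (cases s) simp_all
qed

text \<open>Truncation kills short terminal words and fixes the other monomials, whose prefix and
  final letter already exceed the bound. A long terminal word has itself the shape required by
  \<open>lw\<close>.\<close>

lemma cut_long:
  fixes R :: "('a::finite, 'k::comm_semiring_1) ser set"
  assumes R: "\<And>r. r \<in> R \<Longrightarrow> r \<in> lspan (evs ` dg R)" and r: "r \<in> R"
  shows "longer (Suc m) r \<in> lspan (evs ` lw (longer (Suc m) ` R) (Suc m))"
proof (rule lspan_lin[OF long_prefix[OF R r, of m], where T = "longer (Suc m)"])
  let ?L = "lspan (evs ` lw (longer (Suc m) ` R) (Suc m))"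
  have L: "evs x \<in> ?L" if "x \<in> lw R (Suc m)" for x
  proof -
    obtain w u b where x: "length w = Suc m" "set u \<subseteq> syms R" "x = map Inl w @ u @ [Inl b]"
      using \<open>x \<in> lw R (Suc m)\<close> unfolding lw_def by blast
    have "evs (map Inl w) * (evs u * lt b) \<in> ?L"
    proof (rule lspan_left[OF lspan_right[OF ev_cut[OF x(2), of "Suc m"]]])
      fix y assume "y \<in> evs ` {v. set v \<subseteq> syms (longer (Suc m) ` R)}"
      then show "y * lt b \<in> lspan {evs v * lt b |v. set v \<subseteq> syms (longer (Suc m) ` R)}"
        by (auto intro: lspan_base)
    next
      fix y assume "y \<in> {evs v * lt b |v. set v \<subseteq> syms (longer (Suc m) ` R)}"
      then obtain v where v: "set v \<subseteq> syms (longer (Suc m) ` R)" "y = evs v * lt b" by blast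
      from lspan_evs[OF lwI[OF x(1) v(1), of b], of "\<lambda>x. x"] show "evs (map Inl w) * y \<in> ?L"
        by (simp add: v(2))
    qed
    then show ?thesis by (simp add: x)
  qed
  fix y assume "y \<in> evs ` (range (map Inl) \<union> lw R (Suc m))"
  then consider w where "y = evs (map Inl w)" | x where "x \<in> lw R (Suc m)" "y = evs x" by blast
  then show "longer (Suc m) y \<in> ?L"
  proof cases
    case 1
    show ?thesis
    proof (cases "length w \<le> Suc m")
      case True
      then have "longer (Suc m) y = 0" by (intro ser_eqI) (auto simp: 1 cf_cut cf_ev_word)
      then show ?thesis by (simp add: lspan.zero)
    next
      case False
      then have "longer (Suc m) y = y" by (intro ser_eqI) (auto simp: 1 cf_cut cf_ev_word)
      moreover have "map Inl w \<in> (lw R (Suc m) :: ('a + ('a, 'k) ser) list set)"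
      proof -
        have w: "w \<noteq> []" using False by auto
        have eq: "map Inl w = map Inl (take (Suc m) w) @ map Inl (drop (Suc m) (butlast w)) @ [Inl (last w)]"
        proof -
          have "take (Suc m) w = take (Suc m) (butlast w)" using False by (simp add: take_butlast)
          then have "w = take (Suc m) w @ drop (Suc m) (butlast w) @ [last w]"
            using w by (simp add: append_assoc[symmetric] del: append_assoc)
          then show ?thesis by (metis list.map(1) list.map(2) map_append)
        qed
        have "map Inl (take (Suc m) w) @ map Inl (drop (Suc m) (butlast w)) @ [Inl (last w)] \<in> lw R (Suc m)"
          by (rule lwI) (use False in \<open>auto simp: syms_def\<close>)
        then show ?thesis by (simp only: eq)
      qed
      ultimately show ?thesis using L 1 by simp
    qed
  next
    case 2
    then show ?thesis using cut_lw[OF 2(1), of "\<lambda>x. x"] L by simp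
  qed
qed (assumption | rule cut_lin)+

subsection \<open>Coding the variable of a phrase inside the phrase\<close>

text \<open>In the coded form \<open>Dm a b\<close> is an arc around the empty word. A phrase for variable number \<open>i\<close> has
  exactly \<open>i\<close> letters before its first dummy arc, so the nesting structure alone determines \<open>i\<close>.\<close>

datatype 'a item = Lt 'a | Dm 'a 'a | Vr nat

fun idx :: "'a item list \<Rightarrow> nat" where
  "idx (Lt a # l) = Suc (idx l)"
| "idx _ = 0"

fun evi :: "(nat \<Rightarrow> ('a, 'k::comm_semiring_1) ser) \<Rightarrow> 'a item list \<Rightarrow> ('a, 'k) ser" where
  "evi \<rho> [] = 1"
| "evi \<rho> (Lt a # l) = lt a * evi \<rho> l"
| "evi \<rho> (Dm a b # l) = lt a * (lt b * evi \<rho> l)"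
| "evi \<rho> (Vr i # l) = \<rho> i * evi \<rho> l"

lemma evi_append: "evi \<rho> (l @ l') = evi \<rho> l * evi \<rho> l'"
  by (induction \<rho> l rule: evi.induct) (simp_all add: mult.assoc)

lemma evi_word: "evi \<rho> (map Lt w) = ev \<sigma> (map Inl w)"
  by (induction w) simp_all

lemma idx_prefix: "idx (map Lt w @ Dm a b # l) = length w"
  by (induction w) simp_all

text \<open>The 3 counts the opening letter of the enclosing arc and the two letters of the dummy
  arc; the \<open>i\<close> announcing letters lie between them.\<close>

lemma lw_coded:
  fixes F :: "('a, 'k::comm_semiring_1) ser set"
  assumes x: "x \<in> lw F m" and m: "i + 3 \<le> m" and e: "\<And>f. f \<in> F \<Longrightarrow> \<rho> (e f) = f"
  obtains a l b where "evs x = lt a * (evi \<rho> l * lt b)" "idx l = i" "l \<noteq> []"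
proof -
  obtain w u b where w: "length w = m" "set u \<subseteq> syms F" "x = map Inl w @ u @ [Inl b]"
    using x unfolding lw_def by blast
  then obtain a w' where a: "w = a # w'" "length w' \<ge> i + 2" using m by (cases w) auto
  define l where "l = map Lt (take i w') @ Dm (w' ! i) (w' ! Suc i) # map Lt (drop (i + 2) w')
      @ map (case_sum Lt (\<lambda>f. Vr (e f))) u"
  have "evi \<rho> (map (case_sum Lt (\<lambda>f. Vr (e f))) u) = evs u"
    using w(2)
  proof (induction u)
    case (Cons s u)
    then show ?case by (cases s) (simp_all add: e)
  qed simp
  moreover have "evs (map Inl w') = evi \<rho> (map Lt (take i w') @ Dm (w' ! i) (w' ! Suc i) # map Lt (drop (i + 2) w'))"
  proof -
    have "w' = take i w' @ w' ! i # w' ! Suc i # drop (i + 2) w'"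
      using a(2) by (simp add: Cons_nth_drop_Suc)
    then have "evs (map Inl w') = evs (map Inl (take i w' @ w' ! i # w' ! Suc i # drop (i + 2) w'))"
      by simp
    then show ?thesis by (simp add: evi_append evi_word[where \<sigma> = "\<lambda>x. x"] del: append_take_drop_id)
  qed
  ultimately have "evs x = lt a * (evi \<rho> l * lt b)"
    by (simp add: w a l_def evi_append mult.assoc)
  moreover have "idx l = i" unfolding l_def idx_prefix using a(2) by simp
  ultimately show ?thesis using that by (simp add: l_def)
qed

lemma tree_series_imp_coded:
  fixes S :: "('a::finite, 'k::comm_semiring_1) ser"
  assumes "tree_series S"
  obtains m H i0 and \<rho> :: "nat \<Rightarrow> ('a, 'k) ser" and c :: "'a \<Rightarrow> 'a item list \<Rightarrow> 'a \<Rightarrow> 'k"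
  where "finite H" "[] \<notin> H" "\<And>a h b. h \<notin> H \<Longrightarrow> c a h b = 0" "\<rho> i0 = longer m S"
    and "\<And>i. \<rho> i = (\<Sum>a\<in>UNIV. \<Sum>b\<in>UNIV. \<Sum>h\<in>H.
        if idx h = i then sc (c a h b) * (lt a * (evi \<rho> h * lt b)) else 0)"
proof -
  obtain R where R: "finite R" "S \<in> lspan R" "\<And>r. r \<in> R \<Longrightarrow> r \<in> lspan (evs ` dg R)"
    using assms by (rule tree_series_imp_double_greibach) (rule that; assumption)
  \<comment> \<open>There are at most \<open>card R + 1\<close> variables, so their numbers are at
    most \<open>card R\<close> and \<open>i + 3\<close> letters always fit into the prefix.\<close>
  define m where "m = card R + 4"
  define F where "F = insert (longer m S) (longer m ` R)"
  have m: "m = Suc (card R + 3)" by (simp add: m_def)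
  have cutR: "longer m r \<in> lspan (evs ` lw F m)" if "r \<in> R" for r
  proof -
    have "longer m r \<in> lspan (evs ` lw (longer m ` R) m)"
      unfolding m by (rule cut_long[OF _ that]) (rule R(3))
    then show ?thesis by (rule lspan_mono) (intro image_mono lw_mono, auto simp: F_def)
  qed
  moreover have "longer m S \<in> lspan (evs ` lw F m)"
    by (rule lspan_lin[OF R(2)]) (auto intro: cutR cut_lin)
  ultimately have Fl: "f \<in> lspan (evs ` lw F m)" if "f \<in> F" for f using that by (auto simp: F_def)
  have finF: "finite F" using R(1) by (simp add: F_def)
  then obtain e :: "('a, 'k) ser \<Rightarrow> nat" where e: "bij_betw e F {0..<card F}"
    using ex_bij_betw_finite_nat by blast
  have card: "card F \<le> Suc (card R)" using card_image_le[OF R(1), of "longer m"] R(1) by (simp add: F_def card_insert_if)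
  define \<rho> where "\<rho> i = (if i \<in> e ` F then inv_into F e i else 0)" for i
  have \<rho>: "\<rho> (e f) = f" if "f \<in> F" for f
    using that bij_betw_imp_inj_on[OF e] by (simp only: \<rho>_def imageI if_True inv_into_f_f)
  define T where "T i = {(a :: 'a, l :: 'a item list, b :: 'a). idx l = i \<and> l \<noteq> []}" for i
  define E where "E = (\<lambda>(a, l, b). lt a * (evi \<rho> l * lt b))"
  have "\<exists>X d. finite X \<and> X \<subseteq> T (e f) \<and> f = (\<Sum>x\<in>X. sc (d x) * E x)" if f: "f \<in> F" for f
  proof -
    have "f \<in> lspan (E ` T (e f))"
    proof (rule lspan_mono[OF Fl[OF f]], rule subsetI)
      fix y assume "y \<in> evs ` lw F m"
      then obtain x where x: "x \<in> lw F m" "y = evs x" by blast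
      have "e f < card F" using e f by (auto simp: bij_betw_def)
      then have "e f + 3 \<le> m" using card m by simp
      from lw_coded[OF x(1) this \<rho>] obtain a l b where "evs x = lt a * (evi \<rho> l * lt b)" "idx l = e f" "l \<noteq> []"
        by blast
      then show "y \<in> E ` T (e f)" using x(2) unfolding E_def T_def
        by (intro image_eqI[of _ _ "(a, l, b)"]) auto
    qed
    then obtain X d where "finite X" "X \<subseteq> T (e f)" "f = (\<Sum>x\<in>X. sc (d x) * E x)" by (rule lspan_coeffs)
    then show ?thesis by blast
  qed
  then have "\<forall>f\<in>F. \<exists>X d. finite X \<and> X \<subseteq> T (e f) \<and> f = (\<Sum>x\<in>X. sc (d x) * E x)" by blast
  from bchoice[OF this] obtain X where "\<forall>f\<in>F. \<exists>d. finite (X f) \<and> X f \<subseteq> T (e f) \<and> f = (\<Sum>x\<in>X f. sc (d x) * E x)"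
    by blast
  from bchoice[OF this] obtain d where "\<forall>f\<in>F. finite (X f) \<and> X f \<subseteq> T (e f) \<and> f = (\<Sum>x\<in>X f. sc (d f x) * E x)"
    by blast
  then have X: "finite (X f)" "X f \<subseteq> T (e f)" "f = (\<Sum>x\<in>X f. sc (d f x) * E x)" if "f \<in> F" for f
    using that by blast+
  define H where "H = (\<Union>f\<in>F. (\<lambda>(a, l, b). l) ` X f)"
  \<comment> \<open>\<open>idx l\<close> recovers the variable, so a single coefficient function
    serves all rules.\<close>
  define c where "c a l b = (if idx l \<in> e ` F \<and> (a, l, b) \<in> X (\<rho> (idx l)) then d (\<rho> (idx l)) (a, l, b) else 0)" for a l b
  have "finite H" unfolding H_def using finF X(1) by blast
  moreover have "[] \<notin> H"
    using X(2) unfolding H_def T_def by fastforce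
  moreover have "c a h b = 0" if "h \<notin> H" for a h b
  proof -
    have "(a, h, b) \<notin> X (\<rho> (idx h))" if "idx h \<in> e ` F"
    proof
      assume "(a, h, b) \<in> X (\<rho> (idx h))"
      moreover have "\<rho> (idx h) \<in> F" using that \<rho> by auto
      ultimately have "h \<in> H" unfolding H_def by (intro UN_I[of "\<rho> (idx h)"] image_eqI[of _ _ "(a, h, b)"]) auto
      with \<open>h \<notin> H\<close> show False by blast
    qed
    then show ?thesis by (auto simp: c_def)
  qed
  moreover have "\<rho> (e (longer m S)) = longer m S" by (rule \<rho>) (simp add: F_def)
  moreover have "\<rho> i = (\<Sum>a\<in>UNIV. \<Sum>b\<in>UNIV. \<Sum>h\<in>H.
        if idx h = i then sc (c a h b) * (lt a * (evi \<rho> h * lt b)) else 0)" for i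
  proof (cases "i \<in> e ` F")
    case False
    then have "\<rho> i = 0" by (simp add: \<rho>_def)
    moreover have "(if idx h = i then sc (c a h b) * (lt a * (evi \<rho> h * lt b)) else 0) = 0" for a b h
      using False by (auto simp: c_def)
    ultimately show ?thesis by simp
  next
    case True
    then obtain f where f: "f \<in> F" "i = e f" by blast
    let ?T = "(UNIV :: 'a set) \<times> (UNIV :: 'a set) \<times> H"
    let ?\<pi> = "\<lambda>(a :: 'a, h :: 'a item list, b :: 'a). (a, b, h)"
    have "(\<Sum>a\<in>UNIV. \<Sum>b\<in>UNIV. \<Sum>h\<in>H.
        if idx h = i then sc (c a h b) * (lt a * (evi \<rho> h * lt b)) else 0)
      = (\<Sum>(a, b, h)\<in>?T. if idx h = i then sc (c a h b) * (lt a * (evi \<rho> h * lt b)) else 0)"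
      by (simp add: sum.cartesian_product)
    also have "\<dots> = (\<Sum>(a, b, h)\<in>?\<pi> ` X f. sc (c a h b) * (lt a * (evi \<rho> h * lt b)))"
    proof (rule sum.mono_neutral_cong_right)
      show "finite ?T" using \<open>finite H\<close> by simp
      show "?\<pi> ` X f \<subseteq> ?T" using f(1) unfolding H_def by force
      show "\<forall>x\<in>?T - ?\<pi> ` X f. (case x of (a, b, h) \<Rightarrow> if idx h = i then sc (c a h b) * (lt a * (evi \<rho> h * lt b)) else 0) = 0"
      proof
        fix x assume x: "x \<in> ?T - ?\<pi> ` X f"
        obtain a b h where abh: "x = (a, b, h)" by (cases x) auto
        have "(a, h, b) \<notin> X f" using x abh by force
        then have "idx h = i \<Longrightarrow> c a h b = 0" using f \<rho> by (simp add: c_def)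
        then show "(case x of (a, b, h) \<Rightarrow> if idx h = i then sc (c a h b) * (lt a * (evi \<rho> h * lt b)) else 0) = 0"
          by (simp add: abh)
      qed
      fix x assume "x \<in> ?\<pi> ` X f"
      then obtain a h b where abh: "(a, h, b) \<in> X f" "x = (a, b, h)" by auto
      then have "idx h = i" using X(2)[OF f(1)] f(2) unfolding T_def by blast
      then show "(case x of (a, b, h) \<Rightarrow> if idx h = i then sc (c a h b) * (lt a * (evi \<rho> h * lt b)) else 0) =
         (case x of (a, b, h) \<Rightarrow> sc (c a h b) * (lt a * (evi \<rho> h * lt b)))"
        by (simp add: abh)
    qed
    also have "\<dots> = (\<Sum>x\<in>X f. sc (d f x) * E x)"
    proof (subst sum.reindex)
      show "inj_on ?\<pi> (X f)" by (auto simp: inj_on_def)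
      show "sum ((\<lambda>(a, b, h). sc (c a h b) * (lt a * (evi \<rho> h * lt b))) \<circ> ?\<pi>) (X f) = (\<Sum>x\<in>X f. sc (d f x) * E x)"
      proof (rule sum.cong[OF refl])
        fix x assume x: "x \<in> X f"
        obtain a h b where abh: "x = (a, h, b)" by (cases x) auto
        have "idx h = i" using X(2)[OF f(1)] f(2) x abh unfolding T_def by blast
        then have "c a h b = d f x" using x abh f \<rho> by (simp add: c_def)
        then show "((\<lambda>(a, b, h). sc (c a h b) * (lt a * (evi \<rho> h * lt b))) \<circ> ?\<pi>) x = sc (d f x) * E x"
          by (simp add: abh E_def)
      qed
    qed
    also have "\<dots> = \<rho> i" using X(3)[OF f(1)] f \<rho> by simp
    finally show ?thesis by simp
  qed
  ultimately show ?thesis by (rule that)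
qed

section \<open>Reading coded phrases off a nested word\<close>

text \<open>Only the top level is read: an empty arc is a dummy, any other arc stands for the
  variable announced by its content.\<close>

fun items :: "'a nt \<Rightarrow> 'a item list" where
  "items Emp = []"
| "items (Itl a t) = Lt a # items t"
| "items (Arc a t b s) = (if t = Emp then Dm a b else Vr (idx (items t))) # items s"

text \<open>Each nonempty arc contributes the coefficient of the phrase inside it, letters and dummy
  arcs contribute 1. No choice remains, so the weight is a product.\<close>

fun code_weight :: "('a \<Rightarrow> 'a item list \<Rightarrow> 'a \<Rightarrow> 'k::comm_semiring_1) \<Rightarrow> 'a nt \<Rightarrow> 'k" where
  "code_weight c Emp = 1"
| "code_weight c (Itl a t) = code_weight c t"
| "code_weight c (Arc a t b s) = (if t = Emp then 1 else c a (items t) b * code_weight c t) * code_weight c s"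

definition item_weight :: "('a \<Rightarrow> 'a item list \<Rightarrow> 'a \<Rightarrow> 'k::comm_semiring_1) \<Rightarrow> 'a item list \<Rightarrow> 'a nt \<Rightarrow> 'k" where
  "item_weight c l t = (if items t = l then code_weight c t else 0)"

lemma items_Nil: "items t = [] \<longleftrightarrow> t = Emp"
  by (cases t) auto

lemma ysum_Itl_shape:
  fixes f :: "'a::finite nt \<Rightarrow> 'k::comm_semiring_1"
  assumes "f Emp = 0" "\<And>a t. f (Itl a t) = (if a = a0 then g t else 0)" "\<And>a t b s. f (Arc a t b s) = 0"
  shows "ysum f = lt a0 * ysum g"
proof -
  have "ysum f = sc (f Emp) + (\<Sum>a\<in>UNIV. \<Sum>h\<in>{()}. sc (if a = a0 then 1 else 0) * (lt a * ysum g))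
    + (\<Sum>a\<in>UNIV. \<Sum>b\<in>UNIV. \<Sum>h\<in>{()}. \<Sum>h'\<in>{()}. sc 0 * (lt a * (ysum g * (lt b * ysum g))))"
    by (rule ysum_bilinear[where \<mu> = "\<lambda>_. g"]) (simp_all add: assms)
  also have "\<dots> = (\<Sum>a\<in>UNIV. sc (if a = a0 then 1 else 0) * (lt a * ysum g))"
    by (simp add: assms)
  also have "\<dots> = lt a0 * ysum g" by (subst sum_single[of UNIV a0]) auto
  finally show ?thesis .
qed

lemma ysum_Arc_shape:
  fixes f :: "'a::finite nt \<Rightarrow> 'k::comm_semiring_1" and K :: "'j set"
  assumes K: "finite K" and f: "f Emp = 0" "\<And>a t. f (Itl a t) = 0"
    and Arc: "\<And>a t b s. f (Arc a t b s) = (\<Sum>k\<in>K. d a b k * g k t) * g' s"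
  shows "ysum f = (\<Sum>a\<in>UNIV. \<Sum>b\<in>UNIV. \<Sum>k\<in>K. sc (d a b k) * (lt a * (ysum (g k) * lt b))) * ysum g'"
proof -
  let ?J = "insert None (Some ` K)"
  let ?\<mu> = "case_option g' g"
  define C where "C a b h h' = (case (h, h') of (Some k, None) \<Rightarrow> d a b k | _ \<Rightarrow> 0)" for a b h and h' :: "'j option"
  have S: "(\<Sum>j\<in>?J. P j) = P None + (\<Sum>k\<in>K. P (Some k))" for P :: "'j option \<Rightarrow> ('d :: comm_monoid_add)"
    using K by (simp add: sum.reindex)
  have "ysum f = sc (f Emp) + (\<Sum>a\<in>UNIV. \<Sum>h\<in>?J. sc 0 * (lt a * ysum (?\<mu> h)))
    + (\<Sum>a\<in>UNIV. \<Sum>b\<in>UNIV. \<Sum>h\<in>?J. \<Sum>h'\<in>?J. sc (C a b h h') * (lt a * (ysum (?\<mu> h) * (lt b * ysum (?\<mu> h')))))"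
  proof (rule ysum_bilinear)
    show "f (Itl a t) = (\<Sum>h\<in>?J. 0 * ?\<mu> h t)" for a t by (simp add: f)
    show "f (Arc a t b s) = (\<Sum>h\<in>?J. \<Sum>h'\<in>?J. C a b h h' * ?\<mu> h t * ?\<mu> h' s)" for a b t s
      unfolding S by (simp add: Arc C_def sum_distrib_right)
  qed
  also have "\<dots> = (\<Sum>a\<in>UNIV. \<Sum>b\<in>UNIV. \<Sum>k\<in>K. sc (d a b k) * (lt a * (ysum (g k) * (lt b * ysum g'))))"
    unfolding S by (simp add: C_def f)
  finally show ?thesis by (simp add: sum_distrib_right mult.assoc)
qed

text \<open>Removing the first item shows that the sums over all trees coding a phrase obey the
  recursion of \<open>evi \<rho>\<close>; contraction then identifies the two. Inside an arc the
  gain comes from the opening letter.\<close>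

lemma ysum_item_weight:
  fixes \<rho> :: "nat \<Rightarrow> ('a::finite, 'k::comm_semiring_1) ser"
  assumes H: "finite H" "[] \<notin> H" and c: "\<And>a h b. h \<notin> H \<Longrightarrow> c a h b = 0"
    and \<rho>: "\<And>i. \<rho> i = (\<Sum>a\<in>UNIV. \<Sum>b\<in>UNIV. \<Sum>h\<in>H.
        if idx h = i then sc (c a h b) * (lt a * (evi \<rho> h * lt b)) else 0)"
  shows "ysum (item_weight c l) = evi \<rho> l"
proof (rule eqn_induct[of UNIV "\<lambda>l. ysum (item_weight c l)"])
  have nil: "ysum (item_weight c []) = 1"
  proof (rule ser_eqI)
    fix w
    have "cf (ysum (item_weight c [])) w = (\<Sum>t\<in>{t. yield t = w}. if t = Emp then 1 else 0)"
      unfolding cf_ysum by (intro sum.cong) (auto simp: item_weight_def items_Nil)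
    then show "cf (ysum (item_weight c [])) w = cf 1 w" by (auto simp: cf_one)
  qed
  fix n l assume IH: "\<And>l. l \<in> UNIV \<Longrightarrow> eqn n (ysum (item_weight c l)) (evi \<rho> l)"
  show "eqn (Suc n) (ysum (item_weight c l)) (evi \<rho> l)"
  proof (cases l)
    case Nil
    then show ?thesis by (simp add: nil)
  next
    case (Cons x l')
    show ?thesis
    proof (cases x)
      case (Lt a)
      have "ysum (item_weight c l) = lt a * ysum (item_weight c l')"
        by (rule ysum_Itl_shape) (auto simp: item_weight_def Cons Lt)
      then show ?thesis using IH[of l'] by (simp add: Cons Lt eqn_lt)
    next
      case (Dm a b)
      have "ysum (item_weight c l) = (\<Sum>a'\<in>UNIV. \<Sum>b'\<in>UNIV. \<Sum>k\<in>{()}. sc (if a' = a \<and> b' = b then 1 else 0)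
          * (lt a' * (ysum (item_weight c []) * lt b'))) * ysum (item_weight c l')"
        by (rule ysum_Arc_shape) (auto simp: item_weight_def Cons Dm items_Nil)
      also have "(\<Sum>a'\<in>UNIV. \<Sum>b'\<in>UNIV. \<Sum>k\<in>{()}. sc (if a' = a \<and> b' = b then 1 else 0)
          * (lt a' * (ysum (item_weight c []) * lt b'))) = lt a * lt b"
        by (subst sum_single[of UNIV a], simp, simp, force intro!: sum.neutral, subst sum_single[of UNIV b])
           (auto simp: nil)
      finally have "ysum (item_weight c l) = lt a * (lt b * ysum (item_weight c l'))" by (simp add: mult.assoc)
      then show ?thesis using IH[of l'] by (simp add: Cons Dm eqn_lt eqn_mult)
    next
      case (Vr i)
      have "ysum (item_weight c l) = (\<Sum>a\<in>UNIV. \<Sum>b\<in>UNIV. \<Sum>h\<in>H. sc (if idx h = i then c a h b else 0)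
          * (lt a * (ysum (item_weight c h) * lt b))) * ysum (item_weight c l')" (is "_ = ?Y * _")
      proof (rule ysum_Arc_shape[OF H(1)])
        fix a t b s
        show "item_weight c l (Arc a t b s) = (\<Sum>h\<in>H. (if idx h = i then c a h b else 0) * item_weight c h t) * item_weight c l' s"
        proof (cases "items t \<in> H")
          case True
          then have "t \<noteq> Emp" using H(2) by auto
          moreover have "(\<Sum>h\<in>H. (if idx h = i then c a h b else 0) * item_weight c h t) =
              (if idx (items t) = i then c a (items t) b else 0) * code_weight c t"
            by (subst sum_single[OF H(1) True]) (auto simp: item_weight_def)
          ultimately show ?thesis by (simp add: item_weight_def Cons Vr)
        next
          case False
          then have "(\<Sum>h\<in>H. (if idx h = i then c a h b else 0) * item_weight c h t) = 0"
            by (intro sum.neutral) (auto simp: item_weight_def)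
          moreover have "item_weight c l (Arc a t b s) = 0"
            using c[OF False] by (auto simp: item_weight_def Cons Vr)
          ultimately show ?thesis by simp
        qed
      qed (auto simp: item_weight_def Cons Vr)
      moreover have "eqn (Suc n) ?Y (\<rho> i)"
      proof -
        have "eqn (Suc n) ?Y (\<Sum>a\<in>UNIV. \<Sum>b\<in>UNIV. \<Sum>h\<in>H. sc (if idx h = i then c a h b else 0)
            * (lt a * (evi \<rho> h * lt b)))"
          by (intro eqn_sum eqn_mult[of "Suc n"] eqn_refl eqn_lt eqn_mult[of n] IH) simp
        also have "(\<Sum>a\<in>UNIV. \<Sum>b\<in>UNIV. \<Sum>h\<in>H. sc (if idx h = i then c a h b else 0)
            * (lt a * (evi \<rho> h * lt b))) = \<rho> i"
          by (subst \<rho>) (intro sum.cong refl, simp)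
        finally show ?thesis .
      qed
      \<comment> \<open>With this, agreement on the remaining items up to \<open>n\<close> is
        enough.\<close>
      moreover have "cf (\<rho> i) [] = 0" by (subst \<rho>) (simp add: if_distrib[of "\<lambda>f. cf f _"] cong: if_cong)
      ultimately show ?thesis using IH[of l'] by (simp add: Cons Vr eqn_mult_left)
    qed
  qed
qed simp

lemma code_weight_letters: "items t = map Lt w \<Longrightarrow> code_weight c t = 1"
  by (induction t arbitrary: w) auto

text \<open>\<open>items_at w \<nu> p l\<close>: the items that follow position \<open>p\<close> up to the end of its block are \<open>l\<close>.\<close>

fun idx_at :: "nat \<Rightarrow> (nat \<times> nat) set \<Rightarrow> nat \<Rightarrow> nat \<Rightarrow> bool" where
  "idx_at n \<nu> p 0 = (\<not> (Suc p \<le> n \<and> Suc p \<notin> Field \<nu>))"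
| "idx_at n \<nu> p (Suc i) = (Suc p \<le> n \<and> Suc p \<notin> Field \<nu> \<and> idx_at n \<nu> (Suc p) i)"

fun items_at :: "'a list \<Rightarrow> (nat \<times> nat) set \<Rightarrow> nat \<Rightarrow> 'a item list \<Rightarrow> bool" where
  "items_at w \<nu> p [] = (\<not> (Suc p \<le> length w \<and> Suc p \<notin> Range \<nu>))"
| "items_at w \<nu> p (Lt a # l) =
     (Suc p \<le> length w \<and> w ! p = a \<and> Suc p \<notin> Field \<nu> \<and> items_at w \<nu> (Suc p) l)"
| "items_at w \<nu> p (Dm a b # l) =
     (w ! p = a \<and> (Suc p, p + 2) \<in> \<nu> \<and> w ! Suc p = b \<and> items_at w \<nu> (p + 2) l)"
| "items_at w \<nu> p (Vr i # l) =
     (\<exists>q. (Suc p, q) \<in> \<nu> \<and> q \<noteq> p + 2 \<and> idx_at (length w) \<nu> (Suc p) i \<and> items_at w \<nu> q l)"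

text \<open>A block ends where a formula can see it: just before a return, or at the end of the
  word.\<close>

definition block_end :: "nat \<Rightarrow> (nat \<times> nat) set \<Rightarrow> nat \<Rightarrow> bool" where
  "block_end n \<nu> e \<longleftrightarrow> \<not> (Suc e \<le> n \<and> Suc e \<notin> Range \<nu>)"

lemma idx_at_emb:
  assumes N: "\<nu> \<in> Nest (length w)"
  shows "emb w \<nu> k t \<Longrightarrow> block_end (length w) \<nu> (k + len t) \<Longrightarrow> idx_at (length w) \<nu> k i \<longleftrightarrow> idx (items t) = i"
proof (induction t arbitrary: k i)
  case Emp
  then show ?case by (cases i) (auto simp: block_end_def Field_def)
next
  case (Itl a t)
  then show ?case by (cases i) auto
next
  case (Arc a t b s)
  then have "Suc k \<in> Field \<nu>" by (auto intro: FieldI1)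
  then show ?case by (cases i) auto
qed

text \<open>\<open>items_at\<close> inspects letters, positions and \<nu> only, so it can be written
  as a formula; on a factor with a visible end it agrees with the recursive
  \<open>items\<close>.\<close>

lemma items_at_emb:
  assumes N: "\<nu> \<in> Nest (length w)"
  shows "emb w \<nu> k t \<Longrightarrow> block_end (length w) \<nu> (k + len t) \<Longrightarrow> items_at w \<nu> k l \<longleftrightarrow> items t = l"
proof (induction t arbitrary: k l)
  case Emp
  have nocall: "(Suc k, j) \<notin> \<nu>" for j
  proof
    assume j: "(Suc k, j) \<in> \<nu>"
    with Emp Nest_bounds[OF N j] have "Suc k \<in> Range \<nu>" by (auto simp: block_end_def)
    with Nest_call_not_return[OF N _ j] show False by blast
  qed
  show ?case
  proof (cases l)
    case Nil then show ?thesis using Emp by (auto simp: block_end_def)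
  next
    case (Cons x l')
    then show ?thesis using Emp nocall by (cases x) (auto simp: block_end_def Field_def)
  qed
next
  case (Itl a t)
  have nocall: "(Suc k, j) \<notin> \<nu>" for j using Itl.prems by (auto intro: FieldI1)
  show ?case
  proof (cases l)
    case Nil then show ?thesis using Itl.prems by (auto simp: Field_def)
  next
    case (Cons x l')
    then show ?thesis using Itl nocall by (cases x) auto
  qed
next
  case (Arc a t b s)
  let ?r = "k + len t + 2"
  have arc: "(Suc k, ?r) \<in> \<nu>" using Arc.prems by simp
  have q: "(Suc k, q) \<in> \<nu> \<longleftrightarrow> q = ?r" for q using arc Nest_functional[OF N arc] by blast
  have noret: "Suc k \<notin> Range \<nu>" using Nest_call_not_return[OF N _ arc] by blast
  have fld: "Suc k \<in> Field \<nu>" using arc by (rule FieldI1)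
  have s: "items_at w \<nu> ?r l' \<longleftrightarrow> items s = l'" for l'
    using Arc.prems by (intro Arc.IH(2)) (auto simp: add_ac)
  have t: "idx_at (length w) \<nu> (Suc k) i \<longleftrightarrow> idx (items t) = i" for i
    using Arc.prems arc by (intro idx_at_emb[OF N]) (auto simp: block_end_def)
  have e: "?r = k + 2 \<longleftrightarrow> t = Emp" by (auto simp: yield_eq_Nil)
  show ?case
  proof (cases l)
    case Nil then show ?thesis using Arc.prems noret by auto
  next
    case (Cons x l')
    show ?thesis
    proof (cases x)
      case (Lt c)
      then show ?thesis using Cons fld by simp
    next
      case (Dm c d)
      show ?thesis
      proof (cases "t = Emp")
        case True
        have "(Suc k, k + 2) \<in> \<nu>" "items_at w \<nu> (k + 2) l' \<longleftrightarrow> items s = l'" using arc s[of l'] True by simp_all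
        moreover have "w ! k = a" "w ! Suc k = b" using Arc.prems True by simp_all
        ultimately show ?thesis unfolding Cons Dm items_at.simps items.simps using True by auto
      next
        case False
        then have "(Suc k, k + 2) \<notin> \<nu>" using q[of "k + 2"] e by auto
        then show ?thesis unfolding Cons Dm items_at.simps items.simps using False by simp
      qed
    next
      case (Vr i)
      have "items_at w \<nu> k l \<longleftrightarrow> ?r \<noteq> k + 2 \<and> idx_at (length w) \<nu> (Suc k) i \<and> items_at w \<nu> ?r l'"
        unfolding Cons Vr items_at.simps q by blast
      then show ?thesis unfolding e s t Cons Vr items.simps by simp
    qed
  qed
qed

subsection \<open>First-order formulas for the code\<close>

fun fv :: "'a mso \<Rightarrow> nat set" where
  "fv (MAt a) = atom_vars1 a"
| "fv (MNeg p) = fv p"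
| "fv (MOr p q) = fv p \<union> fv q"
| "fv (MEx1 x p) = fv p - {x}"
| "fv (MEx2 X p) = fv p"

lemma fv_mand [simp]: "fv (mand p q) = fv p \<union> fv q" and fv_mlt [simp]: "fv (mlt x y) = {y, x}"
  and vars2_mand [simp]: "vars2 (mand p q) = vars2 p \<union> vars2 q" and vars2_mlt [simp]: "vars2 (mlt x y) = {}"
  by (simp_all add: mand_def mlt_def)

lemma fv_subst1: "fv (subst1 x y p) \<subseteq> (fv p - {x}) \<union> {y}"
proof (induction p)
  case (MAt a) then show ?case by (cases a) auto
qed auto

lemma vars2_subst1 [simp]: "vars2 (subst1 x y p) = vars2 p"
proof (induction p)
  case (MAt a) then show ?case by (cases a) auto
qed auto

lemma wfree1_pm:
  fixes p :: "'a mso"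
  shows "fo p \<Longrightarrow> wfree1 (pm b p :: ('a, 'k) wf) \<subseteq> fv p"
proof (induction b p rule: pm.induct)
  case (6 x p)
  let ?y = "fresh1 (MEx1 x p)"
  have "wfree1 (pm False (mand (mlt ?y x) (subst1 x ?y p)) :: ('a, 'k) wf) \<subseteq> {x, ?y} \<union> fv (subst1 x ?y p)"
    using 6 by auto
  also have "\<dots> \<subseteq> {x, ?y} \<union> fv p" using fv_subst1[of x ?y p] by blast
  finally show ?case using 6 by (simp only: pm.simps wfree1.simps fv.simps fo.simps) blast
qed auto

lemma wfree2_pm: "fo p \<Longrightarrow> vars2 p = {} \<Longrightarrow> wfree2 (pm b p) = {}"
  by (induction b p rule: pm.induct) auto

lemma WAll1_pm: "WAll1 x q \<in> subformulas (pm b p) \<Longrightarrow> q \<in> aUMSO"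
  by (induction b p rule: pm.induct) (auto intro: pm_aUMSO)

text \<open>The bound variable \<open>Suc (x + y)\<close> differs from both \<open>x\<close> and
  \<open>y\<close>.\<close>

definition fsucc :: "nat \<Rightarrow> nat \<Rightarrow> 'a mso" where
  "fsucc x y = mand (mlt x y)
     (MNeg (MEx1 (Suc (x + y)) (mand (mlt x (Suc (x + y))) (mlt (Suc (x + y)) y))))"

definition ffirst :: "nat \<Rightarrow> 'a mso" where
  "ffirst x = MNeg (MEx1 (Suc x) (mlt (Suc x) x))"

definition fcall :: "nat \<Rightarrow> 'a mso" where
  "fcall x = MEx1 (Suc x) (MAt (ANu x (Suc x)))"

definition fret :: "nat \<Rightarrow> 'a mso" where
  "fret x = MEx1 (Suc x) (MAt (ANu (Suc x) x))"

definition fint :: "nat \<Rightarrow> 'a mso" where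
  "fint x = mand (MNeg (fcall x)) (MNeg (fret x))"

lemma msat_fsucc:
  assumes "s y \<in> {1..length w}"
  shows "msat (w, \<nu>) s (fsucc x y) \<longleftrightarrow> s y = Suc (s x)"
proof -
  have "msat (w, \<nu>) s (fsucc x y) \<longleftrightarrow> s x < s y \<and> \<not> (\<exists>i\<in>{1..length w}. s x < i \<and> i < s y)"
    by (simp add: fsucc_def)
  also have "\<dots> \<longleftrightarrow> s y = Suc (s x)"
  proof
    assume *: "s x < s y \<and> \<not> (\<exists>i\<in>{1..length w}. s x < i \<and> i < s y)"
    have "Suc (s x) \<in> {1..length w}" using * assms by auto
    with * have "\<not> Suc (s x) < s y" by blast
    with * show "s y = Suc (s x)" by linarith
  qed auto
  finally show ?thesis .
qed

lemma msat_ffirst: "s x \<in> {1..length w} \<Longrightarrow> msat (w, \<nu>) s (ffirst x) \<longleftrightarrow> s x = 1"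
proof -
  assume x: "s x \<in> {1..length w}"
  then have "1 \<in> {1..length w}" by auto
  have "msat (w, \<nu>) s (ffirst x) \<longleftrightarrow> \<not> (\<exists>i\<in>{1..length w}. i < s x)" by (simp add: ffirst_def)
  also have "\<dots> \<longleftrightarrow> s x = 1"
  proof
    assume "\<not> (\<exists>i\<in>{1..length w}. i < s x)"
    with \<open>1 \<in> {1..length w}\<close> have "\<not> 1 < s x" by blast
    with x show "s x = 1" by simp
  qed auto
  finally show ?thesis .
qed

lemma msat_fcall: "\<nu> \<in> Nest (length w) \<Longrightarrow> msat (w, \<nu>) s (fcall x) \<longleftrightarrow> s x \<in> Domain \<nu>"
  using Nest_bounds[of \<nu> "length w" "s x"] by (fastforce simp: fcall_def)

lemma msat_fret: "\<nu> \<in> Nest (length w) \<Longrightarrow> msat (w, \<nu>) s (fret x) \<longleftrightarrow> s x \<in> Range \<nu>"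
  using Nest_bounds[of \<nu> "length w" _ "s x"] by (fastforce simp: fret_def)

lemma msat_fint: "\<nu> \<in> Nest (length w) \<Longrightarrow> msat (w, \<nu>) s (fint x) \<longleftrightarrow> s x \<notin> Field \<nu>"
  by (auto simp: fint_def msat_fcall msat_fret Field_def)

text \<open>The argument \<open>N\<close> says of \<open>v\<close> that it is the first position of the remaining items.\<close>

fun fidx :: "'a mso \<Rightarrow> nat \<Rightarrow> nat \<Rightarrow> 'a mso" where
  "fidx N v 0 = MNeg (MEx1 v (mand N (fint v)))"
| "fidx N v (Suc i) = MEx1 v (mand N (mand (fint v) (fidx (fsucc v (Suc v)) (Suc v) i)))"

fun fitems :: "'a mso \<Rightarrow> nat \<Rightarrow> 'a item list \<Rightarrow> 'a mso" where
  "fitems N v [] = MNeg (MEx1 v (mand N (MNeg (fret v))))"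
| "fitems N v (Lt a # l) = MEx1 v (mand N (mand (MAt (ALab a v)) (mand (fint v)
     (fitems (fsucc v (Suc v)) (Suc v) l))))"
| "fitems N v (Dm a b # l) = MEx1 v (mand N (mand (MAt (ALab a v))
     (MEx1 (Suc v) (mand (fsucc v (Suc v)) (mand (MAt (ANu v (Suc v))) (mand (MAt (ALab b (Suc v)))
       (fitems (fsucc (Suc v) (Suc (Suc v))) (Suc (Suc v)) l)))))))"
| "fitems N v (Vr i # l) = MEx1 v (mand N (MEx1 (Suc v) (mand (MAt (ANu v (Suc v)))
     (mand (MNeg (fsucc v (Suc v))) (mand (fidx (fsucc v (Suc (Suc v))) (Suc (Suc v)) i)
       (fitems (fsucc (Suc v) (Suc (Suc v))) (Suc (Suc v)) l))))))"

lemma fo_formulas [simp]: "fo (fsucc x y)" "fo (ffirst x)" "fo (fcall x)" "fo (fret x)" "fo (fint x)"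
  by (simp_all add: fsucc_def ffirst_def fcall_def fret_def fint_def)

lemma vars2_formulas [simp]:
  "vars2 (fsucc x y) = {}" "vars2 (ffirst x) = {}" "vars2 (fcall x) = {}" "vars2 (fret x) = {}" "vars2 (fint x) = {}"
  by (simp_all add: fsucc_def ffirst_def fcall_def fret_def fint_def)

lemma fv_formulas [simp]:
  "fv (fsucc x y) = {x, y}" "fv (ffirst x) = {x}" "fv (fcall x) = {x}" "fv (fret x) = {x}" "fv (fint x) = {x}"
  by (auto simp: fsucc_def ffirst_def fcall_def fret_def fint_def)

lemma fidx_simps [simp]: "fo N \<Longrightarrow> fo (fidx N v i)" "vars2 N = {} \<Longrightarrow> vars2 (fidx N v i) = {}"
  and fv_fidx: "fv (fidx N v i) \<subseteq> fv N - {v}"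
proof -
  show "fo N \<Longrightarrow> fo (fidx N v i)" by (induction i arbitrary: N v) auto
  show "vars2 N = {} \<Longrightarrow> vars2 (fidx N v i) = {}" by (induction i arbitrary: N v) auto
  show "fv (fidx N v i) \<subseteq> fv N - {v}" by (induction i arbitrary: N v) fastforce+
qed

lemma fitems_simps [simp]: "fo N \<Longrightarrow> fo (fitems N v l)" "vars2 N = {} \<Longrightarrow> vars2 (fitems N v l) = {}"
  by (induction N v l rule: fitems.induct) auto

lemma fv_fitems: "fv (fitems N v l) \<subseteq> fv N - {v}"
proof (induction N v l rule: fitems.induct)
  case (4 N v i l)
  then show ?case using fv_fidx[of "fsucc v (Suc (Suc v))" "Suc (Suc v)" i] by fastforce
qed fastforce+

text \<open>\<open>N\<close> pins \<open>v\<close> to \<open>Suc p\<close> whatever values the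
  variables above \<open>v\<close> have. Bound variables are taken in increasing order, so nested
  formulas never overwrite one that is still in use.\<close>

definition starts :: "'a list \<Rightarrow> (nat \<times> nat) set \<Rightarrow> 'a mso \<Rightarrow> nat \<Rightarrow> (nat \<Rightarrow> nat) \<Rightarrow> nat \<Rightarrow> bool" where
  "starts w \<nu> N v s p \<longleftrightarrow> (\<forall>s'. (\<forall>y<v. s' y = s y) \<longrightarrow> s' v \<in> {1..length w} \<longrightarrow>
      (msat (w, \<nu>) s' N \<longleftrightarrow> s' v = Suc p))"

lemma starts_upd: "starts w \<nu> N v s p \<Longrightarrow> j \<in> {1..length w} \<Longrightarrow> msat (w, \<nu>) (s(v := j)) N \<longleftrightarrow> j = Suc p"
  unfolding starts_def by (metis fun_upd_other fun_upd_same nat_neq_iff)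

lemma starts_fsucc: "u < v \<Longrightarrow> starts w \<nu> (fsucc u v) v s (s u)"
  unfolding starts_def by (simp add: msat_fsucc)

lemma starts_ffirst: "starts w \<nu> (ffirst v) v s 0"
  unfolding starts_def by (simp add: msat_ffirst)

lemma Bex_starts: 
  assumes "starts w \<nu> N v s p"
  shows "(\<exists>j\<in>{1..length w}. msat (w, \<nu>) (s(v := j)) N \<and> P j) \<longleftrightarrow> Suc p \<le> length w \<and> P (Suc p)"
  using starts_upd[OF assms] by auto

lemma msat_fidx:
  assumes N: "\<nu> \<in> Nest (length w)"
  shows "starts w \<nu> A v s p \<Longrightarrow> msat (w, \<nu>) s (fidx A v i) \<longleftrightarrow> idx_at (length w) \<nu> p i"
proof (induction i arbitrary: A v s p)
  case 0
  then show ?case by (simp add: Bex_starts[OF 0, simplified] msat_fint[OF N])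
next
  case (Suc i)
  have st: "starts w \<nu> (fsucc v (Suc v)) (Suc v) (s(v := Suc p)) (Suc p)"
    using starts_fsucc[of v "Suc v" w \<nu> "s(v := Suc p)"] by simp
  then show ?case
    by (simp add: Bex_starts[OF Suc.prems, simplified] msat_fint[OF N] Suc.IH[OF st])
qed

lemma msat_fitems:
  assumes N: "\<nu> \<in> Nest (length w)"
  shows "starts w \<nu> A v s p \<Longrightarrow> msat (w, \<nu>) s (fitems A v l) \<longleftrightarrow> items_at w \<nu> p l"
proof (induction A v l arbitrary: s p rule: fitems.induct)
  case (1 A v)
  then show ?case by (simp add: Bex_starts[OF 1, simplified] msat_fret[OF N])
next
  case (2 A v a l)
  have st: "starts w \<nu> (fsucc v (Suc v)) (Suc v) (s(v := Suc p)) (Suc p)"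
    using starts_fsucc[of v "Suc v" w \<nu> "s(v := Suc p)"] by simp
  then show ?case
    by (auto simp: Bex_starts[OF "2.prems", simplified] msat_fint[OF N] "2.IH"[OF st])
next
  case (3 A v a b l)
  let ?s = "s(v := Suc p)"
  have 1: "starts w \<nu> (fsucc v (Suc v)) (Suc v) ?s (Suc p)"
    using starts_fsucc[of v "Suc v" w \<nu> ?s] by simp
  have 2: "starts w \<nu> (fsucc (Suc v) (Suc (Suc v))) (Suc (Suc v)) (?s(Suc v := Suc (Suc p))) (Suc (Suc p))"
    using starts_fsucc[of "Suc v" "Suc (Suc v)" w \<nu> "?s(Suc v := Suc (Suc p))"] by simp
  show ?case using Nest_bounds[OF N, of "Suc p" "Suc (Suc p)"]
    by (auto simp: Bex_starts[OF "3.prems", simplified] Bex_starts[OF 1, simplified] "3.IH"[OF 2])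
next
  case (4 A v i l)
  let ?s = "s(v := Suc p)"
  have 1: "starts w \<nu> (fsucc v (Suc (Suc v))) (Suc (Suc v)) (?s(Suc v := q)) (Suc p)" for q
    using starts_fsucc[of v "Suc (Suc v)" w \<nu> "?s(Suc v := q)"] by simp
  have 2: "starts w \<nu> (fsucc (Suc v) (Suc (Suc v))) (Suc (Suc v)) (?s(Suc v := q)) q" for q
    using starts_fsucc[of "Suc v" "Suc (Suc v)" w \<nu> "?s(Suc v := q)"] by simp
  have "msat (w, \<nu>) s (fitems A v (Vr i # l)) \<longleftrightarrow> Suc p \<le> length w \<and>
      (\<exists>q\<in>{1..length w}. (Suc p, q) \<in> \<nu> \<and> \<not> msat (w, \<nu>) (?s(Suc v := q)) (fsucc v (Suc v))
        \<and> idx_at (length w) \<nu> (Suc p) i \<and> items_at w \<nu> q l)"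
    by (simp add: Bex_starts[OF "4.prems", simplified] msat_fidx[OF N 1] "4.IH"[OF 2])
  also have "\<dots> \<longleftrightarrow> Suc p \<le> length w \<and>
      (\<exists>q\<in>{1..length w}. (Suc p, q) \<in> \<nu> \<and> q \<noteq> p + 2 \<and> idx_at (length w) \<nu> (Suc p) i \<and> items_at w \<nu> q l)"
    by (intro conj_cong bex_cong refl) (simp add: msat_fsucc)
  also have "\<dots> \<longleftrightarrow> items_at w \<nu> p (Vr i # l)"
    using Nest_bounds[OF N, of "Suc p"] by fastforce
  finally show ?case .
qed

text \<open>Variable 0 is the call and 1 its return; the phrase is read with variables from 2
  on.\<close>

definition fphrase :: "'a \<Rightarrow> 'a item list \<Rightarrow> 'a \<Rightarrow> 'a mso" where
  "fphrase a h b = mand (MAt (ALab a 0))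
     (mand (MEx1 1 (mand (MAt (ANu 0 1)) (MAt (ALab b 1)))) (fitems (fsucc 0 2) 2 h))"

definition fproper :: "'a mso" where
  "fproper = MEx1 1 (mand (MAt (ANu 0 1)) (MNeg (fsucc 0 1)))"

lemma msat_fphrase:
  assumes N: "\<nu> \<in> Nest (length w)" and "s 0 = Suc k" "k < length w"
  shows "msat (w, \<nu>) s (fphrase a h b) \<longleftrightarrow>
    w ! k = a \<and> (\<exists>q. (Suc k, q) \<in> \<nu> \<and> w ! (q - 1) = b) \<and> items_at w \<nu> (Suc k) h"
proof -
  have "msat (w, \<nu>) s (fitems (fsucc 0 2) 2 h) \<longleftrightarrow> items_at w \<nu> (Suc k) h"
    using starts_fsucc[of 0 2 w \<nu> s] assms by (intro msat_fitems[OF N]) simp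
  then have "msat (w, \<nu>) s (fphrase a h b) \<longleftrightarrow>
    w ! k = a \<and> (\<exists>q\<in>{1..length w}. (Suc k, q) \<in> \<nu> \<and> w ! (q - 1) = b) \<and> items_at w \<nu> (Suc k) h"
    using assms by (auto simp: fphrase_def)
  moreover have "(\<exists>q\<in>{1..length w}. (Suc k, q) \<in> \<nu> \<and> w ! (q - 1) = b) \<longleftrightarrow>
      (\<exists>q. (Suc k, q) \<in> \<nu> \<and> w ! (q - 1) = b)"
    using Nest_bounds[OF N, of "Suc k"] by fastforce
  ultimately show ?thesis by simp
qed

lemma msat_fproper:
  assumes N: "\<nu> \<in> Nest (length w)" and "s 0 = Suc k"
  shows "msat (w, \<nu>) s fproper \<longleftrightarrow> (\<exists>q. (Suc k, q) \<in> \<nu> \<and> q \<noteq> k + 2)"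
proof -
  have "msat (w, \<nu>) s fproper \<longleftrightarrow> (\<exists>q\<in>{1..length w}. (Suc k, q) \<in> \<nu> \<and> q \<noteq> k + 2)"
    unfolding fproper_def msat.simps fst_conv
    by (rule bex_cong) (use assms in \<open>auto simp: msat_fsucc\<close>)
  also have "\<dots> \<longleftrightarrow> (\<exists>q. (Suc k, q) \<in> \<nu> \<and> q \<noteq> k + 2)"
    using Nest_bounds[OF N, of "Suc k"] by fastforce
  finally show ?thesis .
qed

lemma formula_facts [simp]:
  "fo (fphrase a h b)" "fo fproper" "vars2 (fphrase a h b) = {}" "vars2 fproper = {}"
  by (simp_all add: fphrase_def fproper_def)

lemma fv_fphrase: "fv (fphrase a h b) \<subseteq> {0}" and fv_fproper: "fv fproper \<subseteq> {0}"
  using fv_fitems[of "fsucc 0 2" 2 h] by (auto simp: fphrase_def fproper_def)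

text \<open>A weighted disjunction that stays within \<open>aUMSO\<close>. It acts as a case
  distinction when at most one alternative holds.\<close>

fun choice :: "('b \<Rightarrow> 'k) \<Rightarrow> ('b \<Rightarrow> 'a mso) \<Rightarrow> ('a, 'k) wf \<Rightarrow> 'b list \<Rightarrow> ('a, 'k) wf" where
  "choice c f d [] = d"
| "choice c f d (x # xs) = WOr (WAnd (WConst (c x)) (pm True (f x))) (choice c f d xs)"

lemma wsem_choice:
  fixes c :: "'b \<Rightarrow> 'k::comm_semiring_1"
  assumes "\<And>x. fo (f x)" "distinct xs"
  shows "wsem nw s (\<lambda>_. {}) (choice c f d xs) =
    (\<Sum>x\<in>set xs. if msat nw s (f x) then c x else 0) + wsem nw s (\<lambda>_. {}) d"
  using assms(2) by (induction xs) (auto simp: wsem_pm assms(1) add.assoc)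

lemma choice_aUMSO: "d \<in> aUMSO \<Longrightarrow> choice c f d xs \<in> aUMSO"
  by (induction xs) (auto intro: aUMSO.intros pm_aUMSO)

lemma choice_no_so: "(\<And>x. fo (f x)) \<Longrightarrow> no_so_quant d \<Longrightarrow> no_so_quant (choice c f d xs)"
  by (induction xs) (auto simp: no_so_pm)

lemma choice_WAll1: "WAll1 x q \<in> subformulas (choice c f d xs) \<Longrightarrow>
    (WAll1 x q \<in> subformulas d \<Longrightarrow> q \<in> aUMSO) \<Longrightarrow> q \<in> aUMSO"
  by (induction xs) (auto dest: WAll1_pm)

lemma choice_wfree1:
  "(\<And>x. fo (f x)) \<Longrightarrow> (\<And>x. fv (f x) \<subseteq> V) \<Longrightarrow> wfree1 d \<subseteq> V \<Longrightarrow> wfree1 (choice c f d xs) \<subseteq> V"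
proof (induction xs)
  case (Cons x xs)
  then show ?case using wfree1_pm[of "f x" True] by fastforce
qed simp

lemma choice_wfree2:
  "(\<And>x. fo (f x)) \<Longrightarrow> (\<And>x. vars2 (f x) = {}) \<Longrightarrow> wfree2 d = {} \<Longrightarrow> wfree2 (choice c f d xs) = {}"
  by (induction xs) (auto simp: wfree2_pm)

text \<open>The local weight of a position: the coefficient of the phrase at the call of a nonempty
  arc, and 1 elsewhere through the default.\<close>

definition psi :: "('a \<Rightarrow> 'a item list \<Rightarrow> 'a \<Rightarrow> 'k::comm_semiring_1) \<Rightarrow> ('a \<times> 'a item list \<times> 'a) list \<Rightarrow> ('a, 'k) wf" where
  "psi c = choice (\<lambda>(a, h, b). c a h b) (\<lambda>(a, h, b). fphrase a h b) (pm False fproper)"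

text \<open>At a nonempty arc both letters and the phrase are determined, so at most one summand
  survives, and the default is 0. At a dummy arc the phrase is empty and not in \<open>H\<close>, so
  just the default 1 remains.\<close>

lemma wsem_psi_prod:
  fixes c :: "'a::finite \<Rightarrow> 'a item list \<Rightarrow> 'a \<Rightarrow> 'k::comm_semiring_1"
  assumes N: "\<nu> \<in> Nest (length w)" and xs: "distinct xs" "set xs = UNIV \<times> H \<times> UNIV"
    and H: "[] \<notin> H" and c: "\<And>a h b. h \<notin> H \<Longrightarrow> c a h b = 0"
  shows "emb w \<nu> k t \<Longrightarrow> (\<Prod>x\<in>{k<..k + len t}. wsem (w, \<nu>) (s(0 := x)) (\<lambda>_. {}) (psi c xs)) = code_weight c t"
proof -
  define W where "W = (\<lambda>x. wsem (w, \<nu>) (s(0 := x)) (\<lambda>_. {}) (psi c xs))"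
  have G: "W (Suc k) = (\<Sum>(a, h, b)\<in>set xs. if msat (w, \<nu>) (s(0 := Suc k)) (fphrase a h b) then c a h b else 0)
      + (if \<exists>q. (Suc k, q) \<in> \<nu> \<and> q \<noteq> k + 2 then 0 else 1)" for k
    unfolding W_def psi_def by (subst wsem_choice[OF _ xs(1)]) (auto simp: wsem_pm msat_fproper[OF N] case_prod_unfold cong: if_cong)
  have quiet: "W (Suc k) = 1" if "k < length w" "\<And>q. (Suc k, q) \<notin> \<nu>" for k
    unfolding G using that by (auto simp: msat_fphrase[OF N] intro!: sum.neutral)
  have call: "W (Suc k) = (if t = Emp then 1 else c a (items t) b)" if e: "emb w \<nu> k (Arc a t b s')" for k a t b s'
  proof -
    let ?r = "k + len t + 2"
    have arc: "(Suc k, ?r) \<in> \<nu>" using e by simp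
    have q: "(Suc k, q) \<in> \<nu> \<longleftrightarrow> q = ?r" for q using arc Nest_functional[OF N arc] by blast
    have "items_at w \<nu> (Suc k) h \<longleftrightarrow> items t = h" for h
      using e arc by (intro items_at_emb[OF N]) (auto simp: block_end_def)
    then have "msat (w, \<nu>) (s(0 := Suc k)) (fphrase a' h b') \<longleftrightarrow> (a', h, b') = (a, items t, b)" for a' h b'
      using e by (auto simp: msat_fphrase[OF N] q)
    then have "(\<Sum>(a', h, b')\<in>set xs. if msat (w, \<nu>) (s(0 := Suc k)) (fphrase a' h b') then c a' h b' else 0) =
        (\<Sum>x\<in>set xs. if x = (a, items t, b) then c a (items t) b else 0)"
      by (intro sum.cong) (auto split: if_splits)
    also have "\<dots> = (if items t \<in> H then c a (items t) b else 0)" by (subst sum.delta[OF finite_set]) (simp add: xs(2))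
    also have "\<dots> = (if t = Emp then 0 else c a (items t) b)" using H c by auto
    finally show ?thesis unfolding G q by (auto simp: yield_eq_Nil)
  qed
  have "emb w \<nu> k t \<Longrightarrow> prod W {k<..k + len t} = code_weight c t"
  proof (induction t arbitrary: k)
    case (Itl a t)
    have "W (Suc k) = 1" using Itl.prems by (intro quiet) (auto intro: FieldI1)
    moreover have "prod W {Suc k<..Suc k + len t} = code_weight c t" using Itl.prems by (intro Itl.IH) simp
    ultimately show ?case using prod.split_Itl[of W k "len t"] by simp
  next
    case (Arc a t b u)
    have "(Suc k, k + len t + 2) \<in> \<nu>" using Arc.prems by simp
    then have "W (Suc (k + len t + 1)) = 1"
      using Arc.prems Nest_call_not_return[OF N] by (intro quiet) auto
    moreover have "prod W {Suc k<..Suc k + len t} = code_weight c t" using Arc.prems by (intro Arc.IH(1)) simp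
    moreover have "prod W {k + len t + 2<..k + len t + 2 + len u} = code_weight c u" using Arc.prems by (intro Arc.IH(2)) simp
    moreover note call[OF Arc.prems]
    ultimately show ?case using prod.split_Arc[of W k "len t" "len u"] by (auto simp: mult_ac)
  qed simp
  then show "emb w \<nu> k t \<Longrightarrow> (\<Prod>x\<in>{k<..k + len t}. wsem (w, \<nu>) (s(0 := x)) (\<lambda>_. {}) (psi c xs)) = code_weight c t"
    by (simp only: W_def)
qed

section \<open>From algebraic series to logic\<close>

text \<open>A word of length at most \<open>m\<close> gets its coefficient from a disjunct that
  holds for the empty nesting relation only. Longer words are covered by \<open>long\<close>: one
  arc spans the whole word and announces \<open>i0\<close>, and the product over positions is the
  weight of the derivation.\<close>

lemma algebraic_imp_logic:
  fixes S :: "'a::finite list \<Rightarrow> 'k::comm_semiring_1"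
  assumes "algebraic S"
  shows "\<exists>\<phi> :: ('a, 'k) wf. \<phi> \<in> sRFO \<and> sentence \<phi> \<and> nest_sem \<phi> = S"
proof -
  have S: "tree_series (Ser S)" "S [] = 0" using assms by (simp_all add: algebraic_iff_tree_series)
  obtain m H i0 and \<rho> :: "nat \<Rightarrow> ('a, 'k) ser" and c :: "'a \<Rightarrow> 'a item list \<Rightarrow> 'a \<Rightarrow> 'k"
    where H: "finite H" "[] \<notin> H" and c: "\<And>a h b. h \<notin> H \<Longrightarrow> c a h b = 0" and i0: "\<rho> i0 = longer m (Ser S)"
    and \<rho>: "\<And>i. \<rho> i = (\<Sum>a\<in>UNIV. \<Sum>b\<in>UNIV. \<Sum>h\<in>H.
        if idx h = i then sc (c a h b) * (lt a * (evi \<rho> h * lt b)) else 0)"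
    using S(1) by (rule tree_series_imp_coded) (rule that; assumption)
  have ysumF: "ysum (item_weight c l) = evi \<rho> l" for l using H c \<rho> by (rule ysum_item_weight)
  have "finite ((UNIV :: 'a set) \<times> H \<times> (UNIV :: 'a set))" using H(1) by simp
  then obtain xs where xs: "set xs = (UNIV :: 'a set) \<times> H \<times> (UNIV :: 'a set)" "distinct xs"
    using finite_distinct_list by blast
  have "finite {w :: 'a list. length w \<le> m}" using finite_lists_length_le[of "UNIV :: 'a set" m] by simp
  then obtain ws where ws: "set ws = {w :: 'a list. length w \<le> m}" "distinct ws"
    using finite_distinct_list by blast
  let ?root = "fitems (ffirst 0) 0 [Vr i0] :: 'a mso"
  define long where "long = WAnd (pm True ?root) (WAll1 0 (psi c xs))"
  define \<phi> where "\<phi> = choice S (\<lambda>w. fitems (ffirst 0) 0 (map Lt w)) long ws"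
  have psi: "psi c xs \<in> aUMSO" "no_so_quant (psi c xs)"
    unfolding psi_def by (auto intro!: choice_aUMSO pm_aUMSO choice_no_so simp: no_so_pm)
  have psi1: "wfree1 (psi c xs) \<subseteq> {0}"
    unfolding psi_def
  proof (rule choice_wfree1)
    show "wfree1 (pm False fproper) \<subseteq> {0}"
      using wfree1_pm[OF formula_facts(2)] fv_fproper by (rule subset_trans)
  qed (use subsetD[OF fv_fphrase] in \<open>auto split: prod.splits\<close>)
  have psi2: "wfree2 (psi c xs) = {}"
    unfolding psi_def by (rule choice_wfree2) (auto simp: wfree2_pm split: prod.splits)
  have fv0: "fv (fitems (ffirst 0) 0 l) = {}" for l :: "'a item list"
    using fv_fitems[of "ffirst 0" 0 l] by auto
  have "no_so_quant \<phi>" unfolding \<phi>_def long_def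
    by (intro choice_no_so) (simp_all add: no_so_pm psi del: fitems.simps)
  moreover have "q \<in> aUMSO" if "WAll1 x q \<in> subformulas \<phi>" for x q
  proof (rule choice_WAll1[OF that[unfolded \<phi>_def]])
    assume "WAll1 x q \<in> subformulas long"
    then consider "q = psi c xs" | "WAll1 x q \<in> subformulas (pm True ?root)" | "WAll1 x q \<in> subformulas (psi c xs)"
      unfolding long_def by (auto simp del: fitems.simps pm.simps)
    then show "q \<in> aUMSO"
    proof cases
      case 1
      then show ?thesis using psi by simp
    next
      case 2
      then show ?thesis by (rule WAll1_pm)
    next
      case 3
      then show ?thesis unfolding psi_def by (rule choice_WAll1) (rule WAll1_pm)
    qed
  qed
  moreover have "sentence \<phi>"
  proof -
    have "wfree1 \<phi> \<subseteq> {}" unfolding \<phi>_def long_def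
      using psi1 wfree1_pm[of ?root True] fv0[of "[Vr i0]"]
      by (intro choice_wfree1) (auto simp: fv0 simp del: fitems.simps)
    moreover have "wfree2 \<phi> = {}" unfolding \<phi>_def long_def
      by (intro choice_wfree2) (simp_all add: psi2 wfree2_pm del: fitems.simps)
    ultimately show ?thesis by (simp add: sentence_def)
  qed
  moreover have "nest_sem \<phi> = S"
  proof
    fix w
    show "nest_sem \<phi> w = S w"
    proof (cases "w = []")
      case False
      have sem: "sentence_sem \<phi> (yield t, nu t) = (\<Sum>v\<in>set ws. S v * item_weight c (map Lt v) t) + item_weight c [Vr i0] t" for t
      proof -
        have items: "msat (yield t, nu t) s (fitems (ffirst 0) 0 l) \<longleftrightarrow> items t = l" for l s
          using msat_fitems[OF nu_Nest[of t] starts_ffirst] items_at_emb[OF nu_Nest[of t] emb_self[of t]]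
          by (auto simp: block_end_def)
        have prod: "(\<Prod>x\<in>{1..len t}. wsem (yield t, nu t) (s(0 := x)) (\<lambda>_. {}) (psi c xs)) = code_weight c t" for s
          using wsem_psi_prod[OF nu_Nest[of t] xs(2,1) H(2) c emb_self[of t], where s = s]
          by (simp add: atLeastSucAtMost_greaterThanAtMost)
        have long: "wsem (yield t, nu t) s (\<lambda>_. {}) long = item_weight c [Vr i0] t" for s
          unfolding long_def wsem.simps fst_conv prod by (subst wsem_pm) (simp_all add: items item_weight_def del: fitems.simps)
        have "sentence_sem \<phi> (yield t, nu t) = (\<Sum>v\<in>set ws. if items t = map Lt v then S v else 0) + item_weight c [Vr i0] t"
          unfolding sentence_sem_def \<phi>_def
          by (subst wsem_choice[OF _ ws(2)]) (simp_all add: items long)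
        also have "(\<Sum>v\<in>set ws. if items t = map Lt v then S v else 0) = (\<Sum>v\<in>set ws. S v * item_weight c (map Lt v) t)"
          by (intro sum.cong refl) (simp add: item_weight_def code_weight_letters)
        finally show ?thesis .
      qed
      have "nest_sem \<phi> w = cf (ysum (\<lambda>t. sentence_sem \<phi> (yield t, nu t))) w"
        using cf_ysum_Nest[of "\<lambda>w \<nu>. sentence_sem \<phi> (w, \<nu>)" w] False by (simp add: nest_sem_def)
      also have "\<dots> = (\<Sum>v\<in>set ws. S v * cf (ysum (item_weight c (map Lt v))) w) + cf (ysum (item_weight c [Vr i0])) w"
        unfolding cf_ysum sem sum.distrib sum_distrib_left by (subst sum.swap) simp
      also have "\<dots> = (\<Sum>v\<in>set ws. if w = v then S v else 0) + cf (longer m (Ser S)) w"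
        by (simp add: ysumF i0 evi_word[where \<sigma> = "\<lambda>x. x"] cf_ev_word if_distrib[of "\<lambda>x. _ * x"] cong: if_cong)
      also have "\<dots> = S w" by (subst sum.delta'[OF finite_set]) (simp add: ws(1) cf_cut)
      finally show ?thesis .
    qed (simp add: nest_sem_def S(2))
  qed
  ultimately show ?thesis by (intro exI[of _ \<phi>]) (auto simp: sRFO_def)
qed


theorem theorem6p9:
  fixes S :: "'a::finite list \<Rightarrow> 'k::comm_semiring_1"
  shows "(algebraic S \<longleftrightarrow> (\<exists>R :: 'a nword \<Rightarrow> 'k. regular_nw_series R \<and> S = proj R))
       \<and> (algebraic S \<longleftrightarrow> (\<exists>\<phi> :: ('a, 'k) wf. \<phi> \<in> sRFO \<and> sentence \<phi> \<and> nest_sem \<phi> = S))"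
  using algebraic_iff_regular[of S] algebraic_imp_logic[of S] logic_imp_algebraic by blast

end
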